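(* Let $w\in W$ and set $d_w=\max\{\operatorname{dp}_\infty(\gamma)\mid\gamma\in\Phi^R(w)\}$. Then: (1) $\operatorname{dp}_\infty(\beta)\le d_w$ for all $\beta\in\Phi^1(w)$ (the dominance-depth on $\Phi^1(w)$ reaches its maximum on $\Phi^R(w)$); (2) $w$ is a $d_w$-low element, i.e. $w\in L_{d_w}$; (3) for $m\in\mathbb N$, $w\in L_m$ if and only if $m\ge d_w$.
   Context: Let $(W,S)$ be a Coxeter system with length function $\ell$, realized via a geometric representation on a real vector space $V$ with symmetric bilinear form $B$, simple roots $\Delta=\{\alpha_s\mid s\in S\}$ ($B(\alpha_s,\alpha_s)=1$), root system $\Phi=W(\Delta)$, positive roots $\Phi^+=\Phi\cap\operatorname{cone}(\Delta)$, $\Phi^-=-\Phi^+$. For $\beta\in\Phi$, $s_\beta$ is the reflection in $\beta$. $\Phi(w)=\Phi^+\cap w(\Phi^-)$; short inversions $\Phi^1(w)=\{\beta\in\Phi^+\mid\ell(s_\beta w)=\ell(w)-1\}$; right-descent roots $\Phi^R(w)=\{-w(\alpha_s)\mid s\in S,\ \ell(ws)<\ell(w)\}$. Dominance order on $\Phi^+$: $\alpha\preceq_{\operatorname{dom}}\beta$ iff for all $u\in W$, $\beta\in\Phi(u)\Rightarrow\alpha\in\Phi(u)$. Dominance-depth: $\operatorname{dp}_\infty(\beta)=|\{\alpha\in\Phi^+\setminus\{\beta\}\mid\alpha\preceq_{\operatorname{dom}}\beta\}|$. $m$-small roots: $\Sigma_m=\{\beta\in\Phi^+\mid\operatorname{dp}_\infty(\beta)\le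 m\}$. $m$-low elements: $L_m=\{u\in W\mid\Phi^1(u)\subseteq\Sigma_m\}$. *)

theory Defs
  imports
    "HOL-Algebra.Generated_Groups"
    "HOL-Algebra.Multiplicative_Group"
    "HOL-Analysis.Analysis"
begin

subsection \<open>Coxeter systems\<close>

definition word_prod :: "('g, 'b) monoid_scheme \<Rightarrow> 'g list \<Rightarrow> 'g" where
  "word_prod G xs = foldr (\<otimes>\<^bsub>G\<^esub>) xs \<one>\<^bsub>G\<^esub>"

text \<open>
  The congruence on words over \<open>S\<close> generated by the Coxeter relations \<open>(st)\<^sup>m = 1\<close>, where
  \<open>m\<close> is the order of \<open>st\<close>. The library's \<open>group.ord\<close> is 0 for elements of infinite order, and
  these give no relation. The case \<open>s = t\<close> gives \<open>ss = 1\<close>, so the quotient of the free monoid on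
  \<open>S\<close> is the group presented by the Coxeter relations.
\<close>

inductive coxeter_cong :: "('g, 'b) monoid_scheme \<Rightarrow> 'g set \<Rightarrow> 'g list \<Rightarrow> 'g list \<Rightarrow> bool"
  for G and S where
  refl: "xs \<in> lists S \<Longrightarrow> coxeter_cong G S xs xs"
| sym: "coxeter_cong G S xs ys \<Longrightarrow> coxeter_cong G S ys xs"
| trans: "coxeter_cong G S xs ys \<Longrightarrow> coxeter_cong G S ys zs \<Longrightarrow> coxeter_cong G S xs zs"
| relator: "s \<in> S \<Longrightarrow> t \<in> S \<Longrightarrow> group.ord G (s \<otimes>\<^bsub>G\<^esub> t) \<noteq> 0 \<Longrightarrow> xs \<in> lists S \<Longrightarrow> ys \<in> lists S \<Longrightarrow>
    coxeter_cong G S (xs @ concat (replicate (group.ord G (s \<otimes>\<^bsub>G\<^esub> t)) [s, t]) @ ys) (xs @ ys)"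

locale coxeter_system = group G for G (structure) +
  fixes S :: "'a set"
  assumes gens_subset: "S \<subseteq> carrier G"
    and gens_generate: "generate G S = carrier G"
    and gens_order: "s \<in> S \<Longrightarrow> ord s = 2"
    and presentation: "xs \<in> lists S \<Longrightarrow> ys \<in> lists S \<Longrightarrow> word_prod G xs = word_prod G ys \<Longrightarrow>
      coxeter_cong G S xs ys"

definition cox_length :: "('g, 'b) monoid_scheme \<Rightarrow> 'g set \<Rightarrow> 'g \<Rightarrow> nat" where
  "cox_length G S w = (LEAST n. \<exists>xs \<in> lists S. length xs = n \<and> word_prod G xs = w)"


subsection \<open>Geometric representations\<close>

text \<open>
  The group \<open>W\<close> is the monoid part of the record; \<open>simple_root\<close> is only meaningful on \<open>gens\<close>, and
  \<open>action\<close> only on the carrier.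
\<close>

record ('g, 'v) coxeter_rep = "'g monoid" +
  gens :: "'g set"
  form :: "'v \<Rightarrow> 'v \<Rightarrow> real"
  simple_root :: "'g \<Rightarrow> 'v"
  action :: "'g \<Rightarrow> 'v \<Rightarrow> 'v"

definition reflection :: "('v::real_vector \<Rightarrow> 'v \<Rightarrow> real) \<Rightarrow> 'v \<Rightarrow> 'v \<Rightarrow> 'v" where
  "reflection B \<beta> v = v - (2 * B \<beta> v) *\<^sub>R \<beta>"

text \<open>
  The simple roots are only assumed to be positively independent (linearly independent simple
  roots are a special case), and for \<open>st\<close> of infinite order \<open>B(\<alpha>\<^sub>s, \<alpha>\<^sub>t)\<close> may be any number
  \<open>\<le> -1\<close>; this covers the usual notions of geometric representation. Neither the rank nor the
  dimension is assumed to be finite.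
\<close>

locale geometric_representation =
  coxeter_system W "gens W" for W :: "('g, 'v::real_vector) coxeter_rep" (structure) +
  assumes form_bilinear: "bilinear (form W)"
    and form_sym: "form W x y = form W y x"
    and form_simple_root: "s \<in> gens W \<Longrightarrow> form W (simple_root W s) (simple_root W s) = 1"
    and form_finite: "s \<in> gens W \<Longrightarrow> t \<in> gens W \<Longrightarrow> s \<noteq> t \<Longrightarrow> ord (s \<otimes> t) \<noteq> 0 \<Longrightarrow>
      form W (simple_root W s) (simple_root W t) = - cos (pi / real (ord (s \<otimes> t)))"
    and form_infinite: "s \<in> gens W \<Longrightarrow> t \<in> gens W \<Longrightarrow> s \<noteq> t \<Longrightarrow> ord (s \<otimes> t) = 0 \<Longrightarrow>
      form W (simple_root W s) (simple_root W t) \<le> - 1"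
    and positively_independent: "finite F \<Longrightarrow> F \<subseteq> gens W \<Longrightarrow> (\<And>s. s \<in> F \<Longrightarrow> 0 \<le> c s) \<Longrightarrow>
      (\<Sum>s\<in>F. c s *\<^sub>R simple_root W s) = 0 \<Longrightarrow> s \<in> F \<Longrightarrow> c s = 0"
    and action_linear: "w \<in> carrier W \<Longrightarrow> linear (action W w)"
    and action_one: "action W \<one> = id"
    and action_mult: "u \<in> carrier W \<Longrightarrow> w \<in> carrier W \<Longrightarrow>
      action W (u \<otimes> w) = action W u \<circ> action W w"
    and action_gens: "s \<in> gens W \<Longrightarrow> action W s = reflection (form W) (simple_root W s)"


subsection \<open>Roots and inversions\<close>

abbreviation len :: "('g, 'v) coxeter_rep \<Rightarrow> 'g \<Rightarrow> nat" where
  "len W \<equiv> cox_length W (gens W)"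

definition roots :: "('g, 'v) coxeter_rep \<Rightarrow> 'v set" where
  "roots W = {action W w (simple_root W s) | w s. w \<in> carrier W \<and> s \<in> gens W}"

text \<open>The library's \<open>cone hull\<close> need not be convex; \<open>convex_cone hull\<close> is the set of all
  non-negative linear combinations.\<close>

definition pos_roots :: "('g, 'v::real_vector) coxeter_rep \<Rightarrow> 'v set" where
  "pos_roots W = roots W \<inter> convex_cone hull (simple_root W ` gens W)"

definition neg_roots :: "('g, 'v::real_vector) coxeter_rep \<Rightarrow> 'v set" where
  "neg_roots W = uminus ` pos_roots W"

text \<open>
  The element of \<open>W\<close> that acts as the reflection in the root \<open>\<beta>\<close>: for \<open>\<beta> = w(\<alpha>\<^sub>s)\<close> it is
  \<open>w s w\<^sup>-\<^sup>1\<close>, and it is unique because the action is faithful.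
\<close>

definition root_reflection :: "('g, 'v::real_vector) coxeter_rep \<Rightarrow> 'v \<Rightarrow> 'g" where
  "root_reflection W \<beta> = (THE g. g \<in> carrier W \<and> action W g = reflection (form W) \<beta>)"

definition inversions :: "('g, 'v::real_vector) coxeter_rep \<Rightarrow> 'g \<Rightarrow> 'v set" where
  "inversions W w = pos_roots W \<inter> action W w ` neg_roots W"

definition short_inversions :: "('g, 'v::real_vector) coxeter_rep \<Rightarrow> 'g \<Rightarrow> 'v set" where
  "short_inversions W w =
    {\<beta> \<in> pos_roots W. int (len W (root_reflection W \<beta> \<otimes>\<^bsub>W\<^esub> w)) = int (len W w) - 1}"

definition right_descent_roots :: "('g, 'v::real_vector) coxeter_rep \<Rightarrow> 'g \<Rightarrow> 'v set" where
  "right_descent_roots W w =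
    {- action W w (simple_root W s) | s. s \<in> gens W \<and> len W (w \<otimes>\<^bsub>W\<^esub> s) < len W w}"


subsection \<open>Dominance order, small roots and low elements\<close>

definition dominates :: "('g, 'v::real_vector) coxeter_rep \<Rightarrow> 'v \<Rightarrow> 'v \<Rightarrow> bool" where
  "dominates W \<beta> \<alpha> \<longleftrightarrow> \<alpha> \<in> pos_roots W \<and> \<beta> \<in> pos_roots W \<and>
    (\<forall>u \<in> carrier W. \<beta> \<in> inversions W u \<longrightarrow> \<alpha> \<in> inversions W u)"

text \<open>
  The set counted here is finite (so \<open>card\<close> is its true cardinality): the roots dominated by
  \<open>\<beta>\<close> are all inversions of the reflection in \<open>\<beta>\<close>.
\<close>

definition dominance_depth :: "('g, 'v::real_vector) coxeter_rep \<Rightarrow> 'v \<Rightarrow> nat" where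
  "dominance_depth W \<beta> = card {\<alpha> \<in> pos_roots W - {\<beta>}. dominates W \<beta> \<alpha>}"

definition small_roots :: "('g, 'v::real_vector) coxeter_rep \<Rightarrow> nat \<Rightarrow> 'v set" where
  "small_roots W m = {\<beta> \<in> pos_roots W. dominance_depth W \<beta> \<le> m}"

definition low_elements :: "('g, 'v::real_vector) coxeter_rep \<Rightarrow> nat \<Rightarrow> 'g set" where
  "low_elements W m = {u \<in> carrier W. short_inversions W u \<subseteq> small_roots W m}"

text \<open>
  The number \<open>d\<^sub>w\<close>. The identity is the only element without right descents, and the maximum over
  the empty set is taken to be 0. Right-descent roots are inversions of \<open>w\<close>, so there are finitely
  many.
\<close>

definition max_descent_depth :: "('g, 'v::real_vector) coxeter_rep \<Rightarrow> 'g \<Rightarrow> nat" where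
  "max_descent_depth W w = (if right_descent_roots W w = {} then 0
    else Max (dominance_depth W ` right_descent_roots W w))"

end

theory Submission
  imports Defs
begin

text \<open>Put \<open>y = w\<^sup>-\<^sup>1\<close>. A short inversion \<open>\<beta>\<close> of \<open>w\<close> corresponds to the short inversion \<open>\<delta> = -w\<^sup>-\<^sup>1(\<beta>)\<close> of \<open>y\<close>, and
  right-descent roots of \<open>w\<close> correspond to the simple ones among these. So it is enough to replace a
  non-simple \<open>\<delta>\<close> by one of smaller depth without decreasing the dominance depth of \<open>-y\<^sup>-\<^sup>1(\<delta>)\<close>. The
  basic step takes \<open>\<delta> = a \<alpha>\<^sub>s + b \<eta>\<close> to \<open>\<alpha>\<^sub>s\<close>, for a descent \<open>s\<close> of \<open>y\<close>. A short inversion is never strictly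
  between two inversions, hence \<open>-y\<^sup>-\<^sup>1(\<delta>)\<close> is an extreme positive root of the plane that it spans
  with \<open>-y\<^sup>-\<^sup>1(\<alpha>\<^sub>s)\<close>. If this plane is not positive definite, the two roots are comparable in the dominance
  order. Otherwise its roots have the angles \<open>j \<pi> / n\<close>, and dominance depths are compared along the
  half circle by means of \<open>dp \<kappa> \<le> dp (s\<^sub>\<xi> \<kappa>)\<close>, valid for positive \<open>\<xi>\<close>, \<open>\<kappa>\<close> with \<open>B(\<xi>, \<kappa>) \<le> 0\<close>; only the step
  from the angle \<open>0\<close> to \<open>\<pi> / n\<close> for even \<open>n\<close> needs a separate argument.\<close>

subsection \<open>Words and length\<close>

text \<open>A reflection of a plane whose roots have the angles \<open>j * pi / n\<close> sends the
  index \<open>j\<close> to \<open>2 * m - j\<close> modulo \<open>n\<close>. For even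
  \<open>n\<close> the parity of the index is therefore invariant, and comparing a root with its
  mirror image never relates an even to an odd index. That crossing needs control of the values of
  the form. Dominance is first expressed by the form: distinct roots are comparable exactly when
  their product is at least 1. A root dominated by the first vector but not by the second then
  becomes, in the standard parabolic position, a positive root outside the plane whose products with
  the two simple roots lie in a narrow region. Induction on depth shows that such products are
  quantized. With \<open>c = cos (pi / n)\<close> and \<open>n \<ge> 6\<close>, the squared norm of
  the projection to the plane avoids the open intervals from 0 to 1 and from 1 to 4/3, while the
  narrow region keeps it below \<open>1 / c^2 \<le> 4/3\<close>; only one position remains. For
  \<open>n = 4\<close> the bound \<open>1 / c^2\<close> is 2 and this gap is too small, so a
  condition on the products with all four positive roots of the plane takes its place.\<close>

context coxeter_system
begin

abbreviation "wp \<equiv> word_prod G"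
abbreviation "lg \<equiv> cox_length G S"

lemma gens_closed: "s \<in> S \<Longrightarrow> s \<in> carrier G"
  using gens_subset by auto

lemma gens_square: "s \<in> S \<Longrightarrow> s \<otimes> s = \<one>"
  using pow_ord_eq_1[of s] gens_order[of s] gens_closed[of s]
  by (simp add: numeral_2_eq_2)

lemma gens_inv: "s \<in> S \<Longrightarrow> inv s = s"
  using gens_square gens_closed by (simp add: inv_equality)

lemma gens_not_one: "s \<in> S \<Longrightarrow> s \<noteq> \<one>"
  using gens_order[of s] ord_eq_1[of \<one>] by auto

lemma word_prod_Nil [simp]: "wp [] = \<one>"
  and word_prod_Cons [simp]: "wp (x # xs) = x \<otimes> wp xs"
  by (simp_all add: word_prod_def)

lemma word_prod_closed [simp]: "xs \<in> lists S \<Longrightarrow> wp xs \<in> carrier G"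
  by (induction xs) (auto simp: gens_closed)

lemma word_prod_append:
  "xs \<in> lists S \<Longrightarrow> ys \<in> lists S \<Longrightarrow> wp (xs @ ys) = wp xs \<otimes> wp ys"
  by (induction xs) (auto simp: gens_closed m_assoc)

lemma word_prod_rev: "xs \<in> lists S \<Longrightarrow> wp (rev xs) = inv (wp xs)"
proof (induction xs)
  case (Cons a xs)
  then have "rev xs \<in> lists S" "[a] \<in> lists S" by (auto simp: in_lists_conv_set)
  then show ?case using Cons
    by (auto simp: gens_closed word_prod_append inv_mult_group gens_inv simp del: lists.Cons)
qed simp

lemma word_exists:
  assumes "w \<in> carrier G"
  shows "\<exists>xs \<in> lists S. wp xs = w"
proof -
  have "w \<in> generate G S" using assms gens_generate by simp
  then show ?thesis
  proof (induction rule: generate.induct)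
    case one then show ?case by (intro bexI[of _ "[]"]) auto
  next
    case (incl h) then show ?case by (intro bexI[of _ "[h]"]) (auto simp: gens_closed)
  next
    case (inv h) then show ?case by (intro bexI[of _ "[h]"]) (auto simp: gens_closed gens_inv)
  next
    case (eng h1 h2)
    then obtain xs ys where "xs \<in> lists S" "ys \<in> lists S" "wp xs = h1" "wp ys = h2" by blast
    then show ?case by (intro bexI[of _ "xs @ ys"]) (auto simp: word_prod_append)
  qed
qed

lemma length_le_word: "xs \<in> lists S \<Longrightarrow> lg (wp xs) \<le> length xs"
  unfolding cox_length_def by (rule Least_le) blast

lemma reduced_word_exists:
  assumes "w \<in> carrier G"
  shows "\<exists>xs \<in> lists S. wp xs = w \<and> length xs = lg w"
proof -
  have "\<exists>n. \<exists>xs \<in> lists S. length xs = n \<and> wp xs = w"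
    using word_exists[OF assms] by blast
  from LeastI_ex[OF this] show ?thesis unfolding cox_length_def by blast
qed

lemma length_one [simp]: "lg \<one> = 0"
  using length_le_word[of "[]"] by simp

lemma length_eq_0: "w \<in> carrier G \<Longrightarrow> lg w = 0 \<longleftrightarrow> w = \<one>"
  using reduced_word_exists[of w] by auto

lemma length_mult_le:
  assumes "u \<in> carrier G" "v \<in> carrier G"
  shows "lg (u \<otimes> v) \<le> lg u + lg v"
proof -
  obtain xs ys where "xs \<in> lists S" "ys \<in> lists S" "wp xs = u" "wp ys = v"
    "length xs = lg u" "length ys = lg v"
    using reduced_word_exists assms by meson
  then show ?thesis using length_le_word[of "xs @ ys"] by (auto simp: word_prod_append)
qed

lemma length_inv:
  assumes "w \<in> carrier G"
  shows "lg (inv w) = lg w"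
proof -
  have le: "lg (inv w) \<le> lg w" if w: "w \<in> carrier G" for w
  proof -
    obtain xs where "xs \<in> lists S" "wp xs = w" "length xs = lg w"
      using reduced_word_exists w by meson
    moreover from this have "rev xs \<in> lists S" by (auto simp: in_lists_conv_set)
    ultimately show ?thesis using length_le_word[of "rev xs"] by (auto simp: word_prod_rev)
  qed
  show ?thesis using le[of w] le[of "inv w"] assms by simp
qed

text \<open>Every relator has even length, so the parity of a word depends only on its value. This
  is how the presentation enters: multiplying by a generator cannot keep the length.\<close>

lemma coxeter_cong_parity: "coxeter_cong G S xs ys \<Longrightarrow> even (length xs) \<longleftrightarrow> even (length ys)"
proof (induction rule: coxeter_cong.induct)
  case (relator s t xs ys)
  have "length (concat (replicate n [s, t])) = 2 * n" for n by (induction n) auto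
  then show ?case by simp
qed auto

lemma word_parity:
  "xs \<in> lists S \<Longrightarrow> even (lg (wp xs)) \<longleftrightarrow> even (length xs)"
  using reduced_word_exists[of "wp xs"] presentation coxeter_cong_parity
  by (metis word_prod_closed)

lemma length_mult_parity:
  assumes "u \<in> carrier G" "v \<in> carrier G"
  shows "even (lg (u \<otimes> v)) \<longleftrightarrow> even (lg u + lg v)"
proof -
  obtain xs ys where "xs \<in> lists S" "ys \<in> lists S" "wp xs = u" "wp ys = v"
    "length xs = lg u" "length ys = lg v"
    using reduced_word_exists assms by meson
  then show ?thesis using word_parity[of "xs @ ys"] by (auto simp: word_prod_append)
qed

lemma length_gen [simp]: "s \<in> S \<Longrightarrow> lg s = 1"
  using length_le_word[of "[s]"] gens_closed[of s] gens_not_one[of s] length_eq_0[of s] by auto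

lemma gen_cancel_right [simp]: "s \<in> S \<Longrightarrow> w \<in> carrier G \<Longrightarrow> w \<otimes> s \<otimes> s = w"
  by (simp add: gens_closed gens_square m_assoc)

lemma gen_cancel_left [simp]: "s \<in> S \<Longrightarrow> w \<in> carrier G \<Longrightarrow> s \<otimes> (s \<otimes> w) = w"
  by (simp add: gens_closed gens_square flip: m_assoc)

lemma length_mult_gen_cases:
  assumes "s \<in> S" "w \<in> carrier G"
  shows "lg (w \<otimes> s) = lg w + 1 \<or> lg w = lg (w \<otimes> s) + 1"
proof -
  have c: "s \<in> carrier G" "w \<otimes> s \<in> carrier G" using assms gens_closed by auto
  have "lg (w \<otimes> s) \<le> lg w + 1" using length_mult_le[of w s] assms c by simp
  moreover have "lg w \<le> lg (w \<otimes> s) + 1" using length_mult_le[of "w \<otimes> s" s] assms c by simp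
  moreover have "even (lg (w \<otimes> s)) \<longleftrightarrow> even (lg w + 1)"
    using length_mult_parity[of w s] assms c by simp
  then have "lg (w \<otimes> s) \<noteq> lg w" by auto
  ultimately show ?thesis by linarith
qed

lemma length_gen_mult_inv:
  assumes "s \<in> S" "w \<in> carrier G"
  shows "lg (s \<otimes> w) = lg (inv w \<otimes> s)"
  using length_inv[of "s \<otimes> w"] assms by (simp add: gens_closed inv_mult_group gens_inv)

lemma length_gen_mult_cases:
  assumes "s \<in> S" "w \<in> carrier G"
  shows "lg (s \<otimes> w) = lg w + 1 \<or> lg w = lg (s \<otimes> w) + 1"
  using length_mult_gen_cases[of s "inv w"] length_gen_mult_inv[OF assms] length_inv[of w] assms by simp

lemma exists_right_descent:
  assumes "w \<in> carrier G" "w \<noteq> \<one>"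
  shows "\<exists>s \<in> S. lg (w \<otimes> s) < lg w"
proof -
  obtain xs where xs: "xs \<in> lists S" "wp xs = w" "length xs = lg w"
    using reduced_word_exists assms by meson
  then have "xs \<noteq> []" using assms by auto
  then obtain ys s where ys: "xs = ys @ [s]" using rev_exhaust by blast
  then have s: "s \<in> S" "ys \<in> lists S" using xs by auto
  then have "w = wp ys \<otimes> s" using xs ys by (auto simp: word_prod_append gens_closed)
  then have "w \<otimes> s = wp ys" using s by (simp)
  then have "lg (w \<otimes> s) < lg w" using length_le_word[of ys] xs ys s by simp
  then show ?thesis using s by blast
qed

lemma exists_left_descent:
  assumes "w \<in> carrier G" "w \<noteq> \<one>"
  shows "\<exists>s \<in> S. lg (s \<otimes> w) < lg w"
  using exists_right_descent[of "inv w"] length_gen_mult_inv length_inv[of w] assms by auto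

text \<open>The alternating word of length \<open>k\<close> in \<open>s\<close> and \<open>t\<close> that ends in \<open>t\<close>.\<close>

fun alternating :: "'a \<Rightarrow> 'a \<Rightarrow> nat \<Rightarrow> 'a list" where
  "alternating s t 0 = []"
| "alternating s t (Suc k) = (if even k then t else s) # alternating s t k"

lemma alternating_in_lists: "s \<in> S \<Longrightarrow> t \<in> S \<Longrightarrow> alternating s t k \<in> lists S"
  by (induction k) auto

lemma set_alternating: "set (alternating s t k) \<subseteq> {s, t}"
  by (induction k) auto

lemma length_alternating [simp]: "length (alternating s t k) = k"
  by (induction k) auto

lemma alternating_unique:
  "s \<noteq> t \<Longrightarrow> set xs \<subseteq> {s, t} \<Longrightarrow> distinct_adj xs \<Longrightarrow> xs = [] \<or> last xs = t \<Longrightarrow>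
    xs = alternating s t (length xs)"
proof (induction xs)
  case (Cons a xs)
  show ?case
  proof (cases xs)
    case Nil then show ?thesis using Cons by auto
  next
    case (Cons b ys)
    then have eq: "xs = alternating s t (length xs)"
      using Cons.IH Cons.prems by (auto simp: distinct_adj_Cons)
    have len: "length xs = Suc (length ys)" using Cons by simp
    have "b = (if even (length ys) then t else s)" using eq Cons len by simp
    moreover have "a \<noteq> b" "a \<in> {s,t}" using Cons.prems Cons by (auto)
    ultimately have "a = (if even (length xs) then t else s)" using len Cons.prems(1) by auto
    then show ?thesis using eq by simp
  qed
qed simp

section \<open>Alternating words and the braid relation\<close>

lemma conj_pow:
  assumes "s \<in> S" "t \<in> S"
  shows "t \<otimes> ((s \<otimes> t) [^] (k::nat)) \<otimes> s = (t \<otimes> s) [^] Suc k"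
proof (induction k)
  case 0 then show ?case using assms by (simp add: gens_closed)
next
  case (Suc k)
  have c: "s \<in> carrier G" "t \<in> carrier G" using assms gens_closed by auto
  have "t \<otimes> ((s \<otimes> t) [^] Suc k) \<otimes> s = (t \<otimes> ((s \<otimes> t) [^] k) \<otimes> s) \<otimes> (t \<otimes> s)"
    using c by (simp add: m_assoc)
  then show ?case using Suc by simp
qed

text \<open>Prefixing a letter to each word wraps the quotient between two letters, and
  \<open>conj_pow\<close> turns this into the next power of the opposite product. At
  \<open>k = ord (s \<otimes> t)\<close> both powers are trivial, which is the braid
  relation.\<close>

lemma alternating_quotient:
  assumes "s \<in> S" "t \<in> S"
  shows "wp (alternating s t k) \<otimes> inv (wp (alternating t s k)) =
    (if even k then (s \<otimes> t) [^] k else (t \<otimes> s) [^] k)"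
proof (induction k)
  case 0 then show ?case by simp
next
  case (Suc k)
  have c: "s \<in> carrier G" "t \<in> carrier G" using assms gens_closed by auto
  have a: "wp (alternating s t k) \<in> carrier G" "wp (alternating t s k) \<in> carrier G"
    using assms alternating_in_lists by auto
  define x where "x = (if even k then t else s)"
  define z where "z = (if even k then s else t)"
  have xz: "x \<in> carrier G" "z \<in> carrier G" "inv z = z"
    using c assms gens_inv unfolding x_def z_def by auto
  have "wp (alternating s t (Suc k)) \<otimes> inv (wp (alternating t s (Suc k))) =
    x \<otimes> (wp (alternating s t k) \<otimes> inv (wp (alternating t s k))) \<otimes> z"
    using xz a by (simp add: x_def[symmetric] z_def[symmetric] inv_mult_group m_assoc)
  also have "\<dots> = (if even (Suc k) then (s \<otimes> t) [^] Suc k else (t \<otimes> s) [^] Suc k)"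
    unfolding Suc.IH using conj_pow[OF assms] conj_pow[OF assms(2,1)] by (simp add: x_def z_def)
  finally show ?case .
qed

lemma alternating_braid:
  assumes "s \<in> S" "t \<in> S"
  shows "wp (alternating s t (ord (s \<otimes> t))) = wp (alternating t s (ord (s \<otimes> t)))"
proof -
  let ?m = "ord (s \<otimes> t)"
  have c: "s \<in> carrier G" "t \<in> carrier G" using assms gens_closed by auto
  have "(t \<otimes> s) = inv (s \<otimes> t)" using c assms by (simp add: inv_mult_group gens_inv)
  then have "(t \<otimes> s) [^] ?m = \<one>" "(s \<otimes> t) [^] ?m = \<one>"
    using c pow_ord_eq_1[of "s \<otimes> t"] by (simp_all add: nat_pow_inv)
  then have "wp (alternating s t ?m) \<otimes> inv (wp (alternating t s ?m)) = \<one>"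
    using alternating_quotient[OF assms, of ?m] by simp
  then show ?thesis using assms alternating_in_lists
    by (metis inv_closed inv_equality inv_inv word_prod_closed)
qed

lemma alternating_append:
  "\<exists>zs. set zs \<subseteq> {s, t} \<and> alternating s t (k + m) = zs @ alternating s t m \<and> length zs = k"
  by (induction k) (auto intro: exI[of _ "_ # _"])

lemma alternating_last: "alternating s t (Suc k) = butlast (alternating s t (Suc k)) @ [t]"
proof -
  have "last (alternating s t (Suc k)) = t" by (induction k) auto
  then show ?thesis
    by (metis alternating.simps(2) append_butlast_last_id list.discI)
qed

end

subsection \<open>Chebyshev polynomials of the second kind\<close>

text \<open>The index is shifted by one, so that \<open>cheb (cos \<theta>) k\<close> is
  \<open>sin (k * \<theta>) / sin \<theta>\<close>. The values are the coefficients that appear when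
  an alternating word in two reflections is applied to a simple root.\<close>

fun cheb :: "real \<Rightarrow> nat \<Rightarrow> real" where
  "cheb c 0 = 0"
| "cheb c (Suc 0) = 1"
| "cheb c (Suc (Suc k)) = 2 * c * cheb c (Suc k) - cheb c k"

lemma cheb_sin: "cheb (cos \<theta>) k * sin \<theta> = sin (real k * \<theta>)"
proof (induction "cos \<theta>" k rule: cheb.induct)
  case (3 k)
  have "sin (real k * \<theta>) + sin (real (Suc (Suc k)) * \<theta>) = 2 * cos \<theta> * sin (real (Suc k) * \<theta>)"
    using sin_add[of "real (Suc k) * \<theta>" \<theta>] sin_diff[of "real (Suc k) * \<theta>" \<theta>]
    by (simp add: algebra_simps)
  then show ?case using 3 by (simp add: algebra_simps)
qed auto

text \<open>Growth by at least 1 serves twice: it gives the signs when \<open>s \<otimes> t\<close>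
  has infinite order, and it later makes infinitely many roots of a plane distinct.\<close>

lemma cheb_step_ge_1:
  assumes "1 \<le> c"
  shows "0 \<le> cheb c k \<and> cheb c k + 1 \<le> cheb c (Suc k)"
proof (induction k)
  case (Suc k)
  have "2 * cheb c (Suc k) \<le> 2 * c * cheb c (Suc k)"
    using Suc assms mult_right_mono[of 2 "2 * c" "cheb c (Suc k)"] by simp
  then show ?case unfolding cheb.simps using Suc by linarith
qed simp

subsection \<open>The form, the action and the positive cone\<close>

context geometric_representation
begin

abbreviation "S \<equiv> gens W"
abbreviation "B \<equiv> form W"
abbreviation "\<alpha> \<equiv> simple_root W"
abbreviation "act \<equiv> action W"
abbreviation "C \<equiv> convex_cone hull (\<alpha> ` S)"

lemma form_simps [simp]:
  "B (x + y) z = B x z + B y z" "B x (y + z) = B x y + B x z"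
  "B (x - y) z = B x z - B y z" "B x (y - z) = B x y - B x z"
  "B (a *\<^sub>R x) y = a * B x y" "B x (a *\<^sub>R y) = a * B x y"
  "B (- x) y = - B x y" "B x (- y) = - B x y"
  "B 0 x = 0" "B x 0 = 0"
  using form_bilinear
  by (simp_all add: bilinear_ladd bilinear_radd bilinear_lmul bilinear_rmul bilinear_lneg
      bilinear_rneg bilinear_lzero bilinear_rzero bilinear_lsub bilinear_rsub)

lemma form_sum_right: "B x (\<Sum>i\<in>A. f i) = (\<Sum>i\<in>A. B x (f i))"
  by (induction A rule: infinite_finite_induct) auto

lemma ord_gens_ge_2:
  assumes "s \<in> S" "t \<in> S" "s \<noteq> t" "ord (s \<otimes> t) \<noteq> 0"
  shows "2 \<le> ord (s \<otimes> t)"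
proof -
  have "ord (s \<otimes> t) \<noteq> 1"
  proof
    assume "ord (s \<otimes> t) = 1"
    then have "s \<otimes> t = \<one>" using ord_eq_1 assms gens_closed by simp
    then show False using assms gens_closed gens_inv inv_equality by metis
  qed
  then show ?thesis using assms by simp
qed

lemma form_simple_nonpos:
  assumes "s \<in> S" "t \<in> S" "s \<noteq> t"
  shows "B (\<alpha> s) (\<alpha> t) \<le> 0"
proof (cases "ord (s \<otimes> t) = 0")
  case True then show ?thesis using form_infinite[OF assms] by simp
next
  case False
  have "2 \<le> ord (s \<otimes> t)" using ord_gens_ge_2[OF assms(1-3) False] .
  then have "0 \<le> cos (pi / real (ord (s \<otimes> t)))"
    by (intro cos_ge_zero) (auto simp: field_simps order_trans[of _ 0])
  then show ?thesis using form_finite[OF assms False] by simp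
qed

lemma act_simps [simp]:
  assumes "u \<in> carrier W"
  shows "act u (x + y) = act u x + act u y" "act u (x - y) = act u x - act u y"
    "act u (a *\<^sub>R x) = a *\<^sub>R act u x" "act u (- x) = - act u x" "act u 0 = 0"
  using action_linear[OF assms]
  by (simp_all add: linear_add linear_diff linear_cmul linear_neg linear_0)

lemma act_one [simp]: "act \<one> v = v"
  by (simp add: action_one)

lemma act_mult [simp]: "u \<in> carrier W \<Longrightarrow> w \<in> carrier W \<Longrightarrow> act (u \<otimes> w) v = act u (act w v)"
  by (simp add: action_mult)

lemma act_inv_cancel [simp]:
  "u \<in> carrier W \<Longrightarrow> act (inv u) (act u v) = v" "u \<in> carrier W \<Longrightarrow> act u (act (inv u) v) = v"
  by (simp_all flip: act_mult)

lemma act_gen: "s \<in> S \<Longrightarrow> act s v = v - (2 * B (\<alpha> s) v) *\<^sub>R \<alpha> s"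
  by (simp add: action_gens reflection_def)

lemma act_gen_simple: "s \<in> S \<Longrightarrow> act s (\<alpha> s) = - \<alpha> s"
  by (simp add: act_gen form_simple_root scaleR_2)

lemma act_gen_gen [simp]: "s \<in> S \<Longrightarrow> act s (act s v) = v"
  using act_mult[of s s v] gens_square gens_closed by simp

lemma word_induct [consumes 1, case_names one mult]:
  assumes "w \<in> carrier W" "P \<one>" "\<And>s u. s \<in> S \<Longrightarrow> u \<in> carrier W \<Longrightarrow> P u \<Longrightarrow> P (s \<otimes> u)"
  shows "P w"
proof -
  have "P (wp xs)" if "xs \<in> lists S" for xs
    using that by (induction xs) (auto simp: assms)
  then show ?thesis using word_exists[OF assms(1)] by blast
qed

lemma form_act [simp]: "w \<in> carrier W \<Longrightarrow> B (act w x) (act w y) = B x y"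
proof (induction w rule: word_induct)
  case (mult s u)
  have "B (act s x) (act s y) = B x y" for x y
    using mult(1) by (simp add: act_gen form_simple_root form_sym[of x "\<alpha> s"] algebra_simps)
  then show ?case using mult gens_closed by simp
qed simp

lemma form_act_inv: "w \<in> carrier W \<Longrightarrow> B (act (inv w) x) y = B x (act w y)"
  using form_act[of w "act (inv w) x" y] by simp

section \<open>Non-negative combinations of simple roots and their extremality\<close>

lemma cone_simple: "s \<in> S \<Longrightarrow> \<alpha> s \<in> C"
  by (intro hull_inc) auto

lemma cone_add: "x \<in> C \<Longrightarrow> y \<in> C \<Longrightarrow> x + y \<in> C"
  by (rule convex_cone_hull_add)

lemma cone_scale: "x \<in> C \<Longrightarrow> 0 \<le> a \<Longrightarrow> a *\<^sub>R x \<in> C"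
  by (rule convex_cone_hull_mul)

lemma cone_comb: "x \<in> C \<Longrightarrow> y \<in> C \<Longrightarrow> 0 \<le> a \<Longrightarrow> 0 \<le> b \<Longrightarrow> a *\<^sub>R x + b *\<^sub>R y \<in> C"
  by (simp add: cone_add cone_scale)

text \<open>The coefficients are non-negative everywhere and vanish off \<open>F\<close>, so
  \<open>F\<close> can be enlarged without touching \<open>c\<close>, and two vectors can be
  expanded over a common finite set. Expansions need not be unique, as the simple roots are only
  positively independent.\<close>

definition cone_coeffs :: "'g set \<Rightarrow> ('g \<Rightarrow> real) \<Rightarrow> 'v \<Rightarrow> bool" where
  "cone_coeffs F c v \<longleftrightarrow> finite F \<and> F \<subseteq> S \<and> (\<forall>s. 0 \<le> c s) \<and> (\<forall>s. s \<notin> F \<longrightarrow> c s = 0) \<and>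
    v = (\<Sum>s\<in>F. c s *\<^sub>R \<alpha> s)"

lemma cone_coeffs_mono:
  assumes "cone_coeffs F c v" "F \<subseteq> F'" "finite F'" "F' \<subseteq> S"
  shows "cone_coeffs F' c v"
proof -
  have "(\<Sum>s\<in>F. c s *\<^sub>R \<alpha> s) = (\<Sum>s\<in>F'. c s *\<^sub>R \<alpha> s)"
    using assms by (intro sum.mono_neutral_left) (auto simp: cone_coeffs_def)
  then show ?thesis using assms unfolding cone_coeffs_def by auto
qed

lemma cone_coeffs_exist:
  assumes "v \<in> C"
  shows "\<exists>F c. cone_coeffs F c v"
proof -
  let ?D = "{v. \<exists>F c. cone_coeffs F c v}"
  have "C \<subseteq> ?D"
  proof (rule hull_minimal)
    show "\<alpha> ` S \<subseteq> ?D"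
    proof clarify
      fix s assume "s \<in> S"
      then have "cone_coeffs {s} (\<lambda>t. if t = s then 1 else 0) (\<alpha> s)" by (simp add: cone_coeffs_def)
      then show "\<exists>F c. cone_coeffs F c (\<alpha> s)" by blast
    qed
    have "0 \<in> ?D" by (auto simp: cone_coeffs_def intro!: exI[of _ "{}"] exI[of _ "\<lambda>_. 0"])
    moreover have "x + y \<in> ?D" if xy: "x \<in> ?D" "y \<in> ?D" for x y
    proof -
      obtain F c F' c' where a: "cone_coeffs F c x" "cone_coeffs F' c' y" using xy by auto
      have f: "finite F" "finite F'" "F \<subseteq> S" "F' \<subseteq> S" using a by (auto simp: cone_coeffs_def)
      have "cone_coeffs (F \<union> F') c x" "cone_coeffs (F \<union> F') c' y"
        using f by (auto intro: cone_coeffs_mono[OF a(1)] cone_coeffs_mono[OF a(2)])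
      then have "cone_coeffs (F \<union> F') (\<lambda>s. c s + c' s) (x + y)"
        unfolding cone_coeffs_def by (auto simp: scaleR_add_left sum.distrib)
      then show ?thesis by blast
    qed
    moreover have "a *\<^sub>R x \<in> ?D" if ax: "0 \<le> a" "x \<in> ?D" for a x
    proof -
      obtain F c where "cone_coeffs F c x" using ax(2) by blast
      then have "cone_coeffs F (\<lambda>s. a * c s) (a *\<^sub>R x)"
        using ax unfolding cone_coeffs_def by (auto simp: scaleR_sum_right)
      then show ?thesis by blast
    qed
    ultimately show "convex_cone ?D" unfolding convex_cone_iff by blast
  qed
  then show ?thesis using assms by blast
qed

lemma cone_coeffs_exist2:
  assumes "v \<in> C" "w \<in> C" "G \<subseteq> S" "finite G"
  shows "\<exists>F c d. cone_coeffs F c v \<and> cone_coeffs F d w \<and> G \<subseteq> F"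
proof -
  obtain F c where a: "cone_coeffs F c v" using cone_coeffs_exist assms by blast
  obtain F' d where b: "cone_coeffs F' d w" using cone_coeffs_exist assms by blast
  have f: "finite F" "finite F'" "F \<subseteq> S" "F' \<subseteq> S" using a b by (auto simp: cone_coeffs_def)
  have "cone_coeffs (F \<union> F' \<union> G) c v" "cone_coeffs (F \<union> F' \<union> G) d w"
    using f assms by (auto intro!: cone_coeffs_mono[OF a(1)] cone_coeffs_mono[OF b])
  then show ?thesis by blast
qed

lemma cone_pointed:
  assumes "v \<in> C" "- v \<in> C"
  shows "v = 0"
proof -
  obtain F c d where c: "cone_coeffs F c v" and d: "cone_coeffs F d (- v)"
    using cone_coeffs_exist2[OF assms, of "{}"] by auto
  have F: "finite F" "F \<subseteq> S" "\<And>s. 0 \<le> c s" "\<And>s. 0 \<le> d s"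
    and v: "(\<Sum>s\<in>F. c s *\<^sub>R \<alpha> s) = v" and w: "(\<Sum>s\<in>F. d s *\<^sub>R \<alpha> s) = - v"
    using c d by (simp_all add: cone_coeffs_def)
  have "(\<Sum>s\<in>F. (c s + d s) *\<^sub>R \<alpha> s) = v + - v"
    by (simp only: scaleR_add_left sum.distrib v w)
  then have sum0: "(\<Sum>s\<in>F. (c s + d s) *\<^sub>R \<alpha> s) = 0" by simp
  have "c s = 0" if "s \<in> F" for s
  proof -
    have "c s + d s = 0"
      by (rule positively_independent[OF F(1,2) _ sum0 that]) (simp add: F)
    then show ?thesis using F(3)[of s] F(4)[of s] by linarith
  qed
  then show ?thesis unfolding v[symmetric] by simp
qed

text \<open>Without linear independence, coefficients cannot be compared directly. Pairing with
  \<alpha> s shows that \<open>k\<close> is at most the total coefficient of \<alpha> s, because the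
  other simple roots have non-positive product with it. Everything can then be moved to one side as
  a non-negative relation, which kills all other coefficients.\<close>

lemma simple_root_extreme:
  assumes "v \<in> C" "w \<in> C" "s \<in> S" "v + w = k *\<^sub>R \<alpha> s"
  shows "\<exists>a \<ge> 0. v = a *\<^sub>R \<alpha> s"
proof -
  obtain F c d where c: "cone_coeffs F c v" and d: "cone_coeffs F d w" and s: "s \<in> F"
    using cone_coeffs_exist2[OF assms(1,2), of "{s}"] assms by auto
  have F: "finite F" "F \<subseteq> S" "\<And>s. 0 \<le> c s" "\<And>s. 0 \<le> d s"
    and v: "v = (\<Sum>s\<in>F. c s *\<^sub>R \<alpha> s)" and w: "w = (\<Sum>s\<in>F. d s *\<^sub>R \<alpha> s)"
    using c d by (simp_all add: cone_coeffs_def)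
  let ?m = "c s + d s"
  have "k *\<^sub>R \<alpha> s = (\<Sum>t\<in>F. (c t + d t) *\<^sub>R \<alpha> t)"
    unfolding assms(4)[symmetric] v w by (simp add: scaleR_add_left sum.distrib)
  also have "\<dots> = ?m *\<^sub>R \<alpha> s + (\<Sum>t\<in>F - {s}. (c t + d t) *\<^sub>R \<alpha> t)"
    using F s by (subst sum.remove[of F s]) auto
  finally have k: "k *\<^sub>R \<alpha> s = ?m *\<^sub>R \<alpha> s + (\<Sum>t\<in>F - {s}. (c t + d t) *\<^sub>R \<alpha> t)" .
  have rest: "(k - ?m) *\<^sub>R \<alpha> s = (\<Sum>t\<in>F - {s}. (c t + d t) *\<^sub>R \<alpha> t)"
    unfolding scaleR_diff_left[of k] k by simp
  have "k \<le> ?m"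
  proof -
    have "k - ?m = B (\<alpha> s) ((k - ?m) *\<^sub>R \<alpha> s)" using assms form_simple_root by simp
    also have "\<dots> = (\<Sum>t\<in>F - {s}. (c t + d t) * B (\<alpha> s) (\<alpha> t))"
      unfolding rest by (simp add: form_sum_right)
    also have "\<dots> \<le> 0"
    proof (rule sum_nonpos)
      fix t assume "t \<in> F - {s}"
      then have "B (\<alpha> s) (\<alpha> t) \<le> 0" using form_simple_nonpos[of s t] assms F by auto
      moreover have "0 \<le> c t + d t" using F by simp
      ultimately show "(c t + d t) * B (\<alpha> s) (\<alpha> t) \<le> 0" by (rule mult_nonneg_nonpos[rotated])
    qed
    finally show ?thesis by simp
  qed
  define e where "e t = (if t = s then ?m - k else c t + d t)" for t
  have "(\<Sum>t\<in>F. e t *\<^sub>R \<alpha> t) = (?m - k) *\<^sub>R \<alpha> s + (\<Sum>t\<in>F - {s}. (c t + d t) *\<^sub>R \<alpha> t)"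
    using F s by (subst sum.remove[of F s]) (auto simp: e_def intro!: sum.cong)
  also have "\<dots> = 0" unfolding rest[symmetric] by (simp flip: scaleR_add_left)
  finally have sum0: "(\<Sum>t\<in>F. e t *\<^sub>R \<alpha> t) = 0" .
  have "c t = 0" if t: "t \<in> F - {s}" for t
  proof -
    have "e t = 0"
      by (rule positively_independent[OF F(1,2) _ sum0]) (use F t \<open>k \<le> ?m\<close> in \<open>auto simp: e_def\<close>)
    then show ?thesis using F(3)[of t] F(4)[of t] t by (simp add: e_def)
  qed
  then have "v = c s *\<^sub>R \<alpha> s"
    unfolding v using F s by (subst sum.remove[of F s]) auto
  then show ?thesis using F by blast
qed

section \<open>Dihedral words acting on a simple root, and the sign of its images\<close>

lemma act_alternating:
  assumes "s \<in> S" "t \<in> S"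
  defines "c \<equiv> - B (\<alpha> s) (\<alpha> t)"
  shows "act (wp (alternating s t k)) (\<alpha> s) =
    (if even k then cheb c (Suc k) *\<^sub>R \<alpha> s + cheb c k *\<^sub>R \<alpha> t
     else cheb c k *\<^sub>R \<alpha> s + cheb c (Suc k) *\<^sub>R \<alpha> t)"
proof (induction k)
  case (Suc k)
  have step: "act (wp (alternating s t (Suc k))) (\<alpha> s) =
    act (if even k then t else s) (act (wp (alternating s t k)) (\<alpha> s))"
    using assms gens_closed alternating_in_lists[OF assms(1,2)] by simp
  have c: "B (\<alpha> s) (\<alpha> t) = - c" "B (\<alpha> t) (\<alpha> s) = - c"
    using form_sym[of "\<alpha> t" "\<alpha> s"] by (simp_all add: c_def)
  have h1: "x + a *\<^sub>R y - m *\<^sub>R y = x + n *\<^sub>R y" if "a - m = n" for x y :: 'v and a m n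
    unfolding that[symmetric] by (simp add: scaleR_diff_left)
  have h2: "a *\<^sub>R y + x - m *\<^sub>R y = n *\<^sub>R y + x" if "a - m = n" for x y :: 'v and a m n
    unfolding that[symmetric] by (simp add: scaleR_diff_left)
  have h3: "a *\<^sub>R y - m *\<^sub>R y = n *\<^sub>R y" if "a - m = n" for y :: 'v and a m n
    unfolding that[symmetric] by (simp add: scaleR_diff_left)
  show ?case unfolding step Suc.IH
    using assms(1,2) by (auto simp: act_gen form_simple_root c intro!: h1 h2 h3)
qed simp

lemma cheb_nonneg:
  assumes "s \<in> S" "t \<in> S" "s \<noteq> t" "ord (s \<otimes> t) \<noteq> 0 \<Longrightarrow> k \<le> ord (s \<otimes> t)"
  shows "0 \<le> cheb (- B (\<alpha> s) (\<alpha> t)) k"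
proof (cases "ord (s \<otimes> t) = 0")
  case True
  then show ?thesis using form_infinite[OF assms(1-3)] cheb_step_ge_1 by simp
next
  case False
  define \<theta> where "\<theta> = pi / real (ord (s \<otimes> t))"
  have c: "- B (\<alpha> s) (\<alpha> t) = cos \<theta>" using form_finite[OF assms(1-3) False] by (simp add: \<theta>_def)
  have m: "2 \<le> ord (s \<otimes> t)" using ord_gens_ge_2[OF assms(1-3) False] .
  have "0 < \<theta>" "\<theta> < pi" using m by (auto simp: \<theta>_def field_simps)
  then have s: "0 < sin \<theta>" by (rule sin_gt_zero)
  have "real k * \<theta> \<le> real (ord (s \<otimes> t)) * \<theta>" using assms(4)[OF False] \<open>0 < \<theta>\<close> by simp
  also have "\<dots> = pi" using m by (simp add: \<theta>_def)
  finally have "0 \<le> sin (real k * \<theta>)" using \<open>0 < \<theta>\<close> by (intro sin_ge_zero) auto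
  then have "0 \<le> cheb (cos \<theta>) k * sin \<theta>" by (simp add: cheb_sin)
  then show ?thesis unfolding c using s by (simp add: zero_le_mult_iff)
qed

text \<open>Humphreys, Reflection Groups and Coxeter Groups, Section 5.4: split off from \<open>w\<close> a longest right
  factor in the dihedral subgroup generated by \<open>s\<close> and a right descent \<open>t\<close> of \<open>w\<close>.\<close>

theorem ascent_in_cone:
  assumes "w \<in> carrier W" "s \<in> S" "lg w < lg (w \<otimes> s)"
  shows "act w (\<alpha> s) \<in> C"
  using assms
proof (induction "lg w" arbitrary: w s rule: less_induct)
  case less
  show ?case
  proof (cases "w = \<one>")
    case True then show ?thesis using less.prems cone_simple by simp
  next
    case False
    then obtain t where t: "t \<in> S" "lg (w \<otimes> t) < lg w"
      using exists_right_descent less.prems by blast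
    then have st: "s \<noteq> t" using less.prems by auto
    have sub: "xs \<in> lists {s,t} \<Longrightarrow> xs \<in> lists S" for xs
      using less.prems t by (auto simp: in_lists_conv_set)
    define Q where "Q v xs \<longleftrightarrow> v \<in> carrier W \<and> xs \<in> lists {s,t} \<and> w = v \<otimes> wp xs \<and>
      lg w = lg v + length xs" for v xs
    have "Q (w \<otimes> t) [t]"
      using less.prems t length_mult_gen_cases[of t w] gens_closed by (auto simp: Q_def)
    then have ex: "\<exists>v xs. Q v xs" by blast
    define v where "v = arg_min lg (\<lambda>v. \<exists>xs. Q v xs)"
    have v: "\<exists>xs. Q v xs" "\<And>v'. \<exists>xs. Q v' xs \<Longrightarrow> lg v \<le> lg v'"
      using arg_min_nat_lemma[of "\<lambda>v. \<exists>xs. Q v xs" _ lg] ex unfolding v_def by blast+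
    obtain xs where xs: "Q v xs" using v by blast
    have vc: "v \<in> carrier W" and wv: "w = v \<otimes> wp xs" and lw: "lg w = lg v + length xs"
      using xs unfolding Q_def by blast+
    have xl: "xs \<in> lists {s,t}" using xs by (simp add: Q_def)
    have asc: "lg v < lg (v \<otimes> r)" if r: "r \<in> {s, t}" for r
    proof (rule ccontr)
      assume "\<not> lg v < lg (v \<otimes> r)"
      then have l: "lg v = lg (v \<otimes> r) + 1"
        using length_mult_gen_cases[of r v] r vc less.prems t by auto
      have rS: "r \<in> S" using r less.prems t by auto
      have "w = v \<otimes> r \<otimes> (r \<otimes> wp xs)"
        using xs rS sub gens_closed unfolding Q_def
        by (metis gen_cancel_left m_assoc m_closed word_prod_closed)
      then have "Q (v \<otimes> r) (r # xs)"
        using xs rS gens_closed l r unfolding Q_def by auto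
      then show False using v(2)[of "v \<otimes> r"] l by auto
    qed
    have "lg v < lg w" using v(2)[of "w \<otimes> t"] \<open>Q (w \<otimes> t) [t]\<close> t(2) by (meson le_less_trans)
    have vC: "act v (\<alpha> s) \<in> C" "act v (\<alpha> t) \<in> C"
      using less.hyps[OF \<open>lg v < lg w\<close>] asc vc less.prems t by auto
    have shorter: "length xs \<le> length ys" if "ys \<in> lists {s,t}" "wp ys = wp xs" for ys
    proof -
      have "lg w \<le> lg v + lg (wp ys)"
        using length_mult_le[of v "wp ys"] vc sub[OF that(1)] sub[OF xl] unfolding wv that(2) by simp
      then show ?thesis using length_le_word[of ys] sub[OF that(1)] lw by linarith
    qed
    have shorter': "length xs < length ys" if "ys \<in> lists {s,t}" "wp ys = wp xs \<otimes> s" for ys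
    proof -
      have "w \<otimes> s = v \<otimes> wp ys"
        unfolding wv that(2) using sub[OF xl] vc less.prems(2) gens_closed by (simp add: m_assoc)
      then have "lg (w \<otimes> s) \<le> lg v + lg (wp ys)"
        using length_mult_le[of v "wp ys"] vc sub[OF that(1)] by simp
      then show ?thesis using length_le_word[of ys] sub[OF that(1)] less.prems(3) lw by linarith
    qed
    have adj: "distinct_adj xs"
    proof (rule ccontr)
      assume "\<not> distinct_adj xs"
      then obtain as a bs where x: "xs = as @ [a, a] @ bs"
        unfolding distinct_adj_conv_nth
        by (metis Cons_nth_drop_Suc Suc_lessD append_Cons append_Nil id_take_nth_drop)
      then have *: "as \<in> lists {s,t}" "bs \<in> lists {s,t}" "a \<in> {s,t}" using xl by auto
      have aS: "a \<in> S" "a # a # bs \<in> lists S" using * sub[OF *(2)] less.prems(2) t(1) by auto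
      have "as @ bs \<in> lists {s,t}" using * by simp
      moreover have "wp xs = wp (as @ bs)"
        using word_prod_append[OF sub[OF *(1)] aS(2)] word_prod_append[OF sub[OF *(1)] sub[OF *(2)]]
          aS(1) word_prod_closed[OF sub[OF *(2)]] unfolding x by simp
      ultimately show False using shorter[of "as @ bs"] x by simp
    qed
    have lst: "last xs = t" if "xs \<noteq> []"
    proof (rule ccontr)
      assume "last xs \<noteq> t"
      then have l: "last xs = s" using xl that by (auto simp: in_lists_conv_set)
      define ys where "ys = butlast xs"
      have x: "xs = ys @ [s]" using l that unfolding ys_def by (metis append_butlast_last_id)
      have "ys \<in> lists {s,t}" using xl x by simp
      moreover have "wp ys = wp xs \<otimes> s"
        using sub[OF calculation] less.prems gens_closed by (auto simp: x word_prod_append)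
      ultimately show False using shorter'[of ys] x by simp
    qed
    have alt: "xs = alternating s t (length xs)"
      using alternating_unique[OF st _ adj] lst xl by (auto simp: in_lists_conv_set)
    \<comment> \<open>A word at least as long as the order ends in an alternating block of that
      length. Braiding the block makes it end in \<open>s\<close>, and cancelling that letter writes
      \<open>w \<otimes> s\<close> too short. The bound keeps both Chebyshev values
      non-negative.\<close>
    have small: "length xs < ord (s \<otimes> t)" if m: "ord (s \<otimes> t) \<noteq> 0"
    proof (rule ccontr)
      assume "\<not> ?thesis"
      then obtain k where k: "length xs = k + ord (s \<otimes> t)" by (metis add.commute le_Suc_ex not_less)
      obtain zs where zs: "set zs \<subseteq> {s,t}" "xs = zs @ alternating s t (ord (s \<otimes> t))" "length zs = k"
        using alternating_append[of s t k "ord (s \<otimes> t)"] alt k by metis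
      have zl: "zs \<in> lists {s,t}" using zs by auto
      obtain m' where m': "ord (s \<otimes> t) = Suc m'" using m not0_implies_Suc by blast
      define ys where "ys = butlast (alternating t s (Suc m'))"
      have ys: "alternating t s (ord (s \<otimes> t)) = ys @ [s]"
        using alternating_last[of t s m'] unfolding m' ys_def .
      have "alternating t s (ord (s \<otimes> t)) \<in> lists {s,t}"
        using set_alternating[of t s "ord (s \<otimes> t)"] by (auto simp: in_lists_conv_set)
      then have yl: "ys \<in> lists {s,t}" unfolding ys by simp
      have "wp xs = wp zs \<otimes> wp (ys @ [s])"
        unfolding zs(2) using alternating_braid[OF less.prems(2) t(1)] alternating_in_lists[OF less.prems(2) t(1)]
          sub[OF zl] ys by (simp add: word_prod_append)
      then have "wp (zs @ ys) = wp xs \<otimes> s"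
        using sub[OF zl] sub[OF yl] less.prems gens_closed by (simp add: word_prod_append m_assoc[symmetric])
      moreover have "zs @ ys \<in> lists {s,t}" using zl yl by simp
      ultimately have "length xs < length (zs @ ys)" using shorter' by blast
      moreover have "length ys = m'" using arg_cong[OF ys, of length] m' by simp
      ultimately show False using k zs m' by simp
    qed
    let ?c = "- B (\<alpha> s) (\<alpha> t)"
    have nn: "0 \<le> cheb ?c (length xs)" "0 \<le> cheb ?c (Suc (length xs))"
      using cheb_nonneg[OF less.prems(2) t(1) st] small by (auto simp: less_imp_le Suc_le_eq)
    have "act w (\<alpha> s) = act v (act (wp xs) (\<alpha> s))"
      unfolding wv using vc sub[OF xl] by simp
    also have "act (wp xs) (\<alpha> s) = (if even (length xs) then cheb ?c (Suc (length xs)) *\<^sub>R \<alpha> s + cheb ?c (length xs) *\<^sub>R \<alpha> t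
     else cheb ?c (length xs) *\<^sub>R \<alpha> s + cheb ?c (Suc (length xs)) *\<^sub>R \<alpha> t)"
      by (subst alt) (rule act_alternating[OF less.prems(2) t(1)])
    finally show ?thesis using nn vC vc
      by (simp add: cone_comb del: cheb.simps split: if_splits)
  qed
qed

subsection \<open>Roots, reflections and inversions\<close>

abbreviation "rt r \<equiv> r \<in> roots W"
abbreviation "pos r \<equiv> r \<in> pos_roots W"
abbreviation "neg r \<equiv> pos (- r)"
abbreviation "rf \<equiv> root_reflection W"

lemma root_simple: "s \<in> S \<Longrightarrow> rt (\<alpha> s)"
  unfolding roots_def using act_one[of "\<alpha> s"] one_closed by (metis (mono_tags, lifting) mem_Collect_eq)

lemma root_act: "rt r \<Longrightarrow> u \<in> carrier W \<Longrightarrow> rt (act u r)"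
  unfolding roots_def by clarify (metis act_mult m_closed)

lemma root_neg: "rt r \<Longrightarrow> rt (- r)"
  unfolding roots_def by clarify (metis act_gen_simple act_mult act_simps(4) gens_closed m_closed)

lemma root_neg_iff [simp]: "rt (- r) \<longleftrightarrow> rt r"
  using root_neg[of r] root_neg[of "- r"] by auto

lemma root_act_iff: "u \<in> carrier W \<Longrightarrow> rt (act u r) \<longleftrightarrow> rt r"
  using root_act[of r u] root_act[of "act u r" "inv u"] by auto

lemma form_root: "rt r \<Longrightarrow> B r r = 1"
  unfolding roots_def by (auto simp: form_simple_root)

lemma pos_root: "pos r \<Longrightarrow> rt r" and pos_cone: "pos r \<Longrightarrow> r \<in> C"
  and posI: "rt r \<Longrightarrow> r \<in> C \<Longrightarrow> pos r"
  by (simp_all add: pos_roots_def)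

lemma pos_simple: "s \<in> S \<Longrightarrow> pos (\<alpha> s)"
  by (simp add: posI root_simple cone_simple)

lemma root_cases: "rt r \<Longrightarrow> pos r \<or> neg r"
proof -
  assume r: "rt r"
  then obtain w s where ws: "w \<in> carrier W" "s \<in> S" "r = act w (\<alpha> s)"
    unfolding roots_def by blast
  have ws': "w \<otimes> s \<in> carrier W" "w \<otimes> s \<otimes> s = w" using ws gens_closed by auto
  show ?thesis
  proof (cases "lg w < lg (w \<otimes> s)")
    case True
    then show ?thesis using ascent_in_cone ws r posI by blast
  next
    case False
    then have "lg (w \<otimes> s) < lg (w \<otimes> s \<otimes> s)" using length_mult_gen_cases[of s w] ws ws' by auto
    then have "act (w \<otimes> s) (\<alpha> s) \<in> C" using ascent_in_cone ws ws' by blast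
    then have "- r \<in> C" using ws gens_closed by (simp add: act_gen_simple)
    then show ?thesis using r posI root_neg by blast
  qed
qed

lemma pos_not_neg: "pos r \<Longrightarrow> \<not> neg r"
proof
  assume "pos r" "neg r"
  then have "r = 0" using cone_pointed pos_cone by blast
  then show False using form_root[of r] \<open>pos r\<close> pos_root by simp
qed

lemma pos_comb:
  "pos x \<Longrightarrow> pos y \<Longrightarrow> 0 \<le> a \<Longrightarrow> 0 \<le> b \<Longrightarrow> rt (a *\<^sub>R x + b *\<^sub>R y) \<Longrightarrow> pos (a *\<^sub>R x + b *\<^sub>R y)"
  by (rule posI) (simp_all add: cone_comb pos_cone)

lemma pos_comb_eq:
  "r = a *\<^sub>R x + b *\<^sub>R y \<Longrightarrow> rt r \<Longrightarrow> pos x \<Longrightarrow> pos y \<Longrightarrow> 0 \<le> a \<Longrightarrow> 0 \<le> b \<Longrightarrow> pos r"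
  using pos_comb by simp

lemma pos_multiple_eq:
  assumes "pos x" "pos y" "x = a *\<^sub>R y"
  shows "x = y"
proof -
  have "a * a = 1" using form_root[OF pos_root[OF assms(1)]] form_root[OF pos_root[OF assms(2)]]
    unfolding assms(3) by simp
  then consider "a = 1" | "a = -1" using square_eq_1_iff by blast
  then show ?thesis
  proof cases
    case 1 then show ?thesis using assms(3) by simp
  next
    case 2
    then have "- y = x" using assms(3) by simp
    then show ?thesis using assms pos_not_neg[of y] by metis
  qed
qed

lemma simple_root_extreme_roots:
  assumes "pos x" "pos y" "0 < a" "0 < b" "s \<in> S" "a *\<^sub>R x + b *\<^sub>R y = k *\<^sub>R \<alpha> s"
  shows "x = \<alpha> s" "y = \<alpha> s"
proof -
  have main: "x = \<alpha> s" if xy: "pos x" "pos y" "0 < a" "0 < b" "a *\<^sub>R x + b *\<^sub>R y = k *\<^sub>R \<alpha> s" for x y a b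
  proof -
    obtain c where c: "a *\<^sub>R x = c *\<^sub>R \<alpha> s"
      using simple_root_extreme[OF _ _ assms(5) xy(5)] cone_scale pos_cone xy by (meson less_imp_le)
    have "x = (1 / a) *\<^sub>R (a *\<^sub>R x)" using xy by simp
    then have "x = (c / a) *\<^sub>R \<alpha> s" unfolding c by simp
    then show ?thesis using pos_multiple_eq[of x "\<alpha> s"] xy pos_simple assms by blast
  qed
  show "x = \<alpha> s" using main[OF assms(1-4,6)] .
  show "y = \<alpha> s" using main[OF assms(2,1,4,3)] assms(6) by (simp add: add.commute)
qed

lemma simple_root_inj: "s \<in> S \<Longrightarrow> t \<in> S \<Longrightarrow> \<alpha> s = \<alpha> t \<Longrightarrow> s = t"
  using form_simple_nonpos[of s t] form_simple_root[of s] by fastforce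

lemma gen_permutes_pos:
  assumes "pos r" "s \<in> S" "r \<noteq> \<alpha> s"
  shows "pos (act s r)"
proof (rule ccontr)
  assume n: "\<not> pos (act s r)"
  have "rt (act s r)" using assms root_act pos_root gens_closed by blast
  then have "neg (act s r)" using n root_cases by blast
  moreover have "1 *\<^sub>R r + 1 *\<^sub>R (- act s r) = (2 * B (\<alpha> s) r) *\<^sub>R \<alpha> s"
    using assms by (simp add: act_gen)
  ultimately show False using simple_root_extreme_roots(1)[of r "- act s r" 1 1 s] assms by auto
qed

lemma ascent_iff:
  assumes "w \<in> carrier W" "s \<in> S"
  shows "lg w < lg (w \<otimes> s) \<longleftrightarrow> pos (act w (\<alpha> s))"
    and "lg (w \<otimes> s) < lg w \<longleftrightarrow> neg (act w (\<alpha> s))"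
proof -
  have r: "rt (act w (\<alpha> s))" using root_act root_simple assms by blast
  have c: "w \<otimes> s \<in> carrier W" "w \<otimes> s \<otimes> s = w" using assms gens_closed by auto
  have up: "lg w < lg (w \<otimes> s) \<Longrightarrow> pos (act w (\<alpha> s))"
    using ascent_in_cone assms r posI by blast
  have "lg (w \<otimes> s) < lg w \<Longrightarrow> act (w \<otimes> s) (\<alpha> s) \<in> C"
    using ascent_in_cone[OF c(1) assms(2)] c(2) by simp
  then have down: "lg (w \<otimes> s) < lg w \<Longrightarrow> neg (act w (\<alpha> s))"
    using assms gens_closed r posI root_neg by (simp add: act_gen_simple)
  show "lg w < lg (w \<otimes> s) \<longleftrightarrow> pos (act w (\<alpha> s))"
    and "lg (w \<otimes> s) < lg w \<longleftrightarrow> neg (act w (\<alpha> s))"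
    using up down pos_not_neg length_mult_gen_cases[OF assms(2,1)] by force+
qed

lemma left_ascent_iff:
  assumes "w \<in> carrier W" "s \<in> S"
  shows "lg w < lg (s \<otimes> w) \<longleftrightarrow> pos (act (inv w) (\<alpha> s))"
    and "lg (s \<otimes> w) < lg w \<longleftrightarrow> neg (act (inv w) (\<alpha> s))"
  using ascent_iff[of "inv w" s] length_gen_mult_inv[OF assms(2,1)] length_inv[of w] assms by auto

text \<open>Each generator adds at most one inverted root, since it makes only its own simple root
  negative. This finiteness later excludes infinite families of roots and makes the angles in a
  plane discrete.\<close>

lemma finite_inverted: "u \<in> carrier W \<Longrightarrow> finite {r. pos r \<and> neg (act u r)}"
proof (induction u rule: word_induct)
  case one
  have "{r. pos r \<and> neg (act \<one> r)} = {}" using pos_not_neg by simp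
  then show ?case by (simp only: finite.emptyI)
next
  case (mult s u)
  have "{r. pos r \<and> neg (act (s \<otimes> u) r)} \<subseteq> {r. pos r \<and> neg (act u r)} \<union> {act (inv u) (\<alpha> s)}"
  proof (rule subsetI, rule ccontr)
    fix r assume "r \<in> {r. pos r \<and> neg (act (s \<otimes> u) r)}"
      and "r \<notin> {r. pos r \<and> neg (act u r)} \<union> {act (inv u) (\<alpha> s)}"
    then have r: "pos r" "neg (act (s \<otimes> u) r)" "r \<noteq> act (inv u) (\<alpha> s)" "\<not> neg (act u r)" by auto
    have n: "act u r \<noteq> \<alpha> s" using r(3) act_inv_cancel(1)[of u r] mult by metis
    have "pos (act u r)" using r mult root_act pos_root root_cases by blast
    then have "pos (act s (act u r))" using gen_permutes_pos mult n by blast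
    then show False using r(2) pos_not_neg mult gens_closed by simp
  qed
  then show ?case using mult by (simp add: finite_subset)
qed

lemma faithful:
  assumes "w \<in> carrier W" "\<And>v. act w v = v"
  shows "w = \<one>"
proof (rule ccontr)
  assume "w \<noteq> \<one>"
  then obtain s where "s \<in> S" "lg (w \<otimes> s) < lg w" using exists_right_descent assms by blast
  then show False using ascent_iff(2)[of w s] assms pos_not_neg pos_simple by auto
qed

lemma faithful_eq:
  assumes "u \<in> carrier W" "w \<in> carrier W" "\<And>v. act u v = act w v"
  shows "u = w"
proof -
  have "inv w \<otimes> u = \<one>" using assms by (intro faithful) auto
  then show ?thesis using assms by (metis inv_closed inv_equality inv_inv)
qed

lemma root_reflection_unique:
  assumes "g \<in> carrier W" "\<And>v. act g v = v - (2 * B \<beta> v) *\<^sub>R \<beta>"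
  shows "rf \<beta> = g"
  unfolding root_reflection_def
proof (rule the_equality)
  show "g \<in> carrier W \<and> act g = reflection B \<beta>"
    using assms by (auto simp: reflection_def)
  fix h assume "h \<in> carrier W \<and> act h = reflection B \<beta>"
  then show "h = g" using assms by (intro faithful_eq) (auto simp: reflection_def)
qed

lemma root_reflection_act:
  assumes "w \<in> carrier W" "s \<in> S"
  shows "rf (act w (\<alpha> s)) = w \<otimes> s \<otimes> inv w"
proof (rule root_reflection_unique)
  show "w \<otimes> s \<otimes> inv w \<in> carrier W" using assms gens_closed by simp
  show "act (w \<otimes> s \<otimes> inv w) v = v - (2 * B (act w (\<alpha> s)) v) *\<^sub>R act w (\<alpha> s)" for v
    using assms gens_closed by (simp add: act_gen flip: form_act_inv)
qed

lemma rf_closed [simp]: "rt \<beta> \<Longrightarrow> rf \<beta> \<in> carrier W"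
  and act_rf: "rt \<beta> \<Longrightarrow> act (rf \<beta>) v = v - (2 * B \<beta> v) *\<^sub>R \<beta>"
proof -
  assume "rt \<beta>"
  then obtain w s where ws: "w \<in> carrier W" "s \<in> S" "\<beta> = act w (\<alpha> s)"
    unfolding roots_def by blast
  then show c: "rf \<beta> \<in> carrier W" using root_reflection_act gens_closed by simp
  have "B (\<alpha> s) (act (inv w) v) = B \<beta> v"
    using form_act_inv[of w v "\<alpha> s"] ws form_sym by metis
  then show "act (rf \<beta>) v = v - (2 * B \<beta> v) *\<^sub>R \<beta>"
    using ws gens_closed by (simp add: root_reflection_act act_gen)
qed

lemma rf_simple: "s \<in> S \<Longrightarrow> rf (\<alpha> s) = s"
  by (rule root_reflection_unique) (auto simp: gens_closed act_gen)

lemma rf_neg: "rt \<beta> \<Longrightarrow> rf (- \<beta>) = rf \<beta>"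
  by (rule root_reflection_unique) (auto simp: act_rf)

lemma act_rf_self: "rt \<beta> \<Longrightarrow> act (rf \<beta>) \<beta> = - \<beta>"
  by (simp add: act_rf form_root scaleR_2)

lemma act_rf_rf [simp]: "rt \<beta> \<Longrightarrow> act (rf \<beta>) (act (rf \<beta>) v) = v"
  by (simp add: act_rf form_root scaleR_2 scaleR_diff_left)

lemma rf_square [simp]: "rt \<beta> \<Longrightarrow> rf \<beta> \<otimes> rf \<beta> = \<one>"
  by (rule faithful) auto

lemma rf_inv [simp]: "rt \<beta> \<Longrightarrow> inv (rf \<beta>) = rf \<beta>"
  by (simp add: inv_equality)

lemma rf_conj: "rt \<beta> \<Longrightarrow> u \<in> carrier W \<Longrightarrow> rf (act u \<beta>) = u \<otimes> rf \<beta> \<otimes> inv u"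
  unfolding roots_def
  by clarify (simp add: root_reflection_act gens_closed m_assoc inv_mult_group flip: act_mult)

lemma rf_cancel [simp]: "rt \<beta> \<Longrightarrow> w \<in> carrier W \<Longrightarrow> rf \<beta> \<otimes> (rf \<beta> \<otimes> w) = w"
  by (simp flip: m_assoc)

lemma rf_parity: "rt \<beta> \<Longrightarrow> odd (lg (rf \<beta>))"
proof -
  assume "rt \<beta>"
  then obtain w s where ws: "w \<in> carrier W" "s \<in> S" "\<beta> = act w (\<alpha> s)"
    unfolding roots_def by blast
  then show ?thesis using gens_closed
    by (simp add: root_reflection_act length_mult_parity length_inv)
qed

text \<open>Follow \<beta> through a reduced word: it has become simple at the letter that turns it
  negative. The additive factorization marks the moment at which \<beta> is inverted.\<close>

lemma strong_exchange:
  assumes "w \<in> carrier W" "pos \<beta>" "neg (act (inv w) \<beta>)"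
  shows "\<exists>v1 s v2. v1 \<in> carrier W \<and> s \<in> S \<and> v2 \<in> carrier W \<and> w = v1 \<otimes> s \<otimes> v2 \<and>
    lg w = lg v1 + 1 + lg v2 \<and> \<beta> = act v1 (\<alpha> s)"
  using assms
proof (induction "lg w" arbitrary: w \<beta> rule: less_induct)
  case less
  have "w \<noteq> \<one>" using less.prems pos_not_neg by auto
  then obtain s where s: "s \<in> S" "lg (s \<otimes> w) < lg w" using exists_left_descent less.prems by blast
  define w' where "w' = s \<otimes> w"
  have w': "w' \<in> carrier W" "w = s \<otimes> w'" "lg w = lg w' + 1"
    using s less.prems gens_closed length_gen_mult_cases[of s w] by (auto simp: w'_def)
  show ?case
  proof (cases "\<beta> = \<alpha> s")
    case True
    then show ?thesis using w' s gens_closed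
      by (rule_tac exI[of _ \<one>], rule_tac exI[of _ s], rule_tac exI[of _ w']) auto
  next
    case False
    have "pos (act s \<beta>)" using False s less.prems gen_permutes_pos by blast
    moreover have "act (inv w') (act s \<beta>) = act (inv w) \<beta>"
      unfolding w'(2) using s w' gens_closed by (simp add: inv_mult_group gens_inv)
    ultimately obtain v1 t v2 where v: "v1 \<in> carrier W" "t \<in> S" "v2 \<in> carrier W"
      "w' = v1 \<otimes> t \<otimes> v2" "lg w' = lg v1 + 1 + lg v2" "act s \<beta> = act v1 (\<alpha> t)"
      using less.hyps[of w' "act s \<beta>"] w' less.prems by auto
    have c: "s \<in> carrier W" "t \<in> carrier W" using s v gens_closed by auto
    have w: "w = (s \<otimes> v1) \<otimes> t \<otimes> v2" unfolding w'(2) v(4) using c v by (simp add: m_assoc)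
    have "lg w \<le> lg (s \<otimes> v1) + 1 + lg v2"
      using length_mult_le[of "s \<otimes> v1 \<otimes> t" v2] length_mult_le[of "s \<otimes> v1" t] c v unfolding w by simp
    moreover have "lg (s \<otimes> v1) \<le> 1 + lg v1" using length_mult_le[of s v1] c v s by simp
    ultimately have "lg w = lg (s \<otimes> v1) + 1 + lg v2" using v(5) w'(3) by simp
    moreover have "\<beta> = act (s \<otimes> v1) (\<alpha> t)"
      using c v s by (simp flip: v(6))
    ultimately show ?thesis using w v c by blast
  qed
qed

lemma inv_cancel_left [simp]:
  assumes "u \<in> carrier W" "v \<in> carrier W"
  shows "inv u \<otimes> (u \<otimes> v) = v" "u \<otimes> (inv u \<otimes> v) = v"
  using assms by (simp_all flip: m_assoc)

lemma rf_mult_exchange: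
  assumes "v1 \<in> carrier W" "s \<in> S" "v2 \<in> carrier W"
  shows "rf (act v1 (\<alpha> s)) \<otimes> (v1 \<otimes> s \<otimes> v2) = v1 \<otimes> v2"
  using assms gens_closed by (simp add: root_reflection_act m_assoc)

lemma reflection_shortens_iff:
  assumes "w \<in> carrier W" "pos \<beta>"
  shows "lg (rf \<beta> \<otimes> w) < lg w \<longleftrightarrow> neg (act (inv w) \<beta>)"
proof -
  have r: "rt \<beta>" using assms pos_root by blast
  have short: "lg (rf \<beta> \<otimes> w) < lg w" if w: "w \<in> carrier W" "neg (act (inv w) \<beta>)" for w
  proof -
    obtain v1 s v2 where v: "v1 \<in> carrier W" "s \<in> S" "v2 \<in> carrier W" "w = v1 \<otimes> s \<otimes> v2"
      "lg w = lg v1 + 1 + lg v2" "\<beta> = act v1 (\<alpha> s)"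
      using strong_exchange[OF w(1) assms(2) w(2)] by blast
    have "rf \<beta> \<otimes> w = v1 \<otimes> v2" unfolding v(4,6) using rf_mult_exchange v(1-3) by blast
    then show ?thesis using length_mult_le[of v1 v2] v(1,3,5) by simp
  qed
  show ?thesis
  proof
    assume a: "lg (rf \<beta> \<otimes> w) < lg w"
    show "neg (act (inv w) \<beta>)"
    proof (rule ccontr)
      assume "\<not> neg (act (inv w) \<beta>)"
      then have "pos (act (inv w) \<beta>)" using r root_act assms root_cases by blast
      then have "neg (act (inv (rf \<beta> \<otimes> w)) \<beta>)"
        using r assms by (simp add: inv_mult_group act_rf_self)
      from short[OF _ this] have "lg w < lg (rf \<beta> \<otimes> w)" using r assms by simp
      then show False using a by simp
    qed
  qed (use short assms in blast)
qed

section \<open>Inversions and short inversions\<close>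

lemma inversions_iff:
  "w \<in> carrier W \<Longrightarrow> \<beta> \<in> inversions W w \<longleftrightarrow> pos \<beta> \<and> neg (act (inv w) \<beta>)"
  unfolding inversions_def neg_roots_def image_image
  by (auto simp: image_iff intro!: bexI[of _ "- act (inv w) \<beta>"])

lemma short_inversions_iff:
  "\<beta> \<in> short_inversions W w \<longleftrightarrow> pos \<beta> \<and> lg (rf \<beta> \<otimes> w) + 1 = lg w"
  unfolding short_inversions_def by auto

lemma short_inversion_inverted:
  "w \<in> carrier W \<Longrightarrow> \<beta> \<in> short_inversions W w \<Longrightarrow> pos \<beta> \<and> neg (act (inv w) \<beta>)"
  using reflection_shortens_iff[of w \<beta>] unfolding short_inversions_iff by auto

text \<open>\<open>z\<close> turns negative at one letter of \<open>v\<close>. By additivity the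
  product of \<open>u\<close> with the part of \<open>v\<close> up to that letter is still reduced,
  so the letter is an ascent there and the image of its simple root is positive.\<close>

lemma length_additive_pos:
  assumes "u \<in> carrier W" "v \<in> carrier W" "lg (u \<otimes> v) = lg u + lg v" "pos z" "neg (act (inv v) z)"
  shows "pos (act u z)"
proof -
  obtain v1 s v2 where v: "v1 \<in> carrier W" "s \<in> S" "v2 \<in> carrier W" "v = v1 \<otimes> s \<otimes> v2"
    "lg v = lg v1 + 1 + lg v2" "z = act v1 (\<alpha> s)"
    using strong_exchange[OF assms(2,4,5)] by blast
  have c: "s \<in> carrier W" using v gens_closed by auto
  have "u \<otimes> v = (u \<otimes> v1) \<otimes> s \<otimes> v2" unfolding v(4) using v(1-3) c assms by (simp add: m_assoc)
  then have "lg u + lg v \<le> lg ((u \<otimes> v1) \<otimes> s) + lg v2"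
    using length_mult_le[of "u \<otimes> v1 \<otimes> s" v2] v(1-3) c assms by simp
  moreover have "lg (u \<otimes> v1) \<le> lg u + lg v1" using length_mult_le assms v by blast
  ultimately have "lg (u \<otimes> v1) < lg (u \<otimes> v1 \<otimes> s)" using v(5) by linarith
  then have "pos (act (u \<otimes> v1) (\<alpha> s))" using ascent_iff v assms by blast
  then show ?thesis using v assms by simp
qed

lemma length_additive_neg:
  assumes "u \<in> carrier W" "v \<in> carrier W" "lg (u \<otimes> v) = lg u + lg v" "pos z" "neg (act (inv u) z)"
  shows "neg (act (inv (u \<otimes> v)) z)"
proof -
  have "lg (inv v \<otimes> inv u) = lg (inv v) + lg (inv u)"
    using assms by (simp add: length_inv flip: inv_mult_group)
  from length_additive_pos[OF _ _ this assms(5)] show ?thesis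
    using assms by (simp add: inv_mult_group)
qed

text \<open>Writing \<open>w = v\<^sub>1 s v\<^sub>2\<close> with \<open>\<beta> = v\<^sub>1(\<alpha>\<^sub>s)\<close>, one of \<open>x\<close>, \<open>y\<close> is inverted before \<open>\<beta>\<close> and
  the other after it; since \<open>v\<^sub>1 v\<^sub>2\<close> is still length-additive, both stay on their sides of
  \<open>s\<^sub>\<beta> w\<close>, which contradicts the sign of the coefficients.\<close>

lemma short_inversion_not_between:
  assumes w: "w \<in> carrier W" and b: "\<beta> \<in> short_inversions W w"
    and x: "pos x" "neg (act (inv w) x)" and y: "pos y" "neg (act (inv w) y)"
    and ab: "0 < a" "0 < b" and eq: "\<beta> = a *\<^sub>R x + b *\<^sub>R y" and ne: "x \<noteq> \<beta>"
  shows False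
proof -
  have bp: "pos \<beta>" "neg (act (inv w) \<beta>)" using short_inversion_inverted w b by auto
  obtain v1 s v2 where v: "v1 \<in> carrier W" "s \<in> S" "v2 \<in> carrier W" "w = v1 \<otimes> s \<otimes> v2"
    "lg w = lg v1 + 1 + lg v2" "\<beta> = act v1 (\<alpha> s)"
    using strong_exchange[OF w bp] by blast
  have sc: "s \<in> carrier W" using v gens_closed by blast
  have r: "rf \<beta> \<otimes> w = v1 \<otimes> v2" unfolding v(4,6) using rf_mult_exchange v(1-3) by blast
  have add: "lg (v1 \<otimes> v2) = lg v1 + lg v2"
    using b v(5) unfolding short_inversions_iff r by simp
  have roots: "rt \<beta>" "rt x" "rt y" using bp x y pos_root by auto
  have eq': "\<alpha> s = a *\<^sub>R act (inv v1) x + b *\<^sub>R act (inv v1) y"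
    using arg_cong[OF eq, of "act (inv v1)"] v(1,6) by simp
  have main: False
    if x: "pos x" "neg (act (inv w) x)" and y: "pos y" "neg (act (inv w) y)"
    and ab: "0 < a" "0 < b" and eq: "\<beta> = a *\<^sub>R x + b *\<^sub>R y"
    and early: "neg (act (inv v1) x)" and late: "pos (act (inv v1) y)" "act (inv v1) y \<noteq> \<alpha> s" for x y a b
  proof -
    have roots: "rt \<beta>" "rt x" "rt y" using bp x y pos_root by auto
    define p where "p = B \<beta> x"
    define q where "q = B \<beta> y"
    have pq: "a * p + b * q = 1" using form_root[OF roots(1)] unfolding p_def q_def
      by (subst (asm) (2) eq) simp
    have sx: "act (rf \<beta>) x = x - (2 * p) *\<^sub>R \<beta>" and sy: "act (rf \<beta>) y = y - (2 * q) *\<^sub>R \<beta>"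
      using act_rf roots unfolding p_def q_def by blast+
    let ?i = "act (inv w)"
    have early': "neg (?i (act (rf \<beta>) x))"
      using length_additive_neg[OF v(1,3) add x(1) early] w roots
      by (simp add: r[symmetric] inv_mult_group)
    define z where "z = act s (act (inv v1) y)"
    have zp: "pos z" using gen_permutes_pos v(2) late unfolding z_def by blast
    have zy: "y = act v1 (act s z)" using v(1,2) unfolding z_def by simp
    have "neg (act (inv v2) z)" using y(2) unfolding zy v(4) using v(1-3) sc
      by (simp add: inv_mult_group gens_inv)
    then have zv: "pos (act v1 z)" using length_additive_pos[OF v(1,3) add zp] by blast
    have "act (rf \<beta>) y = act v1 z"
      unfolding z_def v(6) root_reflection_act[OF v(1,2)] using v(1) sc by simp
    then have sy_pos: "pos (act (rf \<beta>) y)" using zv by simp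
    have c0: "?i (a *\<^sub>R act (rf \<beta>) x + b *\<^sub>R act (rf \<beta>) y) = - ?i \<beta>"
      using arg_cong[OF eq, of "\<lambda>z. ?i (act (rf \<beta>) z)"] act_rf_self[OF roots(1)] w roots by simp
    have isy: "pos (?i (act (rf \<beta>) y))"
    proof -
      have "?i (act (rf \<beta>) y) = (1/b) *\<^sub>R (- ?i \<beta>) + (a / b) *\<^sub>R (- ?i (act (rf \<beta>) x))"
        unfolding c0[symmetric] using w ab by (simp add: scaleR_add_right)
      then show ?thesis
        by (rule pos_comb_eq) (use bp early' ab w roots in \<open>auto intro!: root_act\<close>)
    qed
    \<comment> \<open>The relation \<open>a * p + b * q = 1\<close> forces the contradiction. If
      \<open>q\<close> were not positive, \<open>inv w\<close> would make the reflected
      \<open>y\<close> negative, against \<open>isy\<close>; if \<open>2 * b * q\<close> were at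
      least 1, the reflected \<open>y\<close> itself would be negative. Hence
      \<open>2 * a * p \<ge> 1\<close>, and then \<open>inv w\<close> makes the reflected
      \<open>x\<close> positive, against \<open>early'\<close>.\<close>
    have q: "0 < q"
    proof (rule ccontr)
      assume "\<not> 0 < q"
      then have q': "0 \<le> - 2 * q" by simp
      have "- ?i (act (rf \<beta>) y) = 1 *\<^sub>R (- ?i y) + (- 2 * q) *\<^sub>R (- ?i \<beta>)"
        unfolding sy using w by simp
      then have "neg (?i (act (rf \<beta>) y))"
        by (rule pos_comb_eq) (use q' bp y w roots in \<open>auto intro!: root_act\<close>)
      then show False using isy pos_not_neg by blast
    qed
    have bq: "2 * b * q < 1"
    proof (rule ccontr)
      assume c: "\<not> 2 * b * q < 1"
      have "- act (rf \<beta>) y = (2 * q) *\<^sub>R \<beta> - y" unfolding sy by simp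
      also have "\<dots> = (2 * b * q - 1) *\<^sub>R y + (2 * q * a) *\<^sub>R x"
        by (subst eq) (simp add: algebra_simps)
      finally have "neg (act (rf \<beta>) y)"
        by (rule pos_comb_eq) (use c x y ab q roots in \<open>auto intro!: root_act\<close>)
      then show False using sy_pos pos_not_neg by blast
    qed
    have ap: "1 \<le> 2 * a * p" using pq bq by simp
    have "?i (act (rf \<beta>) x) = ?i (x - (2 * p) *\<^sub>R \<beta>)" unfolding sx ..
    also have "\<dots> = (2 * a * p - 1) *\<^sub>R (- ?i x) + (2 * p * b) *\<^sub>R (- ?i y)"
      by (subst eq) (use w in \<open>simp add: algebra_simps\<close>)
    finally have "pos (?i (act (rf \<beta>) x))"
    proof (rule pos_comb_eq)
      have "0 < a * p" using ap by simp
      then have "0 < p" using ab by (simp add: zero_less_mult_iff)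
      then show "0 \<le> 2 * p * b" using ab by simp
    qed (use ap x y w roots in \<open>auto intro!: root_act\<close>)
    then show False using early' pos_not_neg by blast
  qed
  have rts: "rt (act (inv v1) x)" "rt (act (inv v1) y)" using roots v(1) root_act by auto
  have nx: "act (inv v1) x \<noteq> \<alpha> s" using ne v(1,6) act_inv_cancel(2)[of v1 x] by metis
  have ny: "act (inv v1) y \<noteq> \<alpha> s"
  proof
    assume "act (inv v1) y = \<alpha> s"
    then have yb: "y = \<beta>" using v(1,6) act_inv_cancel(2)[of v1 y] by metis
    have "a *\<^sub>R x = \<beta> - b *\<^sub>R y" by (subst eq) simp
    also have "\<dots> = (1 - b) *\<^sub>R \<beta>" unfolding yb by (simp add: scaleR_diff_left)
    finally have ax: "a *\<^sub>R x = (1 - b) *\<^sub>R \<beta>" .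
    have "x = (1 / a) *\<^sub>R (a *\<^sub>R x)" using ab by simp
    then have "x = ((1 - b) / a) *\<^sub>R \<beta>" unfolding ax by simp
    then show False using pos_multiple_eq[OF x(1) bp(1)] ne by blast
  qed
  consider "pos (act (inv v1) x)" "pos (act (inv v1) y)" | "neg (act (inv v1) x)" "neg (act (inv v1) y)"
    | "neg (act (inv v1) x)" "pos (act (inv v1) y)" | "pos (act (inv v1) x)" "neg (act (inv v1) y)"
    using rts root_cases by blast
  then show False
  proof cases
    case 1
    then show False
      using simple_root_extreme_roots(1)[OF 1 ab v(2), of 1] eq' nx by simp
  next
    case 2
    have "- \<alpha> s = a *\<^sub>R (- act (inv v1) x) + b *\<^sub>R (- act (inv v1) y)"
      unfolding eq' by simp
    then have "neg (\<alpha> s)"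
      by (rule pos_comb_eq) (use 2 ab v(2) root_simple in auto)
    then show False using pos_simple v(2) pos_not_neg by blast
  next
    case 3
    then show False using main[OF x y ab eq] ny by blast
  next
    case 4
    have "\<beta> = b *\<^sub>R y + a *\<^sub>R x" using eq by (simp add: add.commute)
    then show False using main[OF y x ab(2,1)] 4 nx by blast
  qed
qed

subsection \<open>Depth\<close>

text \<open>The usual depth of a positive root, with value 1 on simple roots; not to be confused
  with \<open>dominance_depth\<close>. It is the measure of the inductions on roots.\<close>

definition depth :: "'v \<Rightarrow> nat" where
  "depth \<beta> = (LEAST n. \<exists>g \<in> carrier W. lg g = n \<and> neg (act (inv g) \<beta>))"

lemma depth_le: "g \<in> carrier W \<Longrightarrow> neg (act (inv g) \<beta>) \<Longrightarrow> depth \<beta> \<le> lg g"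
  unfolding depth_def by (rule Least_le) blast

lemma depth_witness:
  assumes "pos \<beta>"
  shows "\<exists>g \<in> carrier W. lg g = depth \<beta> \<and> neg (act (inv g) \<beta>)"
proof -
  have r: "rt \<beta>" using assms pos_root by blast
  have "\<exists>n. \<exists>g \<in> carrier W. lg g = n \<and> neg (act (inv g) \<beta>)"
    using r assms by (intro exI[of _ "lg (rf \<beta>)"] bexI[of _ "rf \<beta>"]) (simp_all add: act_rf_self)
  from LeastI_ex[OF this] show ?thesis unfolding depth_def by blast
qed

text \<open>A shortest element that inverts \<beta> loses this property with its last letter, so
  just before that letter \<beta> has been carried to its simple root.\<close>

lemma depth_step:
  assumes "pos \<beta>"
  obtains g t where "g \<in> carrier W" "t \<in> S" "act g (\<alpha> t) = \<beta>" "depth \<beta> = lg g + 1"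
proof -
  obtain h where h: "h \<in> carrier W" "lg h = depth \<beta>" "neg (act (inv h) \<beta>)"
    using depth_witness[OF assms] by blast
  have "h \<noteq> \<one>" using h assms pos_not_neg by auto
  then obtain t where t: "t \<in> S" "lg (h \<otimes> t) < lg h" using exists_right_descent h by blast
  define g where "g = h \<otimes> t"
  have g: "g \<in> carrier W" "h = g \<otimes> t" "lg h = lg g + 1"
    using t h gens_closed length_mult_gen_cases[of t h] unfolding g_def by auto
  have r: "rt (act (inv g) \<beta>)" using g assms pos_root root_act by blast
  have "\<not> neg (act (inv g) \<beta>)" using depth_le[of g \<beta>] g h by linarith
  then have p: "pos (act (inv g) \<beta>)" using r root_cases by blast
  have "act (inv h) \<beta> = act t (act (inv g) \<beta>)"
    unfolding g(2) using g(1) t gens_closed by (simp add: inv_mult_group gens_inv)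
  then have "act (inv g) \<beta> = \<alpha> t" using gen_permutes_pos[OF p t(1)] h(3) pos_not_neg by auto
  then have "act g (\<alpha> t) = \<beta>" using g(1) by (metis act_inv_cancel(2))
  then show ?thesis using that g t h by simp
qed

lemma depth_gen_le:
  assumes "pos \<beta>" "s \<in> S"
  shows "depth (act s \<beta>) \<le> depth \<beta> + 1"
proof -
  obtain g where g: "g \<in> carrier W" "lg g = depth \<beta>" "neg (act (inv g) \<beta>)"
    using depth_witness[OF assms(1)] by blast
  have "depth (act s \<beta>) \<le> lg (s \<otimes> g)"
    using g assms gens_closed by (intro depth_le) (auto simp: inv_mult_group gens_inv)
  also have "\<dots> \<le> depth \<beta> + 1" using length_mult_le[of s g] g assms gens_closed by auto
  finally show ?thesis .
qed

text \<open>Take a minimal \<open>g\<close> with \<open>act g (\<alpha> t) = \<beta>\<close>. If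
  \<open>inv g\<close> keeps \<alpha> s positive, extremality of \<alpha> t shows that
  \<open>g\<close> already inverts \<open>act s \<beta>\<close>. Otherwise \<open>s\<close> is a
  left descent of \<open>g\<close>, and \<open>s \<otimes> g \<otimes> t\<close>, no longer than
  \<open>g\<close>, inverts \<open>act s \<beta>\<close>.\<close>

lemma depth_gen_less:
  assumes "pos \<beta>" "s \<in> S" "0 < B (\<alpha> s) \<beta>" "\<beta> \<noteq> \<alpha> s"
  shows "depth (act s \<beta>) < depth \<beta>"
proof -
  obtain g t where g: "g \<in> carrier W" "t \<in> S" "act g (\<alpha> t) = \<beta>" "depth \<beta> = lg g + 1"
    using depth_step[OF assms(1)] by blast
  have gt: "act (inv g) \<beta> = \<alpha> t" using g by auto
  define k where "k = 2 * B (\<alpha> s) \<beta>"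
  have k: "0 < k" using assms by (simp add: k_def)
  have e: "act (inv g) (act s \<beta>) = \<alpha> t - k *\<^sub>R act (inv g) (\<alpha> s)"
    using g assms by (simp add: act_gen gt k_def)
  have rs: "rt (act (inv g) (\<alpha> s))" "rt (act (inv g) (act s \<beta>))"
    using g(1) assms root_act root_simple gens_closed pos_root by (meson inv_closed)+
  show ?thesis
  proof (cases "pos (act (inv g) (\<alpha> s))")
    case True
    have "neg (act (inv g) (act s \<beta>))"
    proof (rule ccontr)
      assume "\<not> ?thesis"
      then have p: "pos (act (inv g) (act s \<beta>))" using rs root_cases by blast
      have "1 *\<^sub>R act (inv g) (act s \<beta>) + k *\<^sub>R act (inv g) (\<alpha> s) = 1 *\<^sub>R \<alpha> t" unfolding e by simp
      then have "act (inv g) (\<alpha> s) = \<alpha> t"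
        using simple_root_extreme_roots(2)[OF p True zero_less_one k g(2)] by blast
      then show False using gt assms(4) g(1) by (metis act_inv_cancel(2))
    qed
    then show ?thesis using depth_le[of g "act s \<beta>"] g by simp
  next
    case False
    then have "lg (s \<otimes> g) < lg g" using left_ascent_iff(2)[of g s] rs root_cases g assms by blast
    moreover have "neg (act (inv (s \<otimes> g \<otimes> t)) (act s \<beta>))"
      using g(1,2) assms gens_closed
      by (simp add: inv_mult_group gens_inv gt act_gen_simple pos_simple)
    then have "depth (act s \<beta>) \<le> lg (s \<otimes> g \<otimes> t)" using g assms gens_closed by (intro depth_le) auto
    moreover have "lg (s \<otimes> g \<otimes> t) \<le> lg (s \<otimes> g) + 1"
      using length_mult_le[of "s \<otimes> g" t] g assms gens_closed by simp
    ultimately show ?thesis using g(4) by simp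
  qed
qed

lemma exists_pos_form_simple:
  assumes "pos \<beta>"
  shows "\<exists>s \<in> S. 0 < B (\<alpha> s) \<beta>"
proof (rule ccontr)
  assume n: "\<not> ?thesis"
  obtain F c where c: "cone_coeffs F c \<beta>" using cone_coeffs_exist pos_cone assms by blast
  have F: "F \<subseteq> S" "\<And>s. 0 \<le> c s" "\<beta> = (\<Sum>s\<in>F. c s *\<^sub>R \<alpha> s)" using c by (simp_all add: cone_coeffs_def)
  have "B \<beta> \<beta> = (\<Sum>s\<in>F. c s * B \<beta> (\<alpha> s))"
    by (subst (2) F(3)) (simp add: form_sum_right)
  also have "\<dots> \<le> 0"
  proof (rule sum_nonpos)
    fix s assume "s \<in> F"
    then have "B \<beta> (\<alpha> s) \<le> 0" using n F form_sym[of \<beta> "\<alpha> s"] by force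
    then show "c s * B \<beta> (\<alpha> s) \<le> 0" using F(2)[of s] by (simp add: mult_nonneg_nonpos)
  qed
  finally show False using form_root[of \<beta>] assms pos_root by simp
qed

text \<open>For a minimal \<open>g\<close> with \<open>act g (\<alpha> t) = \<zeta>\<close>, the
  root \<alpha> s stays positive under \<open>inv g\<close>: otherwise \<open>act s \<zeta>\<close>
  would be shallower than \<zeta>, although its product with \<alpha> s is positive. Extremality of
  \<alpha> t then forces \<open>inv g\<close> to make \<omega> negative.\<close>

lemma depth_summand_less:
  assumes "pos \<zeta>" "pos \<omega>" "s \<in> S" "B (\<alpha> s) \<zeta> < 0" "0 < a" "0 < b" "\<zeta> = a *\<^sub>R \<omega> + b *\<^sub>R \<alpha> s"
  shows "depth \<omega> < depth \<zeta>"
proof -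
  obtain g t where g: "g \<in> carrier W" "t \<in> S" "act g (\<alpha> t) = \<zeta>" "depth \<zeta> = lg g + 1"
    using depth_step[OF assms(1)] by blast
  have gt: "act (inv g) \<zeta> = \<alpha> t" using g by auto
  have ns: "\<zeta> \<noteq> \<alpha> s" using assms(3,4) form_simple_root[of s] by auto
  have rs: "rt (act (inv g) (\<alpha> s))" "rt (act (inv g) \<omega>)"
    using g(1) assms root_act root_simple pos_root by (meson inv_closed)+
  have ps: "pos (act (inv g) (\<alpha> s))"
  proof (rule ccontr)
    assume "\<not> ?thesis"
    then have l: "lg (s \<otimes> g) < lg g" using left_ascent_iff(2)[of g s] rs root_cases g assms by blast
    have "neg (act (inv (s \<otimes> g \<otimes> t)) (act s \<zeta>))"
      using g(1,2) assms(3) gens_closed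
      by (simp add: inv_mult_group gens_inv gt act_gen_simple pos_simple)
    then have "depth (act s \<zeta>) \<le> lg (s \<otimes> g \<otimes> t)" using g assms gens_closed by (intro depth_le) auto
    moreover have "lg (s \<otimes> g \<otimes> t) \<le> lg (s \<otimes> g) + 1"
      using length_mult_le[of "s \<otimes> g" t] g assms gens_closed by simp
    ultimately have "depth (act s \<zeta>) < depth \<zeta>" using l g(4) by simp
    moreover have p: "pos (act s \<zeta>)" using gen_permutes_pos assms ns by blast
    have "0 < B (\<alpha> s) (act s \<zeta>)" using assms(3,4) form_simple_root[of s] by (simp add: act_gen)
    moreover have "act s \<zeta> \<noteq> \<alpha> s"
      using assms(1,3) act_gen_simple[of s] act_gen_gen[of s \<zeta>] pos_not_neg pos_simple by metis
    ultimately show False using depth_gen_less[OF p assms(3)] assms(3) by simp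
  qed
  have e: "a *\<^sub>R act (inv g) \<omega> + b *\<^sub>R act (inv g) (\<alpha> s) = 1 *\<^sub>R \<alpha> t"
    using arg_cong[OF assms(7), of "act (inv g)"] gt g(1) by simp
  have "\<not> pos (act (inv g) \<omega>)"
  proof
    assume "pos (act (inv g) \<omega>)"
    from simple_root_extreme_roots(2)[OF this ps assms(5,6) g(2) e]
    have "act (inv g) (\<alpha> s) = act (inv g) \<zeta>" using gt by simp
    then show False using ns g(1) by (metis act_inv_cancel(2))
  qed
  then show ?thesis using depth_le[of g \<omega>] rs root_cases g by fastforce
qed

subsection \<open>Dominance\<close>

text \<open>The dominance relation makes sense on all roots, and then it is invariant under \<open>W\<close> and
  reversed by negation.\<close>

definition dom :: "'v \<Rightarrow> 'v \<Rightarrow> bool" where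
  "dom \<gamma> \<beta> \<longleftrightarrow> rt \<gamma> \<and> rt \<beta> \<and> (\<forall>u \<in> carrier W. neg (act u \<beta>) \<longrightarrow> neg (act u \<gamma>))"

lemma dom_roots: "dom \<gamma> \<beta> \<Longrightarrow> rt \<gamma>" "dom \<gamma> \<beta> \<Longrightarrow> rt \<beta>"
  by (simp_all add: dom_def)

lemma dom_negD: "dom \<gamma> \<beta> \<Longrightarrow> u \<in> carrier W \<Longrightarrow> neg (act u \<beta>) \<Longrightarrow> neg (act u \<gamma>)"
  by (simp add: dom_def)

lemma dom_posD: "dom \<gamma> \<beta> \<Longrightarrow> u \<in> carrier W \<Longrightarrow> pos (act u \<gamma>) \<Longrightarrow> pos (act u \<beta>)"
  using dom_negD[of \<gamma> \<beta> u] pos_not_neg[of "act u \<gamma>"] root_cases[OF root_act[OF dom_roots(2)], of \<gamma> \<beta> u]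
  by blast

lemma dom_pos: "dom \<gamma> \<beta> \<Longrightarrow> pos \<gamma> \<Longrightarrow> pos \<beta>"
  using dom_posD[of \<gamma> \<beta> \<one>] by simp

lemma dom_neg: "dom \<gamma> \<beta> \<Longrightarrow> neg \<beta> \<Longrightarrow> neg \<gamma>"
  using dom_negD[of \<gamma> \<beta> \<one>] by simp

lemma dom_refl: "rt \<beta> \<Longrightarrow> dom \<beta> \<beta>"
  by (simp add: dom_def)

lemma dom_trans: "dom \<delta> \<gamma> \<Longrightarrow> dom \<gamma> \<beta> \<Longrightarrow> dom \<delta> \<beta>"
  by (simp add: dom_def)

lemma dom_act: "dom \<gamma> \<beta> \<Longrightarrow> u \<in> carrier W \<Longrightarrow> dom (act u \<gamma>) (act u \<beta>)"
proof -
  assume d: "dom \<gamma> \<beta>" and u: "u \<in> carrier W"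
  have "neg (act v (act u \<beta>)) \<Longrightarrow> neg (act v (act u \<gamma>))" if "v \<in> carrier W" for v
    using dom_negD[OF d, of "v \<otimes> u"] u that by simp
  moreover have "rt (act u \<gamma>)" "rt (act u \<beta>)" using root_act dom_roots[OF d] u by blast+
  ultimately show ?thesis unfolding dom_def by blast
qed

lemma dom_minus:
  assumes "dom \<gamma> \<beta>"
  shows "dom (- \<beta>) (- \<gamma>)"
  unfolding dom_def
proof (intro conjI ballI impI)
  fix u assume u: "u \<in> carrier W" "neg (act u (- \<gamma>))"
  then show "neg (act u (- \<beta>))" using dom_posD[OF assms u(1)] by simp
qed (use dom_roots assms in auto)

text \<open>\<open>s\<close> makes \<alpha> s negative and hence \<gamma>, but it makes no positive
  root other than \<alpha> s negative.\<close>

lemma dom_simple_left: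
  assumes "dom \<gamma> (\<alpha> s)" "s \<in> S" "\<gamma> \<noteq> \<alpha> s"
  shows "neg \<gamma>"
proof -
  have "neg (act s (\<alpha> s))" using assms(2) by (simp add: act_gen_simple pos_simple)
  then have "neg (act s \<gamma>)" using dom_negD[OF assms(1)] gens_closed assms(2) by blast
  then show ?thesis
    using gen_permutes_pos[OF _ assms(2,3)] dom_roots[OF assms(1)] root_cases pos_not_neg by blast
qed

text \<open>Move one of the roots to a simple root. The other one is then positive, because it
  dominates a positive root, and \<open>dom_simple_left\<close> leaves only equality.\<close>

lemma dom_antisym:
  assumes "dom \<gamma> \<beta>" "dom \<beta> \<gamma>"
  shows "\<gamma> = \<beta>"
proof -
  obtain g s where g: "g \<in> carrier W" "s \<in> S" "\<gamma> = act g (\<alpha> s)"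
    using dom_roots(1)[OF assms(1)] unfolding roots_def by blast
  have "dom (act (inv g) \<beta>) (\<alpha> s)" "dom (\<alpha> s) (act (inv g) \<beta>)"
    using dom_act[OF assms(2), of "inv g"] dom_act[OF assms(1), of "inv g"] g by auto
  then have "act (inv g) \<beta> = \<alpha> s"
    using dom_simple_left dom_pos pos_simple pos_not_neg g by blast
  then show ?thesis using g by (metis act_inv_cancel(2))
qed

lemma dominates_iff: "dominates W \<beta> \<gamma> \<longleftrightarrow> pos \<gamma> \<and> pos \<beta> \<and> dom \<gamma> \<beta>"
proof -
  have "(\<forall>u \<in> carrier W. \<beta> \<in> inversions W u \<longrightarrow> \<gamma> \<in> inversions W u) \<longleftrightarrow> dom \<gamma> \<beta>"
    if p: "pos \<gamma>" "pos \<beta>"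
  proof
    assume a: "\<forall>u \<in> carrier W. \<beta> \<in> inversions W u \<longrightarrow> \<gamma> \<in> inversions W u"
    show "dom \<gamma> \<beta>" unfolding dom_def
    proof (intro conjI ballI impI)
      fix u assume u: "u \<in> carrier W" "neg (act u \<beta>)"
      then show "neg (act u \<gamma>)" using a[rule_format, of "inv u"] p by (simp add: inversions_iff)
    qed (use p pos_root in auto)
  qed (use p dom_negD in \<open>auto simp: inversions_iff\<close>)
  then show ?thesis unfolding dominates_def by blast
qed

abbreviation "D \<beta> \<equiv> {\<gamma>. pos \<gamma> \<and> \<gamma> \<noteq> \<beta> \<and> dom \<gamma> \<beta>}"
abbreviation "dp \<equiv> dominance_depth W"

lemma dp_eq: "pos \<beta> \<Longrightarrow> dp \<beta> = card (D \<beta>)"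
  unfolding dominance_depth_def by (rule arg_cong[of _ _ card]) (auto simp: dominates_iff)

lemma finite_D: "pos \<beta> \<Longrightarrow> finite (D \<beta>)"
proof -
  assume p: "pos \<beta>"
  then have r: "rt \<beta>" using pos_root by blast
  have "D \<beta> \<subseteq> {\<gamma>. pos \<gamma> \<and> neg (act (rf \<beta>) \<gamma>)}"
    using dom_negD[of _ \<beta> "rf \<beta>"] r p act_rf_self[OF r] by auto
  then show ?thesis using finite_inverted[of "rf \<beta>"] r finite_subset by auto
qed

lemma dp_mono:
  assumes "dom \<gamma> \<beta>" "pos \<gamma>"
  shows "dp \<gamma> \<le> dp \<beta>"
proof -
  have p: "pos \<beta>" using assms dom_pos by blast
  have "D \<gamma> \<subseteq> D \<beta>" using dom_trans dom_antisym assms by blast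
  then show ?thesis using card_mono[OF finite_D[OF p]] dp_eq[OF p] dp_eq[OF assms(2)] by simp
qed

text \<open>The injection keeps the dominated roots that \<open>s\<^sub>\<xi>\<close> makes negative and reflects the others.\<close>

lemma dp_reflection_le:
  assumes "pos \<xi>" "pos \<kappa>" "B \<xi> \<kappa> \<le> 0"
  shows "dp \<kappa> \<le> dp (act (rf \<xi>) \<kappa>)"
proof -
  let ?\<sigma> = "act (rf \<xi>)"
  let ?\<kappa> = "?\<sigma> \<kappa>"
  have r: "rt \<xi>" "rt \<kappa>" using assms pos_root by auto
  have c: "rf \<xi> \<in> carrier W" using r by simp
  define m where "m = - 2 * B \<xi> \<kappa>"
  have m: "0 \<le> m" using assms(3) by (simp add: m_def)
  have ka: "?\<kappa> = 1 *\<^sub>R \<kappa> + m *\<^sub>R \<xi>" using act_rf[OF r(1)] by (simp add: m_def)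
  have kp: "pos ?\<kappa>" by (rule pos_comb_eq[OF ka]) (use assms m r c root_act in auto)
  define f where "f \<gamma> = (if neg (?\<sigma> \<gamma>) then \<gamma> else ?\<sigma> \<gamma>)" for \<gamma>
  have ss: "?\<sigma> (?\<sigma> v) = v" for v using r by simp
  have "f ` D \<kappa> \<subseteq> D ?\<kappa>"
  proof (rule image_subsetI)
    fix \<gamma> assume "\<gamma> \<in> D \<kappa>"
    then have g: "pos \<gamma>" "\<gamma> \<noteq> \<kappa>" "dom \<gamma> \<kappa>" by auto
    have rg: "rt \<gamma>" "rt (?\<sigma> \<gamma>)" using g pos_root root_act c by auto
    have d: "dom (?\<sigma> \<gamma>) ?\<kappa>" using dom_act g c by blast
    show "f \<gamma> \<in> D ?\<kappa>"
    proof (cases "neg (?\<sigma> \<gamma>)")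
      case False
      then have "pos (?\<sigma> \<gamma>)" using rg root_cases by blast
      moreover have "?\<sigma> \<gamma> \<noteq> ?\<kappa>" using g(2) ss by metis
      ultimately show ?thesis using d False by (simp add: f_def)
    next
      case True
      define k where "k = 2 * B \<xi> \<gamma>"
      have sg: "?\<sigma> \<gamma> = \<gamma> - k *\<^sub>R \<xi>" using act_rf[OF r(1)] by (simp add: k_def)
      have k: "0 < k"
      proof (rule ccontr)
        assume "\<not> 0 < k"
        then have k0: "0 \<le> - k" by simp
        have "?\<sigma> \<gamma> = 1 *\<^sub>R \<gamma> + (- k) *\<^sub>R \<xi>" unfolding sg by simp
        then have "pos (?\<sigma> \<gamma>)" by (rule pos_comb_eq) (use g assms k0 rg in auto)
        then show False using True pos_not_neg by blast
      qed
      \<comment> \<open>If \<open>u\<close> makes \<open>?\<kappa>\<close> negative but not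
        \<kappa>, it must make \<xi> negative, as \<open>?\<kappa>\<close> is a non-negative
        combination of the two. It also makes \<open>?\<sigma> \<gamma>\<close> negative, and
        \<gamma> is a positive combination of \<open>?\<sigma> \<gamma>\<close> and \<xi>.\<close>
      have "dom \<gamma> ?\<kappa>" unfolding dom_def
      proof (intro conjI ballI impI)
        fix u assume u: "u \<in> carrier W" "neg (act u ?\<kappa>)"
        have ru: "rt (act u \<gamma>)" "rt (act u \<kappa>)" "rt (act u \<xi>)" using root_act u r rg by auto
        show "neg (act u \<gamma>)"
        proof (cases "neg (act u \<kappa>)")
          case True then show ?thesis using dom_negD g u by blast
        next
          case False
          then have pk: "pos (act u \<kappa>)" using ru root_cases by blast
          have uk: "act u ?\<kappa> = 1 *\<^sub>R act u \<kappa> + m *\<^sub>R act u \<xi>" unfolding ka using u by simp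
          have nc: "neg (act u \<xi>)"
          proof (rule ccontr)
            assume "\<not> ?thesis"
            then have "pos (act u \<xi>)" using ru root_cases by blast
            then have "pos (act u ?\<kappa>)"
              by (intro pos_comb_eq[OF uk]) (use pk m u kp root_act pos_root in auto)
            then show False using u pos_not_neg by blast
          qed
          have ng: "neg (act u (?\<sigma> \<gamma>))" using dom_negD[OF d u] .
          have "- act u \<gamma> = 1 *\<^sub>R (- act u (?\<sigma> \<gamma>)) + k *\<^sub>R (- act u \<xi>)"
            unfolding sg using u by simp
          then show ?thesis by (rule pos_comb_eq) (use ng nc k ru in auto)
        qed
      qed (use rg r c root_act in auto)
      moreover have "\<gamma> \<noteq> ?\<kappa>" using True ss assms(2) pos_not_neg by metis
      ultimately show ?thesis using True g by (simp add: f_def)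
    qed
  qed
  moreover have "inj_on f (D \<kappa>)"
  proof (rule inj_onI)
    fix x y assume xy: "x \<in> D \<kappa>" "y \<in> D \<kappa>" "f x = f y"
    have px: "pos x" "pos y" using xy by auto
    have np: "\<not> neg x" "\<not> neg y" using px pos_not_neg by blast+
    consider "neg (?\<sigma> x)" "neg (?\<sigma> y)" | "\<not> neg (?\<sigma> x)" "\<not> neg (?\<sigma> y)"
      | "neg (?\<sigma> x)" "\<not> neg (?\<sigma> y)" | "\<not> neg (?\<sigma> x)" "neg (?\<sigma> y)" by blast
    then show "x = y"
    proof cases
      case 1 then show ?thesis using xy(3) unfolding f_def by metis
    next
      case 2
      then have "?\<sigma> x = ?\<sigma> y" using xy(3) unfolding f_def by metis
      then show ?thesis using ss by metis
    next
      case 3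
      then have "x = ?\<sigma> y" using xy(3) unfolding f_def by metis
      then show ?thesis using 3 ss np by metis
    next
      case 4
      then have "?\<sigma> x = y" using xy(3) unfolding f_def by metis
      then show ?thesis using 4 ss np by metis
    qed
  qed
  ultimately have "card (D \<kappa>) \<le> card (D ?\<kappa>)"
    using card_inj_on_le finite_D kp by blast
  then show ?thesis using dp_eq kp assms(2) by simp
qed

end

subsection \<open>Roots in a plane\<close>

text \<open>Two reflections compose to a translation by \<open>2 * \<phi>\<close>, so every element
  can be moved into the interval from 0 to \<open>2 * \<phi>\<close>. Reflecting there in \<phi> and
  using minimality leaves only 0 and \<phi>.\<close>

lemma reflection_closed_multiples:
  fixes A :: "real set"
  assumes zero: "0 \<in> A" and refl: "\<And>x y. x \<in> A \<Longrightarrow> y \<in> A \<Longrightarrow> 2 * y - x \<in> A"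
    and phi: "\<phi> \<in> A" "0 < \<phi>" and min: "\<And>x. x \<in> A \<Longrightarrow> 0 < x \<Longrightarrow> \<phi> \<le> x"
  shows "x \<in> A \<longleftrightarrow> (\<exists>j::int. x = of_int j * \<phi>)"
proof -
  have minus: "- x \<in> A" if "x \<in> A" for x using refl[OF that zero] by simp
  have up: "x + 2 * \<phi> \<in> A" if "x \<in> A" for x
    using refl[OF minus[OF that] phi(1)] by (simp add: algebra_simps)
  have down: "x - 2 * \<phi> \<in> A" if "x \<in> A" for x
    using minus[OF up[OF minus[OF that]]] by (simp add: algebra_simps)
  have ups: "x + 2 * real k * \<phi> \<in> A" if "x \<in> A" for x and k :: nat
  proof (induction k)
    case (Suc k)
    then show ?case using up[OF Suc] by (simp add: algebra_simps)
  qed (use that in simp)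
  have downs: "x - 2 * real k * \<phi> \<in> A" if "x \<in> A" for x and k :: nat
    using minus[OF ups[OF minus[OF that], of k]] by (simp add: algebra_simps)
  have shift: "x + 2 * of_int k * \<phi> \<in> A" if "x \<in> A" for x and k :: int
  proof (cases "0 \<le> k")
    case True then show ?thesis using ups[OF that, of "nat k"] by simp
  next
    case False then show ?thesis using downs[OF that, of "nat (- k)"] by simp
  qed
  show ?thesis
  proof
    assume x: "x \<in> A"
    define k where "k = \<lfloor>x / (2 * \<phi>)\<rfloor>"
    define y where "y = x - 2 * of_int k * \<phi>"
    have yA: "y \<in> A" using shift[OF x, of "- k"] by (simp add: y_def)
    have "of_int k \<le> x / (2 * \<phi>)" "x / (2 * \<phi>) < of_int k + 1" unfolding k_def by linarith+
    then have y: "0 \<le> y" "y < 2 * \<phi>" using phi by (auto simp: y_def field_simps)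
    have "y = 0 \<or> y = \<phi>"
    proof (cases "y = 0")
      case False
      have "2 * \<phi> - y \<in> A" using refl[OF yA phi(1)] .
      then show ?thesis using min[of "2 * \<phi> - y"] min[OF yA] y False by linarith
    qed simp
    then have "x = of_int (2 * k) * \<phi> \<or> x = of_int (2 * k + 1) * \<phi>"
      by (auto simp: y_def algebra_simps)
    then show "\<exists>j::int. x = of_int j * \<phi>" by blast
  next
    assume "\<exists>j::int. x = of_int j * \<phi>"
    then obtain j :: int where j: "x = of_int j * \<phi>" by blast
    consider k where "j = 2 * k" | k where "j = 2 * k + 1" by (metis evenE oddE)
    then show "x \<in> A"
    proof cases
      case 1 then show ?thesis using shift[OF zero, of k] j by simp
    next
      case 2 then show ?thesis using shift[OF phi(1), of k] j by (simp add: algebra_simps)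
    qed
  qed
qed

section \<open>Unit circles and the angles of roots in positive definite planes\<close>

definition circ :: "'v::real_vector \<Rightarrow> 'v \<Rightarrow> real \<Rightarrow> 'v" where
  "circ b c t = cos t *\<^sub>R b + sin t *\<^sub>R c"

lemma circ_0 [simp]: "circ b c 0 = b"
  by (simp add: circ_def)

lemma circ_plus_pi [simp]: "circ b c (t + pi) = - circ b c t" "circ b c (pi + t) = - circ b c t"
  by (simp_all add: circ_def)

lemma circ_minus_pi [simp]: "circ b c (t - pi) = - circ b c t"
  using circ_plus_pi(1)[of b c "t - pi"] by simp

lemma circ_pi_minus: "circ b c (pi - t) = - circ b c (- t)"
  using circ_plus_pi(1)[of b c "- t"] by simp

lemma circ_uminus: "circ b (- c) t = circ b c (- t)"
  by (simp add: circ_def)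

text \<open>For \<open>x < y < z < x + pi\<close> the three sines are positive, so a root at an
  intermediate angle is a positive combination of its neighbours.\<close>

lemma circ_between:
  "sin (z - x) *\<^sub>R circ b c y = sin (z - y) *\<^sub>R circ b c x + sin (y - x) *\<^sub>R circ b c z"
proof -
  have "sin (z - x) * cos y = sin (z - y) * cos x + sin (y - x) * cos z"
    "sin (z - x) * sin y = sin (z - y) * sin x + sin (y - x) * sin z"
    by (simp_all add: sin_diff algebra_simps)
  then show ?thesis
    by (simp add: circ_def scaleR_add_right scaleR_add_left)
qed

context geometric_representation
begin

definition orthonormal :: "'v \<Rightarrow> 'v \<Rightarrow> bool" where
  "orthonormal b c \<longleftrightarrow> B b b = 1 \<and> B c c = 1 \<and> B b c = 0"

lemma orthonormal_uminus: "orthonormal b c \<Longrightarrow> orthonormal b (- c)"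
  by (simp add: orthonormal_def)

lemma orthonormal_act: "u \<in> carrier W \<Longrightarrow> orthonormal b c \<Longrightarrow> orthonormal (act u b) (act u c)"
  by (simp add: orthonormal_def)

lemma act_circ: "u \<in> carrier W \<Longrightarrow> act u (circ b c t) = circ (act u b) (act u c) t"
  by (simp add: circ_def)

lemma form_circ:
  assumes "orthonormal b c"
  shows "B (circ b c t) (circ b c u) = cos (t - u)"
proof -
  have "B b b = 1" "B c c = 1" "B b c = 0" "B c b = 0"
    using assms form_sym[of c b] by (simp_all add: orthonormal_def)
  then show ?thesis by (simp add: circ_def cos_diff)
qed

lemma circ_reflect:
  "circ b c t - (2 * cos (u - t)) *\<^sub>R circ b c u = - circ b c (2 * u - t)"
proof -
  have c: "cos t - 2 * cos (u - t) * cos u = - cos (2 * u - t)"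
    using cos_add[of u "u - t"] cos_diff[of u "u - t"] by (simp add: algebra_simps)
  have s: "sin t - 2 * cos (u - t) * sin u = - sin (2 * u - t)"
    using sin_add[of u "u - t"] sin_diff[of u "u - t"] by (simp add: algebra_simps)
  have "circ b c t - (2 * cos (u - t)) *\<^sub>R circ b c u =
    (cos t - 2 * cos (u - t) * cos u) *\<^sub>R b + (sin t - 2 * cos (u - t) * sin u) *\<^sub>R c"
    by (simp add: circ_def scaleR_add_right scaleR_diff_left)
  then show ?thesis unfolding c s by (simp add: circ_def)
qed

lemma act_rf_circ:
  "orthonormal b c \<Longrightarrow> rt (circ b c u) \<Longrightarrow> act (rf (circ b c u)) (circ b c t) = - circ b c (2 * u - t)"
  using circ_reflect[of b c t u] by (simp add: act_rf form_circ)

lemma act_gen_circ: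
  "s \<in> S \<Longrightarrow> orthonormal (\<alpha> s) c \<Longrightarrow> act s (circ (\<alpha> s) c t) = - circ (\<alpha> s) c (- t)"
  using act_rf_circ[of "\<alpha> s" c 0 t] root_simple[of s] by (simp add: rf_simple)

lemma circ_eq_cos:
  assumes "orthonormal b c" "circ b c t = circ b c u"
  shows "cos (t - u) = 1"
  using form_circ[OF assms(1), of t u] form_circ[OF assms(1), of u u] assms(2) by simp

lemma circ_inj:
  assumes "orthonormal b c" "circ b c t = circ b c u" "\<bar>t - u\<bar> < 2 * pi"
  shows "t = u"
proof -
  obtain k :: int where k: "t - u = of_int k * 2 * pi"
    using circ_eq_cos[OF assms(1,2)] cos_one_2pi_int by blast
  have "\<bar>of_int k :: real\<bar> * (2 * pi) < 1 * (2 * pi)"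
    using assms(3) unfolding k by (simp add: abs_mult)
  then have "\<bar>of_int k :: real\<bar> < 1" by (subst (asm) mult_less_cancel_right) auto
  then have "k = 0" by linarith
  then show ?thesis using k by simp
qed

lemma circ_between_pos:
  assumes "pos (circ b c x)" "pos (circ b c z)" "x \<le> y" "y \<le> z" "z - x < pi" "rt (circ b c y)"
  shows "pos (circ b c y)"
proof (cases "x = z")
  case True then show ?thesis using assms by simp
next
  case False
  have s: "0 < sin (z - x)" "0 \<le> sin (z - y)" "0 \<le> sin (y - x)"
    using assms False by (auto intro!: sin_gt_zero sin_ge_zero)
  have "circ b c y = (1 / sin (z - x)) *\<^sub>R (sin (z - x) *\<^sub>R circ b c y)" using s by simp
  also have "\<dots> = (sin (z - y) / sin (z - x)) *\<^sub>R circ b c x + (sin (y - x) / sin (z - x)) *\<^sub>R circ b c z"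
    unfolding circ_between[of z x b c y] by (simp add: scaleR_add_right)
  finally show ?thesis by (rule pos_comb_eq) (use s assms in auto)
qed

lemma circ_angles_reflect:
  "orthonormal b c \<Longrightarrow> rt (circ b c t) \<Longrightarrow> rt (circ b c u) \<Longrightarrow> rt (circ b c (2 * u - t))"
  using act_rf_circ[of b c u t] root_act[of "circ b c t" "rf (circ b c u)"]
  by (metis rf_closed root_neg_iff)

text \<open>\<open>s\<close> maps the angle \<open>t\<close> to \<open>pi - t\<close>, so one
  positive root inside the half circle provides another at the mirrored angle. Betweenness fills the
  arc from 0 to the larger of the two, and the mirror covers the remaining arc.\<close>

lemma simple_circ_pos:
  assumes s: "s \<in> S" and o: "orthonormal (\<alpha> s) c" and psi: "0 < \<psi>" "\<psi> < pi" "pos (circ (\<alpha> s) c \<psi>)"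
    and t: "rt (circ (\<alpha> s) c t)" "0 \<le> t" "t < pi"
  shows "pos (circ (\<alpha> s) c t)"
proof -
  let ?e = "circ (\<alpha> s) c"
  have flip: "pos (?e (pi - u))" if u: "pos (?e u)" "0 < u" "u < pi" for u
  proof -
    have "?e u \<noteq> \<alpha> s" using circ_inj[OF o, of u 0] u by auto
    then have "pos (act s (?e u))" using gen_permutes_pos u s by blast
    then show ?thesis using act_gen_circ[OF s o, of u] by (simp add: circ_pi_minus)
  qed
  obtain \<eta> where m: "0 < \<eta>" "\<eta> \<le> pi / 2" "pos (?e \<eta>)" "pos (?e (pi - \<eta>))"
  proof (cases "\<psi> \<le> pi / 2")
    case True then show ?thesis using that[of \<psi>] psi flip by auto
  next
    case False then show ?thesis using that[of "pi - \<psi>"] psi flip by auto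
  qed
  have low: "pos (?e u)" if "rt (?e u)" "0 \<le> u" "u \<le> pi - \<eta>" for u
    by (rule circ_between_pos[of _ _ 0 "pi - \<eta>"]) (use m that pos_simple s in auto)
  show ?thesis
  proof (cases "t \<le> pi - \<eta>")
    case True then show ?thesis using low t by blast
  next
    case False
    have "rt (?e (pi - t))" using act_gen_circ[OF s o, of t] t(1) s root_act gens_closed
      by (metis circ_pi_minus)
    then have "pos (?e (pi - t))" using low[of "pi - t"] False m t by simp
    then show ?thesis using flip[of "pi - t"] False m t by simp
  qed
qed

lemma simple_plane_angles_pos:
  assumes s: "s \<in> S" and o: "orthonormal (\<alpha> s) c" and psi: "0 < \<psi>" "\<psi> < pi" "pos (circ (\<alpha> s) c \<psi>)"
  shows "\<exists>n\<ge>2::nat. \<forall>t. rt (circ (\<alpha> s) c t) \<longleftrightarrow> (\<exists>j::int. t = of_int j * (pi / real n))"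
proof -
  let ?e = "circ (\<alpha> s) c"
  define A where "A = {t. rt (?e t)}"
  have zero: "0 \<in> A" using s by (simp add: A_def root_simple)
  have refl: "2 * y - x \<in> A" if "x \<in> A" "y \<in> A" for x y
    using circ_angles_reflect[OF o, of x y] that by (simp add: A_def)
  have piA: "pi \<in> A" using zero circ_plus_pi(1)[of "\<alpha> s" c 0] by (simp add: A_def)
  have ppos: "pos (?e t)" if "t \<in> A" "0 < t" "t < pi" for t
    using simple_circ_pos[OF s o psi] that by (simp add: A_def)
  have half: "\<exists>\<eta>\<in>A. 0 < \<eta> \<and> \<eta> \<le> pi / 2"
  proof (cases "\<psi> \<le> pi / 2")
    case True then show ?thesis using psi pos_root by (auto simp: A_def)
  next
    case False
    have "rt (?e \<psi>)" using psi pos_root by blast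
    then have "rt (?e (pi - \<psi>))" using act_gen_circ[OF s o, of \<psi>] s root_act gens_closed
      by (metis circ_pi_minus)
    then show ?thesis using False psi by (intro bexI[of _ "pi - \<psi>"]) (auto simp: A_def)
  qed
  then obtain \<theta> where th: "\<theta> \<in> A" "0 < \<theta>" "\<theta> \<le> pi / 2" by blast
  \<comment> \<open>A root whose angle lies strictly between 0 and \<open>2 * \<theta>\<close> is
    inverted by the reflection at \<theta>. There are finitely many of these, so a least positive
    angle exists.\<close>
  define F where "F = {t \<in> A. 0 < t \<and> t < 2 * \<theta>}"
  have fin: "finite F"
  proof -
    have rth: "rt (?e \<theta>)" using th by (simp add: A_def)
    have "?e ` F \<subseteq> {r. pos r \<and> neg (act (rf (?e \<theta>)) r)}"
    proof (rule image_subsetI)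
      fix t assume t: "t \<in> F"
      then have "2 * \<theta> - t \<in> A" using refl th by (simp add: F_def)
      then have "pos (?e (2 * \<theta> - t))" using ppos t th by (simp add: F_def)
      moreover have "pos (?e t)" using ppos t th by (simp add: F_def)
      ultimately show "?e t \<in> {r. pos r \<and> neg (act (rf (?e \<theta>)) r)}"
        using act_rf_circ[OF o rth] by simp
    qed
    then have "finite (?e ` F)" using finite_inverted[of "rf (?e \<theta>)"] rth finite_subset by auto
    moreover have "inj_on ?e F"
    proof (rule inj_onI)
      fix x y assume xy: "x \<in> F" "y \<in> F" "?e x = ?e y"
      have "\<bar>x - y\<bar> < 2 * pi" using xy(1,2) th unfolding F_def by simp linarith
      then show "x = y" using circ_inj[OF o xy(3)] by blast
    qed
    ultimately show ?thesis using finite_imageD by blast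
  qed
  have thF: "\<theta> \<in> F" using th by (simp add: F_def)
  define \<phi> where "\<phi> = Min F"
  have phiF: "\<phi> \<in> F" using Min_in fin thF unfolding \<phi>_def by blast
  have phi: "\<phi> \<in> A" "0 < \<phi>" "\<phi> \<le> \<theta>" using phiF fin thF by (auto simp: F_def \<phi>_def)
  have "\<phi> \<le> x" if "x \<in> A" "0 < x" for x
  proof (cases "x < 2 * \<theta>")
    case True
    then have "x \<in> F" using that by (simp add: F_def)
    then show ?thesis using fin by (simp add: \<phi>_def)
  next
    case False then show ?thesis using phi th by linarith
  qed
  from reflection_closed_multiples[OF zero refl phi(1,2) this]
  have mult: "x \<in> A \<longleftrightarrow> (\<exists>j::int. x = of_int j * \<phi>)" for x by blast
  obtain j :: int where j: "pi = of_int j * \<phi>" using mult piA by blast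
  have "0 < real_of_int j" using j phi pi_gt_zero by (metis zero_less_mult_pos2)
  then have j0: "0 < j" by simp
  have "2 * \<phi> \<le> of_int j * \<phi>" using phi th j by linarith
  then have "2 \<le> real_of_int j" using phi by simp
  then have n2: "2 \<le> nat j" by linarith
  have "pi / real (nat j) = \<phi>" using j j0 by (simp add: field_simps)
  then show ?thesis using mult n2 unfolding A_def by (intro exI[of _ "nat j"]) auto
qed

text \<open>Conjugation moves \<open>b\<close> to a simple root. If the second root then becomes
  negative, its opposite is used in the frame with the orientation of \<open>c\<close> reversed,
  which does not change the set of multiples.\<close>

lemma plane_angles:
  assumes b: "rt b" and o: "orthonormal b c" and psi: "0 < \<psi>" "\<psi> < pi" "rt (circ b c \<psi>)"
  shows "\<exists>n\<ge>2::nat. \<forall>t. rt (circ b c t) \<longleftrightarrow> (\<exists>j::int. t = of_int j * (pi / real n))"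
proof -
  obtain g s where g: "g \<in> carrier W" "s \<in> S" "b = act g (\<alpha> s)"
    using b unfolding roots_def by blast
  define c' where "c' = act (inv g) c"
  have o': "orthonormal (\<alpha> s) c'"
    using orthonormal_act[OF _ o, of "inv g"] g by (simp add: c'_def)
  have e: "circ b c t = act g (circ (\<alpha> s) c' t)" for t
    using g by (simp add: act_circ c'_def)
  have r: "rt (circ b c t) \<longleftrightarrow> rt (circ (\<alpha> s) c' t)" for t
    unfolding e using root_act_iff g by blast
  consider "pos (circ (\<alpha> s) c' \<psi>)" | "neg (circ (\<alpha> s) c' \<psi>)" using psi r root_cases by blast
  then show ?thesis
  proof cases
    case 1 then show ?thesis unfolding r by (rule simple_plane_angles_pos[OF g(2) o' psi(1,2)])
  next
    case 2
    have "pos (circ (\<alpha> s) (- c') (pi - \<psi>))" using 2 by (simp add: circ_uminus)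
    from simple_plane_angles_pos[OF g(2) orthonormal_uminus[OF o'] _ _ this] psi
    obtain n :: nat where n: "2 \<le> n"
      "\<And>t. rt (circ (\<alpha> s) c' (- t)) \<longleftrightarrow> (\<exists>j::int. t = of_int j * (pi / real n))"
      by (auto simp: circ_uminus)
    have "rt (circ (\<alpha> s) c' t) \<longleftrightarrow> (\<exists>j::int. t = of_int j * (pi / real n))" for t
    proof -
      have "(\<exists>j::int. - t = of_int j * (pi / real n)) \<longleftrightarrow> (\<exists>j::int. t = of_int j * (pi / real n))"
        by (metis add.inverse_inverse mult_minus_left of_int_minus)
      then show ?thesis using n(2)[of "- t"] by simp
    qed
    then show ?thesis unfolding r using n(1) by blast
  qed
qed

lemma plane_frame:
  assumes "rt b" "rt g" "\<bar>B b g\<bar> < 1"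
  shows "\<exists>c \<psi>. orthonormal b c \<and> 0 < \<psi> \<and> \<psi> < pi \<and> circ b c \<psi> = g"
proof -
  define q where "q = B b g"
  have q: "-1 < q" "q < 1" using assms(3) by (auto simp: q_def)
  define h where "h = sqrt (1 - q\<^sup>2)"
  have q2: "q\<^sup>2 < 1" using assms(3) by (simp add: q_def abs_square_less_1)
  have h: "0 < h" "h * h = 1 - q\<^sup>2" using q2 by (auto simp: h_def)
  define c where "c = (1 / h) *\<^sub>R (g - q *\<^sub>R b)"
  have f: "B b b = 1" "B g g = 1" "B b g = q" "B g b = q"
    using assms form_root form_sym[of g b] by (auto simp: q_def)
  have "B c c = (1 - q\<^sup>2) / (h * h)" using f by (simp add: c_def power2_eq_square algebra_simps diff_divide_distrib)
  then have "orthonormal b c" using f h q2 by (simp add: orthonormal_def c_def)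
  moreover have "0 < arccos q" "arccos q < pi" using q arccos_lt_bounded by auto
  moreover have "circ b c (arccos q) = g"
    using q h(1) by (simp add: circ_def sin_arccos_abs c_def flip: h_def)
  ultimately show ?thesis by blast
qed

text \<open>Alternating reflections in \<open>x\<close> and \<open>y\<close> give infinitely many
  roots \<open>z k\<close> with non-negative Chebyshev coefficients. All are positive under
  \<open>u\<close> and negative under \<open>v\<close>, so \<open>v \<otimes> inv u\<close> would
  invert infinitely many roots.\<close>

lemma no_infinite_plane:
  assumes "rt x" "rt y" "B x y \<le> -1" "u \<in> carrier W" "v \<in> carrier W"
    "pos (act u x)" "pos (act u y)" "neg (act v x)" "neg (act v y)"
  shows False
proof -
  define c where "c = - B x y"
  have c: "1 \<le> c" "B x y = - c" "B y x = - c" using assms(3) form_sym[of y x] by (auto simp: c_def)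
  define z where "z k = cheb c (Suc k) *\<^sub>R x + cheb c k *\<^sub>R y" for k
  define w where "w k = cheb c k *\<^sub>R x + cheb c (Suc k) *\<^sub>R y" for k
  have f: "B x x = 1" "B y y = 1" using form_root assms by auto
  have h1: "a *\<^sub>R v + v' - m *\<^sub>R v = n *\<^sub>R v + v'" if "a - m = n" for a m n and v v' :: 'v
    unfolding that[symmetric] by (simp add: scaleR_diff_left)
  have h2: "v' + a *\<^sub>R v - m *\<^sub>R v = v' + n *\<^sub>R v" if "a - m = n" for a m n and v v' :: 'v
    unfolding that[symmetric] by (simp add: scaleR_diff_left)
  have zs: "act (rf x) (w k) = z (Suc k)" for k
  proof -
    have "B x (w k) = cheb c k - c * cheb c (Suc k)" using f c by (simp add: w_def)
    then show ?thesis unfolding act_rf[OF assms(1)] by (simp add: w_def z_def h1)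
  qed
  have ws: "act (rf y) (z k) = w (Suc k)" for k
  proof -
    have "B y (z k) = cheb c k - c * cheb c (Suc k)" using f c by (simp add: z_def)
    then show ?thesis unfolding act_rf[OF assms(2)] by (simp add: w_def z_def h2)
  qed
  have rz: "rt (z k) \<and> rt (w k)" for k
  proof (induction k)
    case 0 then show ?case using assms by (simp add: z_def w_def)
  next
    case (Suc k) then show ?case using zs[of k] ws[of k] root_act assms(1,2) by (metis rf_closed)
  qed
  have nn: "0 \<le> cheb c k" for k using cheb_step_ge_1[OF c(1)] by blast
  have uz: "act u (z k) = cheb c (Suc k) *\<^sub>R act u x + cheb c k *\<^sub>R act u y" for k
    using assms(4) by (simp add: z_def)
  have zp: "pos (act u (z k))" for k
    by (rule pos_comb_eq[OF uz]) (use assms nn rz root_act in auto)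
  have zn: "neg (act v (z k))" for k
  proof -
    have "- act v (z k) = cheb c (Suc k) *\<^sub>R (- act v x) + cheb c k *\<^sub>R (- act v y)"
      using assms(5) by (simp add: z_def)
    then show ?thesis by (rule pos_comb_eq) (use assms nn rz root_act in auto)
  qed
  have mono: "strict_mono (cheb c)"
    unfolding strict_mono_Suc_iff using cheb_step_ge_1[OF c(1)] by (metis less_add_one less_le_trans)
  have "inj (\<lambda>k. act u (z k))"
  proof (rule linorder_injI)
    fix j k :: nat assume jk: "j < k"
    define p where "p = cheb c (Suc k) - cheb c (Suc j)"
    define q where "q = cheb c k - cheb c j"
    have pq: "0 < p" "0 < q" using mono jk by (auto simp: p_def q_def strict_mono_less)
    show "act u (z j) \<noteq> act u (z k)"
    proof
      assume e: "act u (z j) = act u (z k)"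
      have "act u (z k) - act u (z j) = p *\<^sub>R act u x + q *\<^sub>R act u y"
        unfolding uz p_def q_def scaleR_diff_left by simp
      then have "p *\<^sub>R act u x + q *\<^sub>R act u y = 0" using e by simp
      then have "- (p *\<^sub>R act u x) = q *\<^sub>R act u y" by (rule minus_unique)
      then have "- (p *\<^sub>R act u x) \<in> C" using cone_scale pos_cone assms(7) pq by (metis less_imp_le)
      moreover have "p *\<^sub>R act u x \<in> C" using cone_scale pos_cone assms(6) pq by (metis less_imp_le)
      ultimately have "p *\<^sub>R act u x = 0" using cone_pointed by blast
      then have "act u x = 0" using pq by simp
      then show False using form_root[OF pos_root[OF assms(6)]] by simp
    qed
  qed
  then have "infinite (range (\<lambda>k. act u (z k)))" using finite_imageD infinite_UNIV_nat by blast
  moreover have "range (\<lambda>k. act u (z k)) \<subseteq> {r. pos r \<and> neg (act (v \<otimes> inv u) r)}"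
    using zp zn assms(4,5) by auto
  ultimately show False using finite_inverted[of "v \<otimes> inv u"] assms(4,5) finite_subset by blast
qed

text \<open>Failure in both directions supplies elements that separate \<open>x\<close> from
  \<open>y\<close> in opposite ways, which is what \<open>no_infinite_plane\<close> forbids for
  \<open>x\<close> and \<open>- y\<close>.\<close>

lemma dom_comparable:
  assumes "rt x" "rt y" "1 \<le> B x y"
  shows "dom x y \<or> dom y x"
proof (rule ccontr)
  assume n: "\<not> ?thesis"
  obtain u where u: "u \<in> carrier W" "neg (act u y)" "\<not> neg (act u x)"
    using n assms unfolding dom_def by blast
  obtain v where v: "v \<in> carrier W" "neg (act v x)" "\<not> neg (act v y)"
    using n assms unfolding dom_def by blast
  have "pos (act u x)" "pos (act v y)" using u v root_cases root_act assms by blast+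
  then show False using no_infinite_plane[of x "- y" u v] u v assms by auto
qed

lemma dom_simpleI:
  assumes "s \<in> S" "pos \<beta>" "1 \<le> B (\<alpha> s) \<beta>"
  shows "dom (\<alpha> s) \<beta>"
proof (cases "\<beta> = \<alpha> s")
  case True then show ?thesis using dom_refl root_simple assms by simp
next
  case False
  then have "\<not> dom \<beta> (\<alpha> s)" using dom_simple_left assms pos_not_neg by blast
  then show ?thesis using dom_comparable[of "\<alpha> s" \<beta>] assms root_simple pos_root by blast
qed

text \<open>Once \<beta> is moved to a simple root, \<open>e = - \<gamma>\<close> is positive, and
  dominance says that no element makes \<alpha> s and \<open>e\<close> both negative. When their
  product exceeds -1 such an element exists: the reflection in \<open>e\<close> if the product is at
  least 1, and otherwise an element of the dihedral group of their plane.\<close>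

lemma dom_form_ge_1:
  assumes "dom \<gamma> \<beta>" "\<gamma> \<noteq> \<beta>"
  shows "1 \<le> B \<gamma> \<beta>"
proof -
  have simple: "1 \<le> B \<gamma> (\<alpha> s)" if d: "dom \<gamma> (\<alpha> s)" "s \<in> S" "\<gamma> \<noteq> \<alpha> s" for \<gamma> s
  proof (rule ccontr)
    assume n: "\<not> 1 \<le> B \<gamma> (\<alpha> s)"
    define e where "e = - \<gamma>"
    have e: "pos e" "rt e" using dom_simple_left[OF d] dom_roots(1)[OF d(1)] by (auto simp: e_def)
    have no: False if "u \<in> carrier W" "neg (act u (\<alpha> s))" "neg (act u e)" for u
      using dom_negD[OF d(1) that(1,2)] that pos_not_neg[of "act u e"] by (simp add: e_def)
    have ne: "e \<noteq> \<alpha> s"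
      using no[of s] gens_closed act_gen_simple[OF d(2)] pos_simple d(2) by auto
    define q where "q = B (\<alpha> s) e"
    have q: "-1 < q" using n form_sym[of \<gamma>] by (simp add: q_def e_def)
    show False
    proof (cases "q < 1")
      case False
      have se: "act (rf e) (\<alpha> s) = \<alpha> s - (2 * q) *\<^sub>R e" using e form_sym[of e] by (simp add: act_rf q_def)
      have "neg (act (rf e) (\<alpha> s))"
      proof (rule ccontr)
        assume "\<not> ?thesis"
        then have p: "pos (act (rf e) (\<alpha> s))" using root_cases root_act e root_simple d(2) by (meson rf_closed)
        have "1 *\<^sub>R act (rf e) (\<alpha> s) + (2 * q) *\<^sub>R e = 1 *\<^sub>R \<alpha> s" unfolding se by simp
        from simple_root_extreme_roots(2)[OF p e(1) zero_less_one _ d(2) this] show False using ne False by simp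
      qed
      then show False using no[of "rf e"] e act_rf_self[of e] by auto
    next
      case True
      then obtain c \<psi> where c: "orthonormal (\<alpha> s) c" "0 < \<psi>" "\<psi> < pi" "circ (\<alpha> s) c \<psi> = e"
        using plane_frame[of "\<alpha> s" e] q root_simple d(2) e q_def by force
      let ?e = "circ (\<alpha> s) c"
      have pp: "pos (?e t)" if "rt (?e t)" "0 \<le> t" "t < pi" for t
        using simple_circ_pos[OF d(2) c(1-3) _ that] c(4) e by simp
      obtain n :: nat where n: "2 \<le> n" "\<And>t. rt (?e t) \<longleftrightarrow> (\<exists>j::int. t = of_int j * (pi / real n))"
        using plane_angles[OF root_simple[OF d(2)] c(1-3)] c(4) e by auto
      have sc: "s \<in> carrier W" using gens_closed d by blast
      \<comment> \<open>The longest element of the dihedral group is used: it is -1 on the plane for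
        even \<open>n\<close> and the reflection in the middle positive root for odd
        \<open>n\<close>.\<close>
      show False
      proof (cases "even n")
        case True
        then obtain m where m: "n = 2 * m" by blast
        have r: "rt (?e (pi / 2))" unfolding n(2) using n(1) by (intro exI[of _ "int m"]) (simp add: m)
        have "act (rf (?e (pi / 2)) \<otimes> s) (?e t) = - ?e t" for t
          using r sc act_gen_circ[OF d(2) c(1)] act_rf_circ[OF c(1) r] by simp
        from this[of 0] this[of \<psi>] show False
          using no[of "rf (?e (pi / 2)) \<otimes> s"] r sc c(4) e pos_simple d(2) by simp
      next
        case False
        then obtain m where m: "n = 2 * m + 1" by (blast elim: oddE)
        have m1: "1 \<le> m" using n(1) m by simp
        define \<phi> where "\<phi> = pi / real n"
        have phi: "0 < \<phi>" "real n * \<phi> = pi" using n(1) by (auto simp: \<phi>_def)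
        have r: "rt (?e (real m * \<phi>))" unfolding n(2) \<phi>_def by (intro exI[of _ "int m"]) simp
        obtain j :: int where j: "\<psi> = of_int j * \<phi>" using n(2)[of \<psi>] c(4) e unfolding \<phi>_def by auto
        have j1: "0 < j" "j < int n"
        proof -
          have "0 < real_of_int j * \<phi>" "real_of_int j * \<phi> < real n * \<phi>" using j c phi by auto
          then have "0 < real_of_int j" "real_of_int j < real n"
            using phi(1) by (auto simp: zero_less_mult_iff)
          then show "0 < j" "j < int n" by linarith+
        qed
        have im: "neg (act (rf (?e (real m * \<phi>))) (?e (of_int i * \<phi>)))" if i: "0 \<le> i" "i < int n" for i :: int
        proof -
          have r2: "2 * (real m * \<phi>) - of_int i * \<phi> = of_int (int n - 1 - i) * \<phi>"
            unfolding m by (simp add: algebra_simps)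
          have "rt (?e (of_int (int n - 1 - i) * \<phi>))" unfolding n(2) \<phi>_def by blast
          moreover have "0 \<le> of_int (int n - 1 - i) * \<phi>" using i phi by simp
          moreover have "of_int (int n - 1 - i) * \<phi> < real n * \<phi>"
            using i phi(1) by (intro mult_strict_right_mono) auto
          ultimately have "pos (?e (of_int (int n - 1 - i) * \<phi>))" using pp phi(2) by auto
          then show ?thesis using act_rf_circ[OF c(1) r, of "of_int i * \<phi>"] by (simp add: r2)
        qed
        show False
          using no[of "rf (?e (real m * \<phi>))"] im[of 0] im[of j] j1 n(1) r c(4) j by simp
      qed
    qed
  qed
  obtain g s where g: "g \<in> carrier W" "s \<in> S" "\<beta> = act g (\<alpha> s)"
    using dom_roots(2)[OF assms(1)] unfolding roots_def by blast
  have "1 \<le> B (act (inv g) \<gamma>) (\<alpha> s)"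
  proof (rule simple)
    show "dom (act (inv g) \<gamma>) (\<alpha> s)" using dom_act[OF assms(1), of "inv g"] g by simp
    show "act (inv g) \<gamma> \<noteq> \<alpha> s" using assms(2) g act_inv_cancel(2)[of g \<gamma>] by metis
  qed (rule g)
  then show ?thesis using form_act_inv g by simp
qed

text \<open>Put \<beta> at the angle 0 and \<gamma> in the open upper half circle. A negative root
  beyond \<gamma> would have a positive opposite below the angle 0, and \<beta> would be a positive
  combination of that root and \<gamma>. Hence the positive arc starts at \<beta>.\<close>

lemma extreme_plane:
  assumes "pos \<beta>" "pos \<gamma>" "\<bar>B \<beta> \<gamma>\<bar> < 1"
    and extreme: "\<And>r a b. pos r \<Longrightarrow> 0 < a \<Longrightarrow> 0 < b \<Longrightarrow> \<beta> \<noteq> a *\<^sub>R r + b *\<^sub>R \<gamma>"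
  shows "\<exists>c n k. orthonormal \<beta> c \<and> 2 \<le> n \<and> 0 < k \<and> k < n \<and> \<gamma> = circ \<beta> c (real k * (pi / real n)) \<and>
    (\<forall>t. rt (circ \<beta> c t) \<longleftrightarrow> (\<exists>j::int. t = of_int j * (pi / real n))) \<and>
    (\<forall>j<n. pos (circ \<beta> c (real j * (pi / real n))))"
proof -
  have r: "rt \<beta>" "rt \<gamma>" using assms pos_root by auto
  obtain c \<psi> where c: "orthonormal \<beta> c" "0 < \<psi>" "\<psi> < pi" "circ \<beta> c \<psi> = \<gamma>"
    using plane_frame[OF r assms(3)] by blast
  obtain n :: nat where n: "2 \<le> n" "\<And>t. rt (circ \<beta> c t) \<longleftrightarrow> (\<exists>j::int. t = of_int j * (pi / real n))"
    using plane_angles[OF r(1) c(1-3)] c(4) r by auto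
  define \<phi> where "\<phi> = pi / real n"
  have phi: "0 < \<phi>" "real n * \<phi> = pi" using n(1) by (auto simp: \<phi>_def)
  obtain i :: int where i: "\<psi> = of_int i * \<phi>" using n(2)[of \<psi>] c(4) r unfolding \<phi>_def by auto
  have "0 < real_of_int i * \<phi>" "real_of_int i * \<phi> < real n * \<phi>" using i c phi by auto
  then have "0 < real_of_int i" "real_of_int i < real n"
    using phi(1) by (auto simp: zero_less_mult_iff)
  then have i0: "0 < i" "i < int n" by linarith+
  define k where "k = nat i"
  have k: "0 < k" "k < n" "\<psi> = real k * \<phi>" using i0 i by (auto simp: k_def)
  have "pos (circ \<beta> c (real j * \<phi>))" if j: "j < n" for j
  proof (cases "j \<le> k")
    case True
    have rj: "rt (circ \<beta> c (real j * \<phi>))" unfolding n(2) \<phi>_def by (intro exI[of _ "int j"]) simp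
    show ?thesis
      by (rule circ_between_pos[of _ _ 0 \<psi>]) (use assms c rj True phi k in \<open>auto\<close>)
  next
    case False
    define t where "t = real j * \<phi>"
    have rj: "rt (circ \<beta> c t)" unfolding n(2) \<phi>_def t_def by (intro exI[of _ "int j"]) simp
    have t: "\<psi> < t" "t < pi" using False j phi unfolding t_def k(3) phi(2)[symmetric] by auto
    have "pos (circ \<beta> c t)"
    proof (rule ccontr)
      assume "\<not> ?thesis"
      then have p: "pos (circ \<beta> c (t - pi))" using rj root_cases by auto
      have s: "0 < sin (\<psi> - (t - pi))" "0 < sin \<psi>" "0 < sin (0 - (t - pi))"
        using t c by (auto intro!: sin_gt_zero)
      have "\<beta> = (1 / sin (\<psi> - (t - pi))) *\<^sub>R (sin (\<psi> - (t - pi)) *\<^sub>R circ \<beta> c 0)" using s by simp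
      also have "\<dots> = (sin \<psi> / sin (\<psi> - (t - pi))) *\<^sub>R circ \<beta> c (t - pi) +
          (sin (0 - (t - pi)) / sin (\<psi> - (t - pi))) *\<^sub>R \<gamma>"
        unfolding circ_between[of \<psi> "t - pi" \<beta> c 0] c(4) by (simp add: scaleR_add_right scaleR_diff_right)
      finally show False using extreme[OF p] s by simp
    qed
    then show ?thesis by (simp add: t_def)
  qed
  then show ?thesis using c(1,4) n k unfolding \<phi>_def by (rule_tac exI[of _ c], rule_tac exI[of _ n], rule_tac exI[of _ k]) auto
qed

text \<open>The reflection in the root of index \<open>m = (j + k + n) / 2\<close> carries index
  \<open>j\<close> to index \<open>k\<close>. The condition \<open>j \<le> k\<close> puts the two
  angles at least \<open>pi / 2\<close> apart, so their product is non-positive;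
  \<open>j + k + 2 \<le> n\<close> gives \<open>m < n\<close>, so the reflecting root is
  positive.\<close>

lemma dp_plane_step:
  assumes o: "orthonormal b c" and n: "2 \<le> n"
    and p: "\<And>j. j < n \<Longrightarrow> pos (circ b c (real j * (pi / real n)))"
    and jk: "j \<le> k" "j + k + 2 \<le> n" "even (j + k + n)"
  shows "dp (circ b c (real j * (pi / real n))) \<le> dp (circ b c (real k * (pi / real n)))"
proof -
  define \<phi> where "\<phi> = pi / real n"
  have phi: "0 < \<phi>" "real n * \<phi> = pi" using n by (auto simp: \<phi>_def)
  obtain m where m: "j + k + n = 2 * m" using jk(3) by blast
  have mn: "m < n" "j < n" using m jk n by auto
  have pm: "pos (circ b c (real m * \<phi>))" "pos (circ b c (real j * \<phi>))" using p mn by (auto simp: \<phi>_def)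
  have m2: "2 * (real m - real j) = real n + (real k - real j)"
    using arg_cong[OF m, of real] by simp
  have "cos (real m * \<phi> - real j * \<phi>) \<le> 0"
  proof -
    have "pi / 2 \<le> (real m - real j) * \<phi>"
    proof -
      have "real n * \<phi> \<le> 2 * (real m - real j) * \<phi>" unfolding m2 using jk(1) phi(1)
        by (intro mult_right_mono) auto
      then show ?thesis using phi(2) by (simp add: algebra_simps)
    qed
    moreover have "(real m - real j) * \<phi> \<le> real n * \<phi>" using mn phi(1) by (intro mult_right_mono) auto
    ultimately have "0 \<le> cos (pi - (real m - real j) * \<phi>)" using phi(2) by (intro cos_ge_zero) auto
    then show ?thesis by (simp add: left_diff_distrib cos_diff)
  qed
  then have "B (circ b c (real m * \<phi>)) (circ b c (real j * \<phi>)) \<le> 0" by (simp add: form_circ[OF o])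
  from dp_reflection_le[OF pm this]
  have "dp (circ b c (real j * \<phi>)) \<le> dp (- circ b c (2 * (real m * \<phi>) - real j * \<phi>))"
    using act_rf_circ[OF o] pm pos_root by simp
  also have "2 * (real m * \<phi>) - real j * \<phi> = (2 * (real m - real j)) * \<phi> + real j * \<phi>"
    by (simp add: algebra_simps)
  also have "\<dots> = real k * \<phi> + pi" unfolding m2 phi(2)[symmetric] by (simp add: algebra_simps)
  finally show ?thesis by (simp add: \<phi>_def)
qed

subsection \<open>Parabolic position of orthogonal pairs\<close>

text \<open>Richardson's argument for an involution, here the product of the reflections in \<open>b\<close> and \<open>b'\<close>:
  conjugate it by a descent until it sends every descent \<open>\<alpha>\<^sub>s\<close> to \<open>-\<alpha>\<^sub>s\<close>.\<close>

lemma orthogonal_pair_simple_span: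
  assumes "rt b" "rt b'" "B b b' = 0"
  shows "\<exists>v s t. v \<in> carrier W \<and> s \<in> S \<and> t \<in> S \<and> s \<noteq> t \<and>
    act v (\<alpha> s) \<in> span {b, b'} \<and> act v (\<alpha> t) \<in> span {b, b'}"
  using assms
proof (induction "lg (rf b \<otimes> rf b')" arbitrary: b b' rule: less_induct)
  case less
  note r = less.prems(1,2)
  have f: "B b b = 1" "B b' b' = 1" "B b b' = 0" "B b' b = 0"
    using form_root r less.prems(3) form_sym[of b' b] by auto
  define g where "g = rf b \<otimes> rf b'"
  have g: "g \<in> carrier W" using r by (simp add: g_def)
  have ga: "act g v = v - (2 * B b v) *\<^sub>R b - (2 * B b' v) *\<^sub>R b'" for v
    using r f by (simp add: g_def act_rf)
  have gg: "act g (act g v) = v" for v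
    unfolding ga by (simp add: f)
  have gi: "inv g = g" using g by (intro inv_equality faithful) (auto simp: gg)
  have inspan: "v \<in> span {b, b'}" if "act g v = - v" for v
  proof -
    have "(2::real) *\<^sub>R v = v - act g v" using that by (simp add: scaleR_2)
    also have "\<dots> = (2 * B b v) *\<^sub>R b + (2 * B b' v) *\<^sub>R b'" unfolding ga by simp
    finally have "(2::real) *\<^sub>R v \<in> span {b, b'}"
      by (simp only:) (intro span_add span_scale span_base, auto)
    then have "(1 / 2) *\<^sub>R ((2::real) *\<^sub>R v) \<in> span {b, b'}" by (rule span_scale)
    then show ?thesis by simp
  qed
  show ?case
  proof (cases "\<exists>s\<in>S. neg (act g (\<alpha> s)) \<and> act g (\<alpha> s) \<noteq> - \<alpha> s")
    case True
    then obtain s where s: "s \<in> S" "neg (act g (\<alpha> s))" "- act g (\<alpha> s) \<noteq> \<alpha> s"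
      by (metis add.inverse_inverse)
    have sc: "s \<in> carrier W" using s gens_closed by blast
    have "lg (g \<otimes> s) < lg g" using ascent_iff(2) g s by blast
    moreover have "lg (s \<otimes> (g \<otimes> s)) < lg (g \<otimes> s)"
    proof -
      have "neg (act s (act g (\<alpha> s)))" using gen_permutes_pos[OF s(2,1,3)] sc by simp
      then have "neg (act (inv (g \<otimes> s)) (\<alpha> s))"
        using g sc s(1) by (simp add: inv_mult_group gi gens_inv)
      then show ?thesis using left_ascent_iff(2)[of "g \<otimes> s" s] g sc s(1) by simp
    qed
    moreover have "rf (act s b) \<otimes> rf (act s b') = s \<otimes> (g \<otimes> s)"
      using r sc s(1) by (simp add: rf_conj g_def m_assoc gens_inv)
    ultimately have "lg (rf (act s b) \<otimes> rf (act s b')) < lg (rf b \<otimes> rf b')" by (simp add: g_def)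
    from less.hyps[OF this] obtain v p q where v: "v \<in> carrier W" "p \<in> S" "q \<in> S" "p \<noteq> q"
      "act v (\<alpha> p) \<in> span {act s b, act s b'}" "act v (\<alpha> q) \<in> span {act s b, act s b'}"
      using r root_act sc f by (metis form_act)
    have im: "act s w \<in> span {b, b'}" if "w \<in> span {act s b, act s b'}" for w
    proof -
      have "act s w \<in> act s ` span {act s b, act s b'}" using that by blast
      also have "\<dots> = span {b, b'}"
        using linear_span_image[OF action_linear[OF sc], of "{act s b, act s b'}", symmetric] s(1) by simp
      finally show ?thesis .
    qed
    have "act (s \<otimes> v) (\<alpha> p) \<in> span {b, b'}" "act (s \<otimes> v) (\<alpha> q) \<in> span {b, b'}"
      using im v sc by auto
    then show ?thesis using v sc by blast
  next
    case False
    have "g \<noteq> \<one>"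
    proof
      assume "g = \<one>"
      then have "B b (act g b) = 1" using f by simp
      then show False unfolding ga using f by simp
    qed
    then obtain s where s: "s \<in> S" "lg (g \<otimes> s) < lg g" using exists_right_descent g by blast
    have sc: "s \<in> carrier W" using s gens_closed by blast
    have gs: "act g (\<alpha> s) = - \<alpha> s" using False s ascent_iff(2) g by blast
    \<comment> \<open>A simple reflection is -1 on a line only, whereas \<open>g\<close> is -1 on
      two orthogonal unit vectors.\<close>
    have "g \<otimes> s \<noteq> \<one>"
    proof
      assume "g \<otimes> s = \<one>"
      then have "g = s" using g sc s gens_inv inv_equality by metis
      then have a: "act s b = - b" "act s b' = - b'" using ga[of b] ga[of b'] f by (simp_all add: scaleR_2)
      define p where "p = B (\<alpha> s) b"
      define p' where "p' = B (\<alpha> s) b'"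
      have "B (act s b) b = B b b - 2 * p * p" "B (act s b) b' = B b b' - 2 * p * p'"
        "B (act s b') b' = B b' b' - 2 * p' * p'"
        using s(1) by (simp_all add: act_gen p_def p'_def)
      then have "p * p = 1" "p * p' = 0" "p' * p' = 1" unfolding a using f by simp_all
      then show False by auto
    qed
    then obtain t where t: "t \<in> S" "lg (g \<otimes> s \<otimes> t) < lg (g \<otimes> s)"
      using exists_right_descent g sc by blast
    have nt: "neg (act (g \<otimes> s) (\<alpha> t))" using ascent_iff(2) t g sc by blast
    have st: "s \<noteq> t"
      using nt gs g sc s(1) pos_simple[OF s(1)] pos_not_neg[of "\<alpha> s"] by (auto simp: act_gen_simple)
    \<comment> \<open>If \<open>t\<close> were not a descent of \<open>g\<close>, extremality of
      \<alpha> s would force \<open>act g (\<alpha> t) = \<alpha> s\<close>; but \<open>g\<close> is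
      an involution that negates \<alpha> s.\<close>
    have "act g (\<alpha> t) = - \<alpha> t"
    proof (cases "neg (act g (\<alpha> t))")
      case True then show ?thesis using False t by blast
    next
      case False
      then have p: "pos (act g (\<alpha> t))" using root_cases root_act root_simple t g by blast
      define k where "k = - 2 * B (\<alpha> s) (\<alpha> t)"
      have "act (g \<otimes> s) (\<alpha> t) = act g (\<alpha> t) - k *\<^sub>R \<alpha> s"
        using g sc s(1) gs by (simp add: act_gen k_def)
      then have "1 *\<^sub>R act g (\<alpha> t) + 1 *\<^sub>R (- act (g \<otimes> s) (\<alpha> t)) = k *\<^sub>R \<alpha> s" by simp
      from simple_root_extreme_roots(1)[OF p nt _ _ s(1) this] have "act g (\<alpha> t) = \<alpha> s" by simp
      then have "\<alpha> t = - \<alpha> s" using gg[of "\<alpha> t"] gs by simp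
      then show ?thesis using pos_simple[OF t(1)] pos_simple[OF s(1)] pos_not_neg by metis
    qed
    then have "act \<one> (\<alpha> s) \<in> span {b, b'}" "act \<one> (\<alpha> t) \<in> span {b, b'}"
      using inspan gs by auto
    then show ?thesis using s(1) t(1) st by blast
  qed
qed

text \<open>Take \<open>v\<close> of minimal length. If it made \<alpha> p negative,
  \<open>v \<otimes> p\<close> would be shorter and still carry both simple roots into the
  plane.\<close>

lemma orthogonal_pair_simple_span_pos:
  assumes "rt b" "rt b'" "B b b' = 0"
  shows "\<exists>v s t. v \<in> carrier W \<and> s \<in> S \<and> t \<in> S \<and> s \<noteq> t \<and>
    act v (\<alpha> s) \<in> span {b, b'} \<and> act v (\<alpha> t) \<in> span {b, b'} \<and> pos (act v (\<alpha> s)) \<and> pos (act v (\<alpha> t))"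
proof -
  define Q where "Q v \<longleftrightarrow> (\<exists>s t. v \<in> carrier W \<and> s \<in> S \<and> t \<in> S \<and> s \<noteq> t \<and>
    act v (\<alpha> s) \<in> span {b, b'} \<and> act v (\<alpha> t) \<in> span {b, b'})" for v
  have ex: "\<exists>v. Q v" using orthogonal_pair_simple_span[OF assms] unfolding Q_def by blast
  define v where "v = arg_min lg Q"
  have v: "Q v" "\<And>v'. Q v' \<Longrightarrow> lg v \<le> lg v'"
    using arg_min_nat_lemma[of Q _ lg] ex unfolding v_def by blast+
  obtain s t where st: "v \<in> carrier W" "s \<in> S" "t \<in> S" "s \<noteq> t"
    "act v (\<alpha> s) \<in> span {b, b'}" "act v (\<alpha> t) \<in> span {b, b'}"
    using v(1) unfolding Q_def by blast
  have p: "pos (act v (\<alpha> p))" if pq: "p \<in> S" "q \<in> S" "p \<noteq> q"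
    "act v (\<alpha> p) \<in> span {b, b'}" "act v (\<alpha> q) \<in> span {b, b'}" for p q
  proof (rule ccontr)
    assume "\<not> ?thesis"
    then have "neg (act v (\<alpha> p))" using root_cases root_act root_simple pq st(1) by blast
    then have l: "lg (v \<otimes> p) < lg v" using ascent_iff(2) st(1) pq by blast
    have pc: "p \<in> carrier W" using gens_closed pq by blast
    have "act (v \<otimes> p) (\<alpha> p) = (-1) *\<^sub>R act v (\<alpha> p)"
      "act (v \<otimes> p) (\<alpha> q) = act v (\<alpha> q) - (2 * B (\<alpha> p) (\<alpha> q)) *\<^sub>R act v (\<alpha> p)"
      using st(1) pq(1) pc by (simp_all add: act_gen_simple) (simp add: act_gen)
    then have "act (v \<otimes> p) (\<alpha> p) \<in> span {b, b'}" "act (v \<otimes> p) (\<alpha> q) \<in> span {b, b'}"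
      using pq by (simp_all only: span_scale span_diff)
    then have "Q (v \<otimes> p)" unfolding Q_def using pq st(1) pc by blast
    then show False using v(2) l by (simp add: not_less[symmetric])
  qed
  show ?thesis using p[of s t] p[of t s] st by blast
qed

subsection \<open>Roots outside a standard parabolic plane\<close>

text \<open>At \<open>2 * pi / 5\<close> the cosines of the double and the triple angle agree,
  whence \<open>4 * c^2 + 2 * c = 1\<close>. The crude bound 1/4 is what the constant 3/4 in
  \<open>simple_plane_split\<close> requires.\<close>

lemma cos_two_fifths_pi_ge: "1 / 4 \<le> cos (2 * pi / 5)"
proof -
  define c where "c = cos (2 * pi / 5)"
  have c: "0 < c" "c < 1" unfolding c_def
    using cos_gt_zero[of "2 * pi / 5"] cos_monotone_0_pi[of 0 "2 * pi / 5"] by auto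
  have "cos (3 * (2 * pi / 5)) = cos (2 * pi - 2 * (2 * pi / 5))" by (rule arg_cong[of _ _ cos]) (simp add: field_simps)
  also have "\<dots> = cos (2 * (2 * pi / 5))" by (simp only: cos_2pi_minus)
  finally have "4 * c ^ 3 - 3 * c = 2 * c\<^sup>2 - 1"
    unfolding c_def cos_treble_cos cos_double_cos .
  then have "(c - 1) * (4 * c\<^sup>2 + 2 * c - 1) = 0"
    by (simp add: algebra_simps power2_eq_square power3_eq_cube)
  then have q: "4 * c\<^sup>2 + 2 * c = 1" using c by simp
  show ?thesis
  proof (rule ccontr)
    assume "\<not> ?thesis"
    then have "c < 1 / 4" by (simp add: c_def)
    then have "c\<^sup>2 < (1 / 4)\<^sup>2" using c by (intro power_strict_mono) auto
    then show False using q \<open>c < 1 / 4\<close> by (simp add: power2_eq_square)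
  qed
qed

text \<open>The root \<zeta> lies \<open>m\<close> steps of size \<open>pi / n\<close> before the
  angle \<open>pi\<close>. For \<open>m = 1\<close> the value is \<open>cos (pi / n)\<close>: 1/2
  for \<open>n = 3\<close>, at least \<open>sqrt 2 / 2\<close> beyond. For larger \<open>m\<close>,
  \<omega> is the last positive root before \<open>- \<alpha> s\<close>, so \<omega> and \<alpha> s
  are the extreme roots of the plane, and the coefficients are quotients of sines. The smaller depth
  of \<omega> feeds the inductions below.\<close>

lemma simple_plane_split:
  assumes s: "s \<in> S" and z: "pos \<zeta>" and x: "x = - B (\<alpha> s) \<zeta>" "0 < x" "x < 1"
  shows "x = 1 / 2 \<or> sqrt 2 / 2 \<le> x \<or>
    (\<exists>\<omega> u v c. pos \<omega> \<and> depth \<omega> < depth \<zeta> \<and> \<zeta> = u *\<^sub>R \<omega> + v *\<^sub>R \<alpha> s \<and> B (\<alpha> s) \<omega> = - c \<and>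
      0 < c \<and> c < 1 \<and> 1 \<le> u \<and> 1 \<le> v \<and> v < c * u \<and> 3 / 4 \<le> x + v / 2)"
proof -
  obtain c \<psi> where c: "orthonormal (\<alpha> s) c" "0 < \<psi>" "\<psi> < pi" "circ (\<alpha> s) c \<psi> = \<zeta>"
    using plane_frame[of "\<alpha> s" \<zeta>] s z root_simple pos_root x by force
  let ?e = "circ (\<alpha> s) c"
  obtain n :: nat where n: "2 \<le> n" "\<And>t. rt (?e t) \<longleftrightarrow> (\<exists>j::int. t = of_int j * (pi / real n))"
    using plane_angles[OF root_simple[OF s] c(1-3)] c(4) z pos_root by auto
  define \<phi> where "\<phi> = pi / real n"
  have phi: "0 < \<phi>" "real n * \<phi> = pi" using n(1) by (auto simp: \<phi>_def)
  have "B (\<alpha> s) \<zeta> = cos \<psi>" using form_circ[OF c(1), of 0 \<psi>] c(4) by simp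
  then have xc: "x = cos (pi - \<psi>)" using x by simp
  have psi: "pi / 2 < \<psi>"
  proof (rule ccontr)
    assume "\<not> ?thesis"
    then have "0 \<le> cos \<psi>" using c by (intro cos_ge_zero) auto
    then show False using xc x by simp
  qed
  obtain i :: int where i: "\<psi> = of_int i * \<phi>" using n(2)[of \<psi>] c(4) z pos_root unfolding \<phi>_def by auto
  have "0 < of_int (int n - i) * \<phi>" using i c(3) phi(2) by (simp add: left_diff_distrib)
  then have i1: "0 < int n - i" using phi(1) by (simp add: zero_less_mult_iff)
  define m where "m = nat (int n - i)"
  have m: "1 \<le> m" "real m = real n - of_int i" using i1 by (auto simp: m_def of_nat_nat)
  have mphi: "real m * \<phi> = pi - \<psi>" unfolding m(2) left_diff_distrib i phi(2) by simp
  have small: "real m * \<phi> < pi / 2" unfolding mphi using psi by simp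
  have xm: "x = cos (real m * \<phi>)" using xc mphi by simp
  show ?thesis
  proof (cases "m = 1")
    case True
    have xn: "x = cos (pi / real n)" using xm True by (simp add: \<phi>_def)
    have "2 < n" using small True phi(1) n(1) by (cases "n = 2") (auto simp: \<phi>_def)
    show ?thesis
    proof (cases "n = 3")
      case True then show ?thesis using xn cos_60 by simp
    next
      case False
      then have "4 \<le> n" using \<open>2 < n\<close> by simp
      then have "pi / real n \<le> pi / 4" by (intro divide_left_mono) auto
      then have "cos (pi / 4) \<le> x" unfolding xn using phi(1)[unfolded \<phi>_def]
        by (intro cos_monotone_0_pi_le) auto
      then show ?thesis using cos_45 by simp
    qed
  next
    case False
    then have m2: "2 \<le> m" using m by simp
    define \<omega> where "\<omega> = ?e (pi - \<phi>)"
    have phis: "2 * \<phi> \<le> real m * \<phi>" using m2 phi(1) by (intro mult_right_mono) auto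
    have phib: "\<phi> < pi / 4" using phis small by simp
    have "rt \<omega>" unfolding \<omega>_def n(2)
      by (rule exI[of _ "int n - 1"]) (use n(1) in \<open>simp add: \<phi>_def field_simps\<close>)
    then have op: "pos \<omega>"
      using simple_circ_pos[OF s c(1-3), of "pi - \<phi>"] c(4) z phi(1) phib by (simp add: \<omega>_def)
    define u where "u = sin (real m * \<phi>) / sin \<phi>"
    define v where "v = sin ((real m - 1) * \<phi>) / sin \<phi>"
    have sp: "0 < sin \<phi>" using phi phib by (intro sin_gt_zero) auto
    have psi': "\<psi> = pi - real m * \<phi>" using mphi by simp
    have "sin \<phi> *\<^sub>R \<zeta> = sin ((real m - 1) * \<phi>) *\<^sub>R \<alpha> s + sin (real m * \<phi>) *\<^sub>R \<omega>"
    proof -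
      have "sin (pi - \<phi> - \<psi>) = sin ((real m - 1) * \<phi>)"
        by (rule arg_cong[of _ _ sin]) (simp add: psi' algebra_simps)
      moreover have "sin (\<psi> - 0) = sin (real m * \<phi>)" by (simp add: psi')
      ultimately show ?thesis using circ_between[of "pi - \<phi>" 0 "\<alpha> s" c \<psi>] c(4) by (simp add: \<omega>_def)
    qed
    then have "(1 / sin \<phi>) *\<^sub>R (sin \<phi> *\<^sub>R \<zeta>) =
        (1 / sin \<phi>) *\<^sub>R (sin ((real m - 1) * \<phi>) *\<^sub>R \<alpha> s + sin (real m * \<phi>) *\<^sub>R \<omega>)"
      by (rule arg_cong)
    then have ze: "\<zeta> = u *\<^sub>R \<omega> + v *\<^sub>R \<alpha> s"
      using sp by (simp add: u_def v_def scaleR_add_right add.commute)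
    have m1: "\<phi> \<le> (real m - 1) * \<phi>" "(real m - 1) * \<phi> < pi / 2"
      using phis small phi(1) by (auto simp: left_diff_distrib)
    have v1: "1 \<le> v" unfolding v_def using sp m1 phi phib
      by (simp add: sin_monotone_2pi_le)
    have u1: "1 \<le> u" unfolding u_def using sp phis small phi phib
      by (simp add: sin_monotone_2pi_le)
    have c1: "0 < cos \<phi>" "cos \<phi> < 1"
      using cos_gt_zero[of \<phi>] cos_monotone_0_pi[of 0 \<phi>] phi phib by auto
    have vu: "v < cos \<phi> * u"
    proof -
      have "sin ((real m - 1) * \<phi>) = sin (real m * \<phi>) * cos \<phi> - cos (real m * \<phi>) * sin \<phi>"
        by (simp add: left_diff_distrib sin_diff)
      moreover have "0 < cos (real m * \<phi>) * sin \<phi>" using xm x(2) sp by simp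
      ultimately show ?thesis using sp by (simp add: u_def v_def divide_strict_right_mono mult.commute)
    qed
    have fo: "B (\<alpha> s) \<omega> = - cos \<phi>" using form_circ[OF c(1), of 0 "pi - \<phi>"] by (simp add: \<omega>_def)
    have dl: "depth \<omega> < depth \<zeta>"
      using depth_summand_less[OF z op s _ _ _ ze] x u1 v1 by simp
    \<comment> \<open>For \<open>m = 2\<close>, the bound \<open>m * \<phi> < pi / 2\<close> forces
      \<open>n \<ge> 5\<close>, so \<open>x \<ge> 1/4\<close> while \<open>v \<ge> 1\<close>. For
      \<open>m \<ge> 3\<close> one has \<open>\<phi> < pi / 6\<close>, and
      \<open>v / 2 \<ge> cos \<phi>\<close> suffices.\<close>
    have "3 / 4 \<le> x + v / 2"
    proof (cases "m = 2")
      case True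
      have "4 < n" using small True phi(2) n(1) by (simp add: \<phi>_def field_simps)
      then have "2 * pi / real n \<le> 2 * pi / 5" by (intro divide_left_mono) auto
      then have "cos (2 * pi / 5) \<le> x" unfolding xm True \<phi>_def
        by (intro cos_monotone_0_pi_le) auto
      then show ?thesis using cos_two_fifths_pi_ge v1 by simp
    next
      case False
      then have m3: "3 \<le> m" using m2 by simp
      then have "3 * \<phi> \<le> real m * \<phi>" using phi(1) by (intro mult_right_mono) auto
      then have p6: "\<phi> < pi / 6" "2 * \<phi> \<le> (real m - 1) * \<phi>" using small by (auto simp: left_diff_distrib)
      have "sin (2 * \<phi>) \<le> sin ((real m - 1) * \<phi>)"
        using p6 m1 phi(1) by (intro sin_monotone_2pi_le) auto
      then have "2 * cos \<phi> * sin \<phi> \<le> sin ((real m - 1) * \<phi>)"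
        unfolding sin_double by (simp only: mult_ac)
      then have "2 * cos \<phi> \<le> v" unfolding v_def pos_le_divide_eq[OF sp] .
      moreover have "cos (pi / 6) \<le> cos \<phi>" using p6 phi(1) by (intro cos_monotone_0_pi_le) auto
      then have "3 / 4 \<le> cos \<phi>" using cos_30 real_le_rsqrt[of "3/2" 3] by (simp add: power2_eq_square)
      ultimately show ?thesis using x by linarith
    qed
    then show ?thesis using op dl ze fo c1 u1 v1 vu by blast
  qed
qed

section \<open>Products of a root with the roots of a plane that does not contain it\<close>

lemma gen_notin_span:
  assumes "s \<in> S" "\<zeta> \<notin> span {\<alpha> s, \<alpha> t}"
  shows "act s \<zeta> \<notin> span {\<alpha> s, \<alpha> t}"
proof
  assume "act s \<zeta> \<in> span {\<alpha> s, \<alpha> t}"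
  moreover have "\<zeta> = act s \<zeta> + (2 * B (\<alpha> s) \<zeta>) *\<^sub>R \<alpha> s" using assms(1) by (simp add: act_gen)
  ultimately have "\<zeta> \<in> span {\<alpha> s, \<alpha> t}" by (metis insertI1 span_add span_base span_scale)
  then show False using assms by simp
qed

lemma summand_notin_span:
  assumes "\<zeta> = u *\<^sub>R \<omega> + v *\<^sub>R \<alpha> s" "\<zeta> \<notin> span {\<alpha> s, \<alpha> t}"
  shows "\<omega> \<notin> span {\<alpha> s, \<alpha> t}"
  using assms by (metis insertI1 span_add span_base span_scale)

lemma outside_span_descent:
  assumes "s \<in> S" "pos \<zeta>" "\<zeta> \<notin> span {\<alpha> s, \<alpha> t}" "0 < B (\<alpha> s) \<zeta>"
  shows "pos (act s \<zeta>)" "depth (act s \<zeta>) < depth \<zeta>"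
proof -
  have "\<zeta> \<noteq> \<alpha> s" using assms(3) span_base[of "\<alpha> s" "{\<alpha> s, \<alpha> t}"] by auto
  then show "pos (act s \<zeta>)" "depth (act s \<zeta>) < depth \<zeta>"
    using gen_permutes_pos depth_gen_less assms by blast+
qed

text \<open>Meant for the products of a root with the four positive roots of a plane of type B2. The
  condition ignores signs and order, so the dihedral group of the plane preserves it; this makes it
  fit for induction on depth.\<close>

definition two_large :: "real \<Rightarrow> real \<Rightarrow> real \<Rightarrow> real \<Rightarrow> bool" where
  "two_large a b c d \<longleftrightarrow> a \<noteq> 0 \<and> b \<noteq> 0 \<and> c \<noteq> 0 \<and> d \<noteq> 0 \<longrightarrow>
    1 \<le> \<bar>a\<bar> \<and> 1 \<le> \<bar>b\<bar> \<or> 1 \<le> \<bar>a\<bar> \<and> 1 \<le> \<bar>c\<bar> \<or> 1 \<le> \<bar>a\<bar> \<and> 1 \<le> \<bar>d\<bar> \<or>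
    1 \<le> \<bar>b\<bar> \<and> 1 \<le> \<bar>c\<bar> \<or> 1 \<le> \<bar>b\<bar> \<and> 1 \<le> \<bar>d\<bar> \<or> 1 \<le> \<bar>c\<bar> \<and> 1 \<le> \<bar>d\<bar>"

text \<open>The case in which neither simple reflection of the plane lowers the depth and one
  product is too small for a direct estimate. After splitting \<zeta>, either \<omega> has
  \<open>Y \<ge> 0\<close> and the bounds on \<open>x\<close> and \<open>v\<close> suffice, or
  \<omega> violates the induction hypothesis.\<close>

lemma form_B2_outside_pos:
  assumes st: "s \<in> S" "t \<in> S" "B (\<alpha> s) (\<alpha> t) = - (sqrt 2 / 2)"
    and z: "pos \<zeta>" "\<zeta> \<notin> span {\<alpha> s, \<alpha> t}"
    and IH: "\<And>\<omega>. pos \<omega> \<Longrightarrow> \<omega> \<notin> span {\<alpha> s, \<alpha> t} \<Longrightarrow> depth \<omega> < depth \<zeta> \<Longrightarrow>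
      two_large (- B (\<alpha> s) \<omega>) (- B (\<alpha> t) \<omega>) (- (sqrt 2 * B (\<alpha> s) \<omega> + B (\<alpha> t) \<omega>))
        (- (B (\<alpha> s) \<omega> + sqrt 2 * B (\<alpha> t) \<omega>))"
    and xy: "x = - B (\<alpha> s) \<zeta>" "y = - B (\<alpha> t) \<zeta>" "0 < x" "x < 1 / 2" "0 < y"
  shows "1 \<le> sqrt 2 * x + y \<and> 1 \<le> x + sqrt 2 * y"
proof -
  let ?r = "sqrt 2"
  have r: "0 < ?r" "?r * ?r = 2" by auto
  have r1: "7 / 5 < ?r" "?r < 3 / 2"
    using real_less_rsqrt[of "7/5" 2] real_less_lsqrt[of "3/2" 2] by (auto simp: power2_eq_square)
  have "\<exists>\<omega> u v c. pos \<omega> \<and> depth \<omega> < depth \<zeta> \<and> \<zeta> = u *\<^sub>R \<omega> + v *\<^sub>R \<alpha> s \<and> B (\<alpha> s) \<omega> = - c \<and>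
      0 < c \<and> c < 1 \<and> 1 \<le> u \<and> 1 \<le> v \<and> v < c * u \<and> 3 / 4 \<le> x + v / 2"
    using simple_plane_split[OF st(1) z(1) xy(1,3)] xy(4) r1 by auto
  then obtain \<omega> u v c where o: "pos \<omega>" "depth \<omega> < depth \<zeta>" "\<zeta> = u *\<^sub>R \<omega> + v *\<^sub>R \<alpha> s"
    "B (\<alpha> s) \<omega> = - c" "0 < c" "c < 1" "1 \<le> u" "1 \<le> v" "v < c * u" "3 / 4 \<le> x + v / 2"
    by blast
  define Y where "Y = - B (\<alpha> t) \<omega>"
  have y: "y = u * Y + v * (?r / 2)"
    unfolding xy(2) o(3) using st(3) form_sym[of "\<alpha> t" "\<alpha> s"] by (simp add: Y_def)
  show ?thesis
  proof (cases "0 \<le> Y")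
    case True
    then have y1: "v * (?r / 2) \<le> y" using y o by simp
    have "?r * (v * (?r / 2)) = (?r * ?r) * v / 2" by (simp only: mult_ac times_divide_eq_right times_divide_eq_left)
    then have "v = ?r * (v * (?r / 2))" unfolding r(2) by simp
    also have "\<dots> \<le> ?r * y" by (rule mult_left_mono[OF y1]) (use r in simp)
    finally have "v \<le> ?r * y" .
    then have "1 \<le> x + ?r * y" using o(8) xy(3) by linarith
    moreover have "?r * (x + v / 2) \<le> ?r * x + y" using y1 by (simp add: algebra_simps)
    moreover have "?r * (3 / 4) \<le> ?r * (x + v / 2)" by (rule mult_left_mono[OF o(10)]) (use r in simp)
    ultimately show ?thesis using r1 by linarith
  next
    case False
    define Z where "Z = - Y"
    have Z: "0 < Z" using False by (simp add: Z_def)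
    have "u * Z < v * (?r / 2)" using xy(5) y by (simp add: Z_def)
    then have "?r * (u * Z) < ?r * (v * (?r / 2))" using r by (intro mult_strict_left_mono) auto
    then have "?r * (u * Z) < v" using r by (simp add: algebra_simps)
    also note o(9)
    also have "?r * (u * Z) = (?r * Z) * u" by simp
    finally have Zc: "?r * Z < c" using o(7) by (simp add: mult_less_cancel_right)
    have Zr: "Z < ?r * Z" using Z r1 mult_strict_right_mono[of 1 ?r Z] by simp
    have cr: "c < ?r * c" using o r1 mult_strict_right_mono[of 1 ?r c] by simp
    \<comment> \<open>None of the four numbers is 0, since \<open>?r * Z < c\<close>. Only
      \<open>?r * c - Z\<close> can reach 1; the others have absolute value at most
      \<open>c < 1\<close>.\<close>
    have "two_large c (- Z) (?r * c - Z) (c - ?r * Z)"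
      using IH[OF o(1) summand_notin_span[OF o(3) z(2)] o(2)] o(4) by (simp add: Z_def Y_def)
    then have False using o Z Zc Zr cr by (auto simp: two_large_def)
    then show ?thesis ..
  qed
qed

text \<open>If \<zeta> has positive product with \<alpha> s or \<alpha> t, that reflection lowers
  the depth and permutes the four numbers up to sign. If \<open>x\<close> and \<open>y\<close> are
  both at least 1/2, the mixed sums exceed 1; if one of them is smaller and both are positive,
  \<open>form_B2_outside_pos\<close> applies.\<close>

lemma form_B2_outside:
  assumes "s \<in> S" "t \<in> S" "B (\<alpha> s) (\<alpha> t) = - (sqrt 2 / 2)" "pos \<zeta>" "\<zeta> \<notin> span {\<alpha> s, \<alpha> t}"
  shows "two_large (- B (\<alpha> s) \<zeta>) (- B (\<alpha> t) \<zeta>) (- (sqrt 2 * B (\<alpha> s) \<zeta> + B (\<alpha> t) \<zeta>))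
    (- (B (\<alpha> s) \<zeta> + sqrt 2 * B (\<alpha> t) \<zeta>))"
  using assms
proof (induction "depth \<zeta>" arbitrary: \<zeta> s t rule: less_induct)
  case less
  note p = less.prems
  let ?r = "sqrt 2"
  have r1: "7 / 5 < ?r" "?r < 3 / 2"
    using real_less_rsqrt[of "7/5" 2] real_less_lsqrt[of "3/2" 2] by (auto simp: power2_eq_square)
  have ts: "B (\<alpha> t) (\<alpha> s) = - (?r / 2)" using p(3) form_sym by metis
  have sw: "\<zeta> \<notin> span {\<alpha> t, \<alpha> s}" using p(5) by (simp add: insert_commute)
  define x where "x = - B (\<alpha> s) \<zeta>"
  define y where "y = - B (\<alpha> t) \<zeta>"
  have xy: "B (\<alpha> s) \<zeta> = - x" "B (\<alpha> t) \<zeta> = - y" by (simp_all add: x_def y_def)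
  have f: "B (\<alpha> s) (\<alpha> s) = 1" "B (\<alpha> t) (\<alpha> t) = 1" using form_simple_root p by auto
  have rr: "?r * (?r * w) = 2 * w" for w by (simp flip: mult.assoc)
  have "two_large x y (?r * x + y) (x + ?r * y)"
  proof -
    consider "x = 0 \<or> y = 0" | "x < 0" | "y < 0" | "0 < x" "0 < y" by linarith
    then show ?thesis
    proof cases
      case 1 then show ?thesis by (auto simp: two_large_def)
    next
      case 2
      note d = outside_span_descent[OF p(1,4,5)]
      have e: "B (\<alpha> s) (act s \<zeta>) = x" "B (\<alpha> t) (act s \<zeta>) = - (y + ?r * x)"
        using p(1) f ts by (simp_all add: act_gen xy)
      then have "two_large (- x) (y + ?r * x) y (x + ?r * y)"
        using less.hyps[OF d(2) p(1-3) d(1) gen_notin_span[OF p(1,5)]] 2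
        unfolding e by (simp add: xy algebra_simps rr)
      then show ?thesis unfolding two_large_def by (simp add: add.commute) argo
    next
      case 3
      note d = outside_span_descent[OF p(2,4) sw]
      have e: "B (\<alpha> t) (act t \<zeta>) = y" "B (\<alpha> s) (act t \<zeta>) = - (x + ?r * y)"
        using p(2) f p(3) by (simp_all add: act_gen xy)
      then have "two_large (- y) (x + ?r * y) x (y + ?r * x)"
        using less.hyps[OF d(2) p(2,1) ts d(1) gen_notin_span[OF p(2) sw]] 3
        unfolding e by (simp add: xy algebra_simps rr)
      then show ?thesis unfolding two_large_def by (simp add: add.commute) argo
    next
      case 4
      consider "x < 1 / 2" | "y < 1 / 2" | "1 / 2 \<le> x" "1 / 2 \<le> y" by linarith
      then show ?thesis
      proof cases
        case 1
        have "1 \<le> ?r * x + y \<and> 1 \<le> x + ?r * y"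
          by (rule form_B2_outside_pos[OF p(1-5) _ x_def y_def 4(1) 1 4(2)])
            (rule less.hyps[OF _ p(1-3)])
        then show ?thesis by (auto simp: two_large_def)
      next
        case 2
        have "1 \<le> ?r * y + x \<and> 1 \<le> y + ?r * x"
          by (rule form_B2_outside_pos[OF p(2,1) ts p(4) sw _ y_def x_def 4(2) 2 4(1)])
            (rule less.hyps[OF _ p(2,1) ts])
        then show ?thesis by (auto simp: two_large_def add.commute)
      next
        case 3
        have "7 / 5 * x \<le> ?r * x" "7 / 5 * y \<le> ?r * y" using r1 4 by (auto intro!: mult_right_mono)
        then have "1 \<le> ?r * x + y" "1 \<le> x + ?r * y" using 3 by linarith+
        then show ?thesis by (auto simp: two_large_def)
      qed
    qed
  qed
  then show ?case unfolding xy by (simp add: add.commute)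
qed

text \<open>\<open>N / (1 - c\<^sup>2)\<close> below is the squared norm of the projection of \<open>\<zeta>\<close> to the plane of \<open>\<alpha>\<^sub>s\<close> and
  \<open>\<alpha>\<^sub>t\<close>; passing from \<open>\<zeta>\<close> to \<open>\<omega>\<close> rescales its distance from 1.\<close>

lemma projection_gap:
  assumes "s \<in> S" "t \<in> S" "B (\<alpha> s) (\<alpha> t) = - c" "pos \<zeta>" "\<zeta> \<notin> span {\<alpha> s, \<alpha> t}"
    and "0 < c" "c < 1" "c\<^sup>2 = 3 / 4 \<or> 13 / 16 \<le> c\<^sup>2"
    and "N = (B (\<alpha> s) \<zeta>)\<^sup>2 + (B (\<alpha> t) \<zeta>)\<^sup>2 + 2 * c * B (\<alpha> s) \<zeta> * B (\<alpha> t) \<zeta>"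
  shows "N \<le> 0 \<or> N = 1 - c\<^sup>2 \<or> 4 / 3 * (1 - c\<^sup>2) \<le> N"
  using assms
proof (induction "depth \<zeta>" arbitrary: \<zeta> s t N rule: less_induct)
  case less
  note p = less.prems(1-5)
  note c = less.prems(6-8)
  have ts: "B (\<alpha> t) (\<alpha> s) = - c" using p(3) form_sym by metis
  have sw: "\<zeta> \<notin> span {\<alpha> t, \<alpha> s}" using p(5) by (simp add: insert_commute)
  define x where "x = - B (\<alpha> s) \<zeta>"
  define y where "y = - B (\<alpha> t) \<zeta>"
  have xy: "B (\<alpha> s) \<zeta> = - x" "B (\<alpha> t) \<zeta> = - y" by (simp_all add: x_def y_def)
  have N: "N = x\<^sup>2 + y\<^sup>2 + 2 * c * x * y" using less.prems(9) by (simp add: xy)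
  have f: "B (\<alpha> s) (\<alpha> s) = 1" "B (\<alpha> t) (\<alpha> t) = 1" using form_simple_root p by auto
  have c2: "1 - c\<^sup>2 \<le> 1 / 4" "c\<^sup>2 < 1" using c by (auto simp: abs_square_less_1)
  have split: ?case
    if st: "s' \<in> S" "t' \<in> S" "B (\<alpha> s') (\<alpha> t') = - c" "\<zeta> \<notin> span {\<alpha> s', \<alpha> t'}"
    and N': "N = x'\<^sup>2 + y'\<^sup>2 + 2 * c * x' * y'" and x': "x' = - B (\<alpha> s') \<zeta>" and y': "y' = - B (\<alpha> t') \<zeta>"
    and o: "pos \<omega>" "depth \<omega> < depth \<zeta>" "\<zeta> = u *\<^sub>R \<omega> + v *\<^sub>R \<alpha> s'" "1 \<le> u"
    for s' t' x' y' \<omega> u v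
  proof -
    define q where "q = - B (\<alpha> s') \<omega>"
    define Y where "Y = - B (\<alpha> t') \<omega>"
    define M where "M = q\<^sup>2 + Y\<^sup>2 + 2 * c * q * Y"
    have ts': "B (\<alpha> t') (\<alpha> s') = - c" "B \<omega> (\<alpha> s') = - q" "B (\<alpha> s') \<omega> = - q" "B (\<alpha> t') \<omega> = - Y"
      using st(3) form_sym unfolding q_def Y_def by (metis minus_minus)+
    have ff: "B \<omega> \<omega> = 1" "B (\<alpha> s') (\<alpha> s') = 1" "B \<zeta> \<zeta> = 1"
      using form_simple_root st o(1) p(4) pos_root form_root by auto
    have IH: "M \<le> 0 \<or> M = 1 - c\<^sup>2 \<or> 4 / 3 * (1 - c\<^sup>2) \<le> M"
      by (rule less.hyps[OF o(2) st(1-3) o(1) summand_notin_span[OF o(3) st(4)] c])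
        (simp add: M_def ts')
    have xx: "x' = u * q - v" "y' = u * Y + v * c"
      unfolding x' y' o(3) using ts' ff by simp_all
    have nz: "u\<^sup>2 + v\<^sup>2 - 2 * u * v * q = 1"
      using ff(3) unfolding o(3) by (simp add: ff ts' power2_eq_square algebra_simps)
    have "N = u\<^sup>2 * M + (1 - c\<^sup>2) * (v\<^sup>2 - 2 * u * v * q)"
      unfolding N' xx M_def by (simp add: power2_eq_square algebra_simps)
    also have "v\<^sup>2 - 2 * u * v * q = 1 - u\<^sup>2" using nz by simp
    finally have NM: "N = (1 - c\<^sup>2) + u\<^sup>2 * (M - (1 - c\<^sup>2))" by (simp add: algebra_simps)
    have u2: "1 \<le> u\<^sup>2" using o(4) by simp
    from IH show ?thesis
    proof (elim disjE)
      assume "M \<le> 0"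
      then have "M - (1 - c\<^sup>2) \<le> 0" using c2 by simp
      then have "u\<^sup>2 * (M - (1 - c\<^sup>2)) \<le> 1 * (M - (1 - c\<^sup>2))" using u2 by (rule mult_right_mono_neg[rotated])
      then show ?thesis using NM \<open>M \<le> 0\<close> by simp
    next
      assume "M = 1 - c\<^sup>2" then show ?thesis using NM by simp
    next
      assume a: "4 / 3 * (1 - c\<^sup>2) \<le> M"
      then have "0 \<le> M - (1 - c\<^sup>2)" using c2 by simp
      then have "1 * (M - (1 - c\<^sup>2)) \<le> u\<^sup>2 * (M - (1 - c\<^sup>2))" using u2 by (rule mult_right_mono[rotated])
      then show ?thesis using NM a by simp
    qed
  qed
  \<comment> \<open>Since \<open>c^2 \<ge> 3/4\<close>, the threshold \<open>4/3 * (1 - c^2)\<close>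
    is at most 1/3, below the 1/2 that a single large coordinate contributes.\<close>
  have big: ?case if "sqrt 2 / 2 \<le> x \<or> sqrt 2 / 2 \<le> y" "0 \<le> x" "0 \<le> y"
  proof -
    have "1 / 2 \<le> x\<^sup>2 \<or> 1 / 2 \<le> y\<^sup>2"
      using that(1) power_mono[of "sqrt 2 / 2" x 2] power_mono[of "sqrt 2 / 2" y 2]
      by (auto simp: power_divide)
    moreover have "0 \<le> 2 * c * x * y" "0 \<le> x\<^sup>2" "0 \<le> y\<^sup>2" using that c by auto
    ultimately have "1 / 2 \<le> N" unfolding N by linarith
    moreover have "4 / 3 * (1 - c\<^sup>2) \<le> 4 / 3 * (1 / 4)" using c2(1) by (intro mult_left_mono) auto
    ultimately have "4 / 3 * (1 - c\<^sup>2) \<le> N" by simp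
    then show ?thesis by blast
  qed
  have sN: "N = y\<^sup>2 + x\<^sup>2 + 2 * c * y * x" using N by (simp add: algebra_simps)
  consider "x < 0" | "y < 0" | "0 \<le> x" "0 \<le> y" by linarith
  then show ?case
  proof cases
    case 1
    note d = outside_span_descent[OF p(1,4,5)]
    have e: "B (\<alpha> s) (act s \<zeta>) = x" "B (\<alpha> t) (act s \<zeta>) = - (y + 2 * c * x)"
      using p(1) f ts by (simp_all add: act_gen xy)
    have "N = (B (\<alpha> s) (act s \<zeta>))\<^sup>2 + (B (\<alpha> t) (act s \<zeta>))\<^sup>2 + 2 * c * B (\<alpha> s) (act s \<zeta>) * B (\<alpha> t) (act s \<zeta>)"
      unfolding N e by (simp add: power2_eq_square algebra_simps)
    then show ?thesis
      using less.hyps[OF d(2) p(1-3) d(1) gen_notin_span[OF p(1,5)] c] 1 by (simp add: xy)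
  next
    case 2
    note d = outside_span_descent[OF p(2,4) sw]
    have e: "B (\<alpha> t) (act t \<zeta>) = y" "B (\<alpha> s) (act t \<zeta>) = - (x + 2 * c * y)"
      using p(2) f p(3) by (simp_all add: act_gen xy)
    have "N = (B (\<alpha> t) (act t \<zeta>))\<^sup>2 + (B (\<alpha> s) (act t \<zeta>))\<^sup>2 + 2 * c * B (\<alpha> t) (act t \<zeta>) * B (\<alpha> s) (act t \<zeta>)"
      unfolding N e by (simp add: power2_eq_square algebra_simps)
    then show ?thesis
      using less.hyps[OF d(2) p(2,1) ts d(1) gen_notin_span[OF p(2) sw] c] 2 by (simp add: xy)
  next
    case 3
    have xs: "?thesis \<or> x = 0 \<or> x = 1 / 2 \<or> sqrt 2 / 2 \<le> x"
    proof (cases "0 < x \<and> x < 1")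
      case True
      then show ?thesis
        using simple_plane_split[OF p(1,4) x_def] split[OF p(1-3,5) N x_def y_def] by blast
    next
      case False then show ?thesis using 3 real_le_lsqrt[of 2 2] by auto
    qed
    have ys: "?thesis \<or> y = 0 \<or> y = 1 / 2 \<or> sqrt 2 / 2 \<le> y"
    proof (cases "0 < y \<and> y < 1")
      case True
      then show ?thesis
        using simple_plane_split[OF p(2,4) y_def] split[OF p(2,1) ts sw sN y_def x_def] by blast
    next
      case False then show ?thesis using 3 real_le_lsqrt[of 2 2] by auto
    qed
    show ?thesis
    proof (cases "(x = 0 \<or> x = 1 / 2) \<and> (y = 0 \<or> y = 1 / 2)")
      case True
      then consider "x = 0" "y = 0" | "x = 0" "y = 1 / 2" | "x = 1 / 2" "y = 0"
        | "x = 1 / 2" "y = 1 / 2" by blast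
      then have "N = 0 \<or> N = 1 / 4 \<or> N = 1 / 2 + c / 2"
      proof cases
        case 1 then show ?thesis unfolding N by simp
      next
        case 2 then show ?thesis unfolding N 2 by (simp add: power2_eq_square)
      next
        case 3 then show ?thesis unfolding N 3 by (simp add: power2_eq_square)
      next
        case 4 then show ?thesis unfolding N 4 by (simp add: power2_eq_square)
      qed
      \<comment> \<open>The value 1/4 dictates the hypothesis on \<open>c\<close>: it is
        \<open>1 - c^2\<close> when \<open>c^2 = 3/4\<close>, and it reaches
        \<open>4/3 * (1 - c^2)\<close> exactly from \<open>c^2 = 13/16\<close> on.\<close>
      then consider "N = 0" | "N = 1 / 4" | "N = 1 / 2 + c / 2" by blast
      then show ?thesis
      proof cases
        case 2
        then show ?thesis using c(3) by auto
      next
        case 3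
        then show ?thesis using c2 c(1) by auto
      qed simp
    next
      case False then show ?thesis using xs ys big 3 by blast
    qed
  qed
qed

end

subsection \<open>Dominance depth along a plane\<close>

text \<open>The bounds on \<open>y\<close> say \<open>\<bar>y + c * x\<bar> < 1 - c * x\<close>, so
  \<open>M\<close> stays below its boundary value \<open>f\<close>, and
  \<open>c^2 * f \<le> d\<close>. With \<open>c^2 \<ge> 3/4\<close> this puts \<open>M\<close> below
  \<open>4/3 * d\<close>, inside the gap. The decomposition
  \<open>M = d * x^2 + (y + c * x)^2\<close> with \<open>x \<ge> 1\<close> then leaves only
  \<open>M = d\<close>, attained at one point.\<close>

lemma projection_extremal:
  fixes x y c :: real
  assumes c: "0 < c" "c < 1" "3 / 4 \<le> c\<^sup>2" and x: "1 \<le> x" and y: "-1 < y" "2 * c * x + y < 1"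
    and N: "x\<^sup>2 + y\<^sup>2 + 2 * c * x * y \<le> 0 \<or> x\<^sup>2 + y\<^sup>2 + 2 * c * x * y = 1 - c\<^sup>2 \<or>
      4 / 3 * (1 - c\<^sup>2) \<le> x\<^sup>2 + y\<^sup>2 + 2 * c * x * y"
  shows "x = 1 \<and> y = - c"
proof -
  define d where "d = 1 - c\<^sup>2"
  define M where "M = x\<^sup>2 + y\<^sup>2 + 2 * c * x * y"
  define f where "f = 1 - 2 * c * x + x\<^sup>2"
  have d: "0 < d" using c by (simp add: d_def abs_square_less_1)
  have M: "M = d * x\<^sup>2 + (y + c * x)\<^sup>2" by (simp add: M_def d_def power2_eq_square algebra_simps)
  have cx: "c * x < 1" using y by linarith
  have "\<bar>y + c * x\<bar> < 1 - c * x" using y by linarith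
  then have "\<bar>y + c * x\<bar>\<^sup>2 < (1 - c * x)\<^sup>2" by (intro power_strict_mono) auto
  then have "(y + c * x)\<^sup>2 < (1 - c * x)\<^sup>2" by simp
  then have "M < d * x\<^sup>2 + (1 - c * x)\<^sup>2" by (simp add: M)
  also have "\<dots> = f" by (simp add: f_def d_def power2_eq_square algebra_simps)
  finally have Mf: "M < f" .
  have "0 \<le> (x - 1) * (1 - c * x)" using x cx by simp
  then have q: "c * x\<^sup>2 \<le> x + c * x - 1" by (simp add: power2_eq_square algebra_simps)
  have "c * f \<le> c - 1 + x * ((1 - c) * (1 + 2 * c))"
    using q by (simp add: f_def power2_eq_square algebra_simps)
  then have "c * (c * f) \<le> c * (c - 1 + x * ((1 - c) * (1 + 2 * c)))" using c by (intro mult_left_mono) auto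
  also have "\<dots> = c * (c - 1) + (c * x) * ((1 - c) * (1 + 2 * c))" by (simp add: algebra_simps)
  also have "\<dots> \<le> c * (c - 1) + 1 * ((1 - c) * (1 + 2 * c))"
    using cx c by (intro add_left_mono mult_right_mono) auto
  also have "\<dots> = d" by (simp add: d_def power2_eq_square algebra_simps)
  finally have cf: "c\<^sup>2 * f \<le> d" by (simp add: power2_eq_square)
  have "0 \<le> M" unfolding M using d by simp
  then have "0 \<le> f" using Mf by simp
  then have "3 / 4 * f \<le> c\<^sup>2 * f" using c(3) by (intro mult_right_mono) auto
  then have "M < 4 / 3 * d" using cf Mf by linarith
  moreover have x2: "1 \<le> x\<^sup>2" using x by simp
  then have dx: "d * 1 \<le> d * x\<^sup>2" using d by (intro mult_left_mono) auto
  then have "d \<le> M" using M zero_le_power2[of "y + c * x"] by linarith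
  ultimately have Md: "M = d" using N d by (simp add: M_def[symmetric] d_def[symmetric])
  then have "(y + c * x)\<^sup>2 = 0" "d * x\<^sup>2 = d" using M dx zero_le_power2[of "y + c * x"] by linarith+
  then have "y + c * x = 0" "x\<^sup>2 = 1" using d by auto
  then show ?thesis using x by (auto simp: power2_eq_1_iff)
qed

context geometric_representation
begin

text \<open>A root dominated by \<open>b\<close> is kept if its product with \<open>b'\<close> is at
  least 1, for then it is also dominated by \<open>b'\<close>; the others are moved by
  \<open>h\<close>. Kept roots have product at least 1 with \<open>b\<close> and moved ones less
  than 1, so the two kinds never collide.\<close>

lemma dp_le_by_map:
  assumes "pos b" "pos b'" "B b b' < 1" "b \<noteq> b'"
    and map: "\<And>\<gamma>. \<gamma> \<in> D b \<Longrightarrow> B \<gamma> b' < 1 \<Longrightarrow> h \<gamma> \<in> D b' \<and> B (h \<gamma>) b < 1"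
    and inj: "inj_on h {\<gamma> \<in> D b. B \<gamma> b' < 1}"
  shows "dp b \<le> dp b'"
proof -
  define f where "f \<gamma> = (if 1 \<le> B \<gamma> b' then \<gamma> else h \<gamma>)" for \<gamma>
  have ge: "1 \<le> B \<gamma> b" if "\<gamma> \<in> D b" for \<gamma> using dom_form_ge_1 that by blast
  have "f ` D b \<subseteq> D b'"
  proof (rule image_subsetI)
    fix \<gamma> assume g: "\<gamma> \<in> D b"
    show "f \<gamma> \<in> D b'"
    proof (cases "1 \<le> B \<gamma> b'")
      case True
      have "\<not> dom b' \<gamma>"
      proof
        assume "dom b' \<gamma>"
        then have "dom b' b" using dom_trans g by blast
        then show False using dom_form_ge_1 assms(3,4) form_sym[of b' b] by fastforce
      qed
      then have "dom \<gamma> b'" using dom_comparable[OF _ _ True] g assms(2) pos_root by blast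
      moreover have "\<gamma> \<noteq> b'" using ge[OF g] assms(3) form_sym[of b' b] by auto
      ultimately show ?thesis using g True by (simp add: f_def)
    next
      case False then show ?thesis using map[OF g] by (simp add: f_def)
    qed
  qed
  moreover have "inj_on f (D b)"
  proof (rule inj_onI)
    fix x y assume xy: "x \<in> D b" "y \<in> D b" "f x = f y"
    consider "1 \<le> B x b'" "1 \<le> B y b'" | "\<not> 1 \<le> B x b'" "\<not> 1 \<le> B y b'"
      | "1 \<le> B x b'" "\<not> 1 \<le> B y b'" | "\<not> 1 \<le> B x b'" "1 \<le> B y b'" by blast
    then show "x = y"
    proof cases
      case 1 then show ?thesis using xy(3) by (simp add: f_def)
    next
      case 2
      then have "h x = h y" using xy(3) by (simp add: f_def)
      then show ?thesis using inj_onD[OF inj, of x y] xy(1,2) 2 by simp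
    next
      case 3
      then have "x = h y" using xy(3) by (simp add: f_def)
      then show ?thesis using map[OF xy(2)] ge[OF xy(1)] 3 by auto
    next
      case 4
      then have "y = h x" using xy(3) by (simp add: f_def)
      then show ?thesis using map[OF xy(1)] ge[OF xy(2)] 4 by auto
    qed
  qed
  ultimately have "card (D b) \<le> card (D b')" using card_inj_on_le finite_D assms(2) by blast
  then show ?thesis using dp_eq assms(1,2) by simp
qed

text \<open>Pulled back, \<gamma> is strictly below a simple root and hence negative. The bound -1
  holds because otherwise \<zeta> would dominate \<alpha> t, and \<open>v\<close> would make
  \<alpha> t negative along with \<zeta>. In the positive definite plane a product of absolute value
  at least 1 occurs only between proportional roots, so \<zeta> is outside.\<close>

lemma dominated_pullback:
  assumes st: "s \<in> S" "t \<in> S" "s \<noteq> t" "B (\<alpha> s) (\<alpha> t) = - c" "\<bar>c\<bar> < 1"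
    and v: "v \<in> carrier W" "pos (act v (\<alpha> s))" "pos (act v (\<alpha> t))"
    and g: "\<gamma> \<in> D (act v (\<alpha> s))"
  defines "\<zeta> \<equiv> - act (inv v) \<gamma>"
  shows "pos \<zeta>" "\<zeta> \<notin> span {\<alpha> s, \<alpha> t}" "act v \<zeta> = - \<gamma>"
    "1 \<le> B \<gamma> (act v (\<alpha> s))" "-1 < B \<gamma> (act v (\<alpha> t))"
    "B (\<alpha> s) \<zeta> = - B \<gamma> (act v (\<alpha> s))" "B (\<alpha> t) \<zeta> = - B \<gamma> (act v (\<alpha> t))"
proof -
  have gd: "pos \<gamma>" "\<gamma> \<noteq> act v (\<alpha> s)" "dom \<gamma> (act v (\<alpha> s))" using g by auto
  show vz: "act v \<zeta> = - \<gamma>" using v by (simp add: \<zeta>_def)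
  have "dom (act (inv v) \<gamma>) (\<alpha> s)" using dom_act[OF gd(3), of "inv v"] v by simp
  moreover have "act (inv v) \<gamma> \<noteq> \<alpha> s" using gd(2) v by (metis act_inv_cancel(2))
  ultimately show pz: "pos \<zeta>" using dom_simple_left st(1) by (simp add: \<zeta>_def)
  show x: "1 \<le> B \<gamma> (act v (\<alpha> s))" using dom_form_ge_1 gd by blast
  show f: "B (\<alpha> s) \<zeta> = - B \<gamma> (act v (\<alpha> s))" "B (\<alpha> t) \<zeta> = - B \<gamma> (act v (\<alpha> t))"
    using form_act_inv[OF v(1), of \<gamma>] form_sym by (simp_all add: \<zeta>_def)
  show "-1 < B \<gamma> (act v (\<alpha> t))"
  proof (rule ccontr)
    assume "\<not> ?thesis"
    then have "dom (\<alpha> t) \<zeta>" using dom_simpleI[OF st(2) pz] f by simp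
    then have "neg (act v (\<alpha> t))" using dom_negD v(1) vz gd(1) by fastforce
    then show False using v(3) pos_not_neg by blast
  qed
  show "\<zeta> \<notin> span {\<alpha> s, \<alpha> t}"
  proof
    assume "\<zeta> \<in> span {\<alpha> s, \<alpha> t}"
    then obtain a where "\<zeta> - a *\<^sub>R \<alpha> s \<in> span {\<alpha> t}" using span_breakdown_eq by metis
    then obtain b where "\<zeta> - a *\<^sub>R \<alpha> s = b *\<^sub>R \<alpha> t" by (auto simp: span_singleton)
    then have z: "\<zeta> = a *\<^sub>R \<alpha> s + b *\<^sub>R \<alpha> t" by (metis add.commute diff_add_cancel)
    have ff: "B (\<alpha> s) (\<alpha> s) = 1" "B (\<alpha> t) (\<alpha> t) = 1" "B (\<alpha> t) (\<alpha> s) = - c"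
      using st form_simple_root form_sym by metis+
    have "B \<zeta> \<zeta> = 1" using pz pos_root form_root by blast
    then have n: "a\<^sup>2 + b\<^sup>2 - 2 * a * b * c = 1"
      unfolding z by (simp add: ff st(4) power2_eq_square algebra_simps)
    define x where "x = B \<gamma> (act v (\<alpha> s))"
    have xa: "x = b * c - a" using f(1) unfolding z x_def by (simp add: ff st(4))
    have "x\<^sup>2 + b\<^sup>2 * (1 - c\<^sup>2) = 1" using n unfolding xa by (simp add: power2_eq_square algebra_simps)
    moreover have "1 \<le> x\<^sup>2" using x by (simp add: x_def)
    moreover have c2: "0 < 1 - c\<^sup>2" using st(5) by (simp add: abs_square_less_1)
    then have "0 \<le> b\<^sup>2 * (1 - c\<^sup>2)" by simp
    ultimately have "b\<^sup>2 * (1 - c\<^sup>2) = 0" by linarith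
    then have "b = 0" using c2 by auto
    then have "\<zeta> = a *\<^sub>R \<alpha> s" using z by simp
    then have "\<zeta> = \<alpha> s" using pos_multiple_eq[OF pz pos_simple[OF st(1)]] by blast
    then show False using f(1) x ff by simp
  qed
qed

text \<open>The product makes \<sigma> and \<open>- \<theta>\<close> comparable, and their signs
  decide the direction.\<close>

lemma dom_from_pullback:
  assumes v: "v \<in> carrier W" and s: "pos \<sigma>" and th: "pos \<theta>" "B \<theta> \<sigma> \<le> -1"
    and g: "pos \<delta>" "\<delta> = - act v \<theta>"
  shows "\<delta> \<in> D (act v \<sigma>)"
proof -
  have "\<not> dom \<sigma> (- \<theta>)" using dom_neg[of \<sigma> "- \<theta>"] th s pos_not_neg by auto
  then have d: "dom (- \<theta>) \<sigma>" using dom_comparable[of \<sigma> "- \<theta>"] th s pos_root form_sym[of \<sigma> \<theta>] by auto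
  have "- \<theta> \<noteq> \<sigma>" using th s pos_not_neg by auto
  then have "\<delta> \<noteq> act v \<sigma>" using g(2) v by (metis act_inv_cancel(1) act_simps(4))
  then show ?thesis using dom_act[OF d v] g v by simp
qed

text \<open>The roots compared are \<open>pi / 4\<close> apart. A \<gamma> dominated by the first,
  with product less than 1 with the second, is forced to be orthogonal to the image of
  \<open>\<alpha> s + sqrt 2 *\<^sub>R \<alpha> t\<close>. With \<open>z\<close> its negated
  pullback, \<open>h \<gamma>\<close> is \<open>- act v \<theta>\<close>, where \<theta> is \<alpha>
  t reflected in the root \<open>act t z\<close>.\<close>

lemma dp_first_step_B2:
  assumes st: "s \<in> S" "t \<in> S" "s \<noteq> t" "B (\<alpha> s) (\<alpha> t) = - (sqrt 2 / 2)"
    and v: "v \<in> carrier W" "pos (act v (\<alpha> s))" "pos (act v (\<alpha> t))"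
  shows "dp (act v (\<alpha> s)) \<le> dp (act v (\<alpha> t + sqrt 2 *\<^sub>R \<alpha> s))"
proof -
  let ?r = "sqrt 2"
  have rr': "?r * (?r * w) = 2 * w" for w by (simp flip: mult.assoc)
  have r1: "7 / 5 < ?r" "?r < 3 / 2"
    using real_less_rsqrt[of "7/5" 2] real_less_lsqrt[of "3/2" 2] by (auto simp: power2_eq_square)
  define \<sigma> where "\<sigma> = \<alpha> t + ?r *\<^sub>R \<alpha> s"
  have f: "B (\<alpha> s) (\<alpha> s) = 1" "B (\<alpha> t) (\<alpha> t) = 1" "B (\<alpha> t) (\<alpha> s) = - (?r / 2)"
    using st form_simple_root form_sym by metis+
  have "act s (\<alpha> t) = \<sigma>" using st(1) by (simp add: act_gen st(4) \<sigma>_def)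
  then have ps: "pos \<sigma>" using gen_permutes_pos[of "\<alpha> t" s] st pos_simple simple_root_inj by metis
  have "act v \<sigma> = 1 *\<^sub>R act v (\<alpha> t) + ?r *\<^sub>R act v (\<alpha> s)" using v(1) by (simp add: \<sigma>_def)
  then have pvs: "pos (act v \<sigma>)"
    by (rule pos_comb_eq) (use v ps root_act pos_root in auto)
  define Y where "Y \<gamma> = - B \<gamma> (act v (\<alpha> t))" for \<gamma>
  define h where "h \<gamma> = (4 * (Y \<gamma>)\<^sup>2 - 1) *\<^sub>R act v (\<alpha> t) + (2 * Y \<gamma>) *\<^sub>R \<gamma>" for \<gamma>
  have bad: "B \<gamma> (act v (\<alpha> s)) = ?r * Y \<gamma> \<and> ?r / 2 \<le> Y \<gamma>"
    if g: "\<gamma> \<in> D (act v (\<alpha> s))" "B \<gamma> (act v \<sigma>) < 1" for \<gamma>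
  proof -
    have cc: "\<bar>?r / 2\<bar> < 1" using r1 by simp
    note p = dominated_pullback[OF st cc v g(1)]
    define x where "x = B \<gamma> (act v (\<alpha> s))"
    define y where "y = B \<gamma> (act v (\<alpha> t))"
    have xy: "1 \<le> x" "-1 < y" "y + ?r * x < 1"
      using p(4,5) g(2) v(1) by (simp_all add: x_def y_def \<sigma>_def)
    \<comment> \<open>Only \<open>x\<close> can be large: the other three numbers lie strictly
      between -1 and 1. All except \<open>x + ?r * y\<close> are seen to be non-zero, so this one
      must vanish.\<close>
    have "two_large x y (?r * x + y) (x + ?r * y)"
      using form_B2_outside[OF st(1,2,4) p(1,2)] unfolding p(6,7) x_def[symmetric] y_def[symmetric] by (simp add: add.commute)
    moreover have "7 / 5 * x \<le> ?r * x" using r1 xy by (intro mult_right_mono) auto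
    then have y0: "y < - (2 / 5)" using xy by linarith
    moreover have "?r * y < ?r * (1 - ?r * x)" using xy by (intro mult_strict_left_mono) auto
    then have "?r * y < ?r - 2 * x" by (simp add: right_diff_distrib rr')
    then have "x + ?r * y < 1" using xy r1 by linarith
    moreover have "?r * (-1) < ?r * y" using xy by (intro mult_strict_left_mono) auto
    then have "-1 < x + ?r * y" using xy r1 by linarith
    moreover have "0 < ?r * x + y" using \<open>7 / 5 * x \<le> ?r * x\<close> xy by linarith
    ultimately have e: "x + ?r * y = 0" using xy unfolding two_large_def by linarith
    then have xY: "x = ?r * Y \<gamma>" by (simp add: Y_def y_def)
    moreover have "?r * 1 \<le> ?r * x" using xy by (intro mult_left_mono) auto
    then have "?r \<le> ?r * (?r * Y \<gamma>)" unfolding xY by simp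
    then have "?r / 2 \<le> Y \<gamma>" by (simp add: rr')
    ultimately show ?thesis by (simp add: x_def)
  qed
  have "dp (act v (\<alpha> s)) \<le> dp (act v \<sigma>)"
  proof (rule dp_le_by_map[OF v(2) pvs, of h])
    show "B (act v (\<alpha> s)) (act v \<sigma>) < 1" using v(1) r1 by (simp add: \<sigma>_def f st(4))
    show "act v (\<alpha> s) \<noteq> act v \<sigma>"
    proof
      assume "act v (\<alpha> s) = act v \<sigma>"
      then have "\<alpha> s = \<sigma>" using v(1) by (metis act_inv_cancel(1))
      then have "B (\<alpha> s) (\<alpha> s) = B (\<alpha> s) \<sigma>" by simp
      then show False using r1 by (simp add: \<sigma>_def f st(4))
    qed
  next
    fix \<gamma> assume g: "\<gamma> \<in> D (act v (\<alpha> s))" "B \<gamma> (act v \<sigma>) < 1"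
    have cc: "\<bar>?r / 2\<bar> < 1" using r1 by simp
    note p = dominated_pullback[OF st cc v g(1)]
    define z where "z = - act (inv v) \<gamma>"
    note p = p[folded z_def]
    define y where "y = Y \<gamma>"
    have b: "B \<gamma> (act v (\<alpha> s)) = ?r * y" "?r / 2 \<le> y" using bad[OF g] by (auto simp: y_def)
    have bt: "B \<gamma> (act v (\<alpha> t)) = - y" by (simp add: y_def Y_def)
    have y0: "0 < y" using b(2) r1 by linarith
    have y2: "1 / 2 \<le> y\<^sup>2" using power_mono[OF b(2), of 2] by (simp add: power_divide)
    define q where "q = act t z"
    have zt: "z \<noteq> \<alpha> t" using p(2) span_base[of "\<alpha> t" "{\<alpha> s, \<alpha> t}"] by auto
    have pq: "pos q" using gen_permutes_pos[OF p(1) st(2) zt] by (simp add: q_def)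
    have fz: "B (\<alpha> s) z = - (?r * y)" "B (\<alpha> t) z = y" "B z (\<alpha> s) = - (?r * y)" "B z (\<alpha> t) = y"
      using p(6,7) b bt form_sym[of z "\<alpha> s"] form_sym[of z "\<alpha> t"] by simp_all
    have qz: "q = z - (2 * y) *\<^sub>R \<alpha> t" using st(2) by (simp add: q_def act_gen fz)
    define \<theta> where "\<theta> = act (rf q) (\<alpha> t)"
    have "B q (\<alpha> t) = - y" unfolding qz by (simp add: fz f)
    then have th1: "\<theta> = 1 *\<^sub>R \<alpha> t + (2 * y) *\<^sub>R q" using pq pos_root by (simp add: \<theta>_def act_rf)
    have rth: "rt \<theta>" using root_act root_simple pq pos_root st(2) by (simp add: \<theta>_def)
    have pth: "pos \<theta>" by (rule pos_comb_eq[OF th1 rth]) (use pq st y0 pos_simple in auto)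
    have th2: "\<theta> = (1 - 4 * y\<^sup>2) *\<^sub>R \<alpha> t + (2 * y) *\<^sub>R z"
      unfolding th1 qz by (simp add: algebra_simps power2_eq_square)
    have hth: "h \<gamma> = - act v \<theta>"
      unfolding th2 using v(1) p(3) by (simp add: h_def y_def[symmetric] scaleR_diff_left)
    have ph: "pos (h \<gamma>)"
      by (rule pos_comb_eq[of _ "4 * y\<^sup>2 - 1" "act v (\<alpha> t)" "2 * y" \<gamma>])
        (use hth rth root_act v y0 y2 g in \<open>auto simp: h_def y_def\<close>)
    have "B \<theta> \<sigma> = - 2 * y\<^sup>2"
      unfolding th2 \<sigma>_def by (simp add: f fz power2_eq_square algebra_simps rr')
    then have "h \<gamma> \<in> D (act v \<sigma>)" using dom_from_pullback[OF v(1) ps pth _ ph hth] y2 by simp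
    moreover have "B (h \<gamma>) (act v (\<alpha> s)) = ?r / 2"
      using v(1) by (simp add: h_def y_def[symmetric] f b power2_eq_square algebra_simps)
    ultimately show "h \<gamma> \<in> D (act v \<sigma>) \<and> B (h \<gamma>) (act v (\<alpha> s)) < 1" using r1 by simp
  next
    show "inj_on h {\<gamma> \<in> D (act v (\<alpha> s)). B \<gamma> (act v \<sigma>) < 1}"
    proof (rule inj_onI)
      fix \<gamma> \<delta> assume a: "\<gamma> \<in> {\<gamma> \<in> D (act v (\<alpha> s)). B \<gamma> (act v \<sigma>) < 1}"
        "\<delta> \<in> {\<gamma> \<in> D (act v (\<alpha> s)). B \<gamma> (act v \<sigma>) < 1}" "h \<gamma> = h \<delta>"
      have Yp: "0 < Y \<gamma>" "0 < Y \<delta>" using bad[of \<gamma>] bad[of \<delta>] a(1,2) r1 by auto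
      \<comment> \<open>This product recovers the positive number \<open>Y \<gamma>\<close> from
        \<open>h \<gamma>\<close>, after which \<open>h\<close> can be solved for \<gamma>.\<close>
      have bh: "B (h \<gamma>) (act v (\<alpha> t)) = 2 * (Y \<gamma>)\<^sup>2 - 1" for \<gamma>
      proof -
        have "B \<gamma> (act v (\<alpha> t)) = - Y \<gamma>" by (simp add: Y_def)
        then show ?thesis using v(1) by (simp add: h_def f power2_eq_square)
      qed
      have "(Y \<gamma>)\<^sup>2 = (Y \<delta>)\<^sup>2" using bh[of \<gamma>] bh[of \<delta>] a(3) by simp
      then have "Y \<gamma> = Y \<delta>" using Yp by (simp add: power2_eq_iff_nonneg)
      then have "(2 * Y \<delta>) *\<^sub>R \<gamma> = (2 * Y \<delta>) *\<^sub>R \<delta>" using a(3) by (simp add: h_def)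
      then show "\<gamma> = \<delta>" using Yp by simp
    qed
  qed
  then show ?thesis by (simp add: \<sigma>_def)
qed

text \<open>\<open>projection_extremal\<close> leaves only those \<gamma> that have the same
  products with the plane as \<open>act v (\<alpha> s)\<close>, so \<gamma> differs from this root
  by an isotropic vector orthogonal to the plane. The map \<open>h\<close> adds \<open>2 * c\<close>
  times that vector to \<open>act v \<sigma>\<close>.\<close>

lemma dp_first_step_large:
  assumes st: "s \<in> S" "t \<in> S" "s \<noteq> t" "B (\<alpha> s) (\<alpha> t) = - c"
    and c: "0 < c" "c < 1" "c\<^sup>2 = 3 / 4 \<or> 13 / 16 \<le> c\<^sup>2"
    and v: "v \<in> carrier W" "pos (act v (\<alpha> s))" "pos (act v (\<alpha> t))"
  shows "dp (act v (\<alpha> s)) \<le> dp (act v (\<alpha> t + (2 * c) *\<^sub>R \<alpha> s))"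
proof -
  have c2: "3 / 4 \<le> c\<^sup>2" using c(3) by auto
  define \<sigma> where "\<sigma> = \<alpha> t + (2 * c) *\<^sub>R \<alpha> s"
  have f: "B (\<alpha> s) (\<alpha> s) = 1" "B (\<alpha> t) (\<alpha> t) = 1" "B (\<alpha> t) (\<alpha> s) = - c"
    using st form_simple_root form_sym by metis+
  have "act s (\<alpha> t) = \<sigma>" using st(1) by (simp add: act_gen st(4) \<sigma>_def)
  then have ps: "pos \<sigma>" using gen_permutes_pos[of "\<alpha> t" s] st pos_simple simple_root_inj by metis
  have "act v \<sigma> = 1 *\<^sub>R act v (\<alpha> t) + (2 * c) *\<^sub>R act v (\<alpha> s)" using v(1) by (simp add: \<sigma>_def)
  then have pvs: "pos (act v \<sigma>)"
    by (rule pos_comb_eq) (use v c ps root_act pos_root in auto)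
  define h where "h \<gamma> = 1 *\<^sub>R act v (\<alpha> t) + (2 * c) *\<^sub>R \<gamma>" for \<gamma>
  have cc: "\<bar>c\<bar> < 1" using c by simp
  have "dp (act v (\<alpha> s)) \<le> dp (act v \<sigma>)"
  proof (rule dp_le_by_map[OF v(2) pvs, of h])
    show "B (act v (\<alpha> s)) (act v \<sigma>) < 1" using v(1) c by (simp add: \<sigma>_def f st(4))
    show "act v (\<alpha> s) \<noteq> act v \<sigma>"
    proof
      assume "act v (\<alpha> s) = act v \<sigma>"
      then have "\<alpha> s = \<sigma>" using v(1) by (metis act_inv_cancel(1))
      then have "B (\<alpha> s) (\<alpha> s) = B (\<alpha> s) \<sigma>" by simp
      then show False using c by (simp add: \<sigma>_def f st(4))
    qed
  next
    fix \<gamma> assume g: "\<gamma> \<in> D (act v (\<alpha> s))" "B \<gamma> (act v \<sigma>) < 1"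
    note p = dominated_pullback[OF st cc v g(1)]
    define z where "z = - act (inv v) \<gamma>"
    note p = p[folded z_def]
    define x where "x = B \<gamma> (act v (\<alpha> s))"
    define y where "y = B \<gamma> (act v (\<alpha> t))"
    have xy: "1 \<le> x" "-1 < y" "2 * c * x + y < 1"
      using p(4,5) g(2) v(1) by (simp_all add: x_def y_def \<sigma>_def)
    have "x\<^sup>2 + y\<^sup>2 + 2 * c * x * y \<le> 0 \<or> x\<^sup>2 + y\<^sup>2 + 2 * c * x * y = 1 - c\<^sup>2 \<or>
      4 / 3 * (1 - c\<^sup>2) \<le> x\<^sup>2 + y\<^sup>2 + 2 * c * x * y"
      by (rule projection_gap[OF st(1,2,4) p(1,2) c]) (simp add: p(6,7) x_def y_def)
    from projection_extremal[OF c(1,2) c2 xy this] have e: "x = 1" "y = - c" by auto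
    have fz: "B (\<alpha> s) z = - 1" "B (\<alpha> t) z = c" "B z (\<alpha> s) = - 1" "B z (\<alpha> t) = c"
      using p(6,7) e form_sym unfolding x_def y_def by (metis minus_minus)+
    define q where "q = act t z"
    have zt: "z \<noteq> \<alpha> t" using p(2) span_base[of "\<alpha> t" "{\<alpha> s, \<alpha> t}"] by auto
    have pq: "pos q" using gen_permutes_pos[OF p(1) st(2) zt] by (simp add: q_def)
    have qz: "q = z - (2 * c) *\<^sub>R \<alpha> t" using st(2) by (simp add: q_def act_gen fz)
    define \<theta> where "\<theta> = - act (rf z) (\<alpha> t)"
    have th2: "\<theta> = (2 * c) *\<^sub>R z - \<alpha> t" using p(1) pos_root by (simp add: \<theta>_def act_rf fz)
    have rth: "rt \<theta>" using root_act root_simple p(1) pos_root st(2) by (simp add: \<theta>_def)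
    have th1: "\<theta> = (4 * c\<^sup>2 - 1) *\<^sub>R \<alpha> t + (2 * c) *\<^sub>R q"
      unfolding th2 qz by (simp add: algebra_simps power2_eq_square)
    have pth: "pos \<theta>" by (rule pos_comb_eq[OF th1 rth]) (use pq st c c2 pos_simple in auto)
    have hth: "h \<gamma> = - act v \<theta>" unfolding th2 using v(1) p(3) by (simp add: h_def)
    have ph: "pos (h \<gamma>)"
      by (rule pos_comb_eq[of _ 1 "act v (\<alpha> t)" "2 * c" \<gamma>])
        (use hth rth root_act v c g in \<open>auto simp: h_def\<close>)
    have "B \<theta> \<sigma> = - 1"
      unfolding th2 \<sigma>_def by (simp add: f fz st(4))
    then have "h \<gamma> \<in> D (act v \<sigma>)" using dom_from_pullback[OF v(1) ps pth _ ph hth] by simp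
    moreover have "B (h \<gamma>) (act v (\<alpha> s)) = c"
      using v(1) e by (simp add: h_def f x_def)
    ultimately show "h \<gamma> \<in> D (act v \<sigma>) \<and> B (h \<gamma>) (act v (\<alpha> s)) < 1" using c by simp
  next
    show "inj_on h {\<gamma> \<in> D (act v (\<alpha> s)). B \<gamma> (act v \<sigma>) < 1}"
      using c by (intro inj_onI) (simp add: h_def)
  qed
  then show ?thesis by (simp add: \<sigma>_def)
qed

text \<open>Sorts even \<open>n\<close> by the argument that applies: \<open>n = 6\<close> gives
  \<open>c^2 = 3/4\<close>, and \<open>n \<ge> 8\<close> gives at least 13/16 by doubling the angle,
  so both fall under \<open>projection_gap\<close>; \<open>n = 4\<close> goes to the B2
  case.\<close>

lemma cos_pi_div_even:
  assumes "even n" "4 \<le> n"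
  shows "n = 4 \<or> 0 < cos (pi / real n) \<and> cos (pi / real n) < 1 \<and>
    ((cos (pi / real n))\<^sup>2 = 3 / 4 \<or> 13 / 16 \<le> (cos (pi / real n))\<^sup>2)"
proof -
  have "n = 4 \<or> n = 6 \<or> 8 \<le> n" using assms by presburger
  then consider "n = 4" | "n = 6" | "8 \<le> n" by blast
  then show ?thesis
  proof cases
    case 2
    define r where "r = cos (pi / real n)"
    have r: "r = sqrt 3 / 2" using 2 cos_30 by (simp add: r_def)
    have "0 < r" "r < 1" "r\<^sup>2 = 3 / 4" using real_less_lsqrt[of 2 3] by (simp_all add: r power_divide)
    then show ?thesis by (simp add: r_def)
  next
    case 3
    define \<phi> where "\<phi> = pi / real n"
    have "pi / real n \<le> pi / 8" using 3 by (intro divide_left_mono) auto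
    then have phi: "0 < \<phi>" "\<phi> \<le> pi / 8" using 3 by (auto simp: \<phi>_def)
    have c: "0 < cos \<phi>" "cos \<phi> < 1"
      using cos_gt_zero[of \<phi>] cos_monotone_0_pi[of 0 \<phi>] phi by auto
    have "cos (pi / 4) \<le> cos (2 * \<phi>)" using phi by (intro cos_monotone_0_pi_le) auto
    then have "sqrt 2 / 2 \<le> 2 * (cos \<phi>)\<^sup>2 - 1" unfolding cos_45 cos_double_cos .
    moreover have "7 / 5 < sqrt 2" using real_less_rsqrt[of "7/5" 2] by (simp add: power2_eq_square)
    ultimately have "13 / 16 \<le> (cos \<phi>)\<^sup>2" by linarith
    then show ?thesis using c by (simp add: \<phi>_def)
  qed simp
qed

text \<open>For even \<open>n\<close> no reflection of the plane relates the angles \<open>0\<close> and \<open>\<pi> / n\<close>, so \<open>dp_plane_step\<close> does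
  not apply. The plane is conjugate to a standard parabolic one, where the roots that are
  dominated by the first but not by the second root can be listed.\<close>

lemma dp_first_step:
  assumes o: "orthonormal b c" and n: "even n" "4 \<le> n"
    and rts: "\<And>t. rt (circ b c t) \<longleftrightarrow> (\<exists>j::int. t = of_int j * (pi / real n))"
    and p: "\<And>j. j < n \<Longrightarrow> pos (circ b c (real j * (pi / real n)))"
  shows "dp b \<le> dp (circ b c (pi / real n))"
proof -
  define \<phi> where "\<phi> = pi / real n"
  have phi: "0 < \<phi>" "real n * \<phi> = pi" using n by (auto simp: \<phi>_def)
  obtain m where m: "n = 2 * m" using n(1) by blast
  \<comment> \<open>Evenness of \<open>n\<close> makes \<open>c\<close> a root, so the plane is
    spanned by two orthogonal roots.\<close>
  have "rt (circ b c (pi / 2))" unfolding rts by (rule exI[of _ "int m"]) (use n in \<open>simp add: m\<close>)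
  then have rc: "rt c" by (simp add: circ_def)
  have rb: "rt b" using p[of 0] n pos_root by simp
  have bc: "B b b = 1" "B c c = 1" "B b c = 0" using o by (auto simp: orthonormal_def)
  obtain v s t where v: "v \<in> carrier W" "s \<in> S" "t \<in> S" "s \<noteq> t"
    "act v (\<alpha> s) \<in> span {b, c}" "act v (\<alpha> t) \<in> span {b, c}" "pos (act v (\<alpha> s))" "pos (act v (\<alpha> t))"
    using orthogonal_pair_simple_span_pos[OF rb rc bc(3)] by blast
  have angle: "\<exists>j<n. w = circ b c (real j * \<phi>)" if w: "w \<in> span {b, c}" "pos w" for w
  proof -
    obtain x where "w - x *\<^sub>R b \<in> span {c}" using w(1) span_breakdown_eq by metis
    then obtain y where "w - x *\<^sub>R b = y *\<^sub>R c" by (auto simp: span_singleton)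
    then have wxy: "w = x *\<^sub>R b + y *\<^sub>R c" by (metis add.commute diff_add_cancel)
    have "B w w = 1" using w pos_root form_root by blast
    then have "x\<^sup>2 + y\<^sup>2 = 1" unfolding wxy using bc form_sym[of c b] by (simp add: power2_eq_square)
    then obtain t where t: "0 \<le> t" "t < 2 * pi" "x = cos t" "y = sin t" by (rule sincos_total_2pi)
    have wt: "w = circ b c t" unfolding wxy t(3,4) circ_def ..
    obtain i :: int where i: "t = of_int i * \<phi>" using rts[of t] w wt pos_root unfolding \<phi>_def by auto
    have i0: "0 \<le> i" using t(1) i phi(1) by (simp add: zero_le_mult_iff)
    define j where "j = nat i"
    have j: "t = real j * \<phi>" using i i0 by (simp add: j_def)
    have "real j * \<phi> < real (2 * n) * \<phi>" using t(2) j phi(2) by simp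
    then have j2: "j < 2 * n" using phi(1) by (simp add: mult_less_cancel_right)
    have "j < n"
    proof (rule ccontr)
      assume nj: "\<not> j < n"
      then have "real j * \<phi> = real (j - n) * \<phi> + pi" using phi(2)[symmetric] by (simp add: of_nat_diff algebra_simps)
      then have "w = - circ b c (real (j - n) * \<phi>)" using wt j by simp
      moreover have "pos (circ b c (real (j - n) * \<phi>))" using p[of "j - n"] j2 nj by (simp add: \<phi>_def)
      ultimately show False using w(2) pos_not_neg by simp
    qed
    then show ?thesis using wt j by blast
  qed
  \<comment> \<open>The images of the two simple roots must be the ends of the half circle. A root
    of the plane outside the arc between them would put one simple root strictly between that root
    and the other simple root, against extremality, whatever the sign of the root.\<close>
  have main: "act v (\<alpha> s) = circ b c 0 \<and> act v (\<alpha> t) = circ b c (real (n - 1) * \<phi>)"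
    if st: "s \<in> S" "t \<in> S" "act v (\<alpha> s) = circ b c (real i * \<phi>)" "act v (\<alpha> t) = circ b c (real j * \<phi>)" "i < j" "j < n"
    for s t i j
  proof -
    have ne: "\<alpha> s \<noteq> \<alpha> t"
    proof
      assume "\<alpha> s = \<alpha> t"
      then have e: "circ b c (real i * \<phi>) = circ b c (real j * \<phi>)" using st by metis
      have "real i * \<phi> < real j * \<phi>" "real j * \<phi> < real n * \<phi>" "0 \<le> real i * \<phi>" using st(5,6) phi(1) by auto
      then have "\<bar>real i * \<phi> - real j * \<phi>\<bar> < 2 * pi" using phi(2) by linarith
      then show False using circ_inj[OF o e] st(5) phi(1) by simp
    qed
    define e where "e t = act (inv v) (circ b c t)" for t
    have ei: "e (real i * \<phi>) = \<alpha> s" "e (real j * \<phi>) = \<alpha> t" using st(3,4)[symmetric] v(1) by (simp_all add: e_def)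
    have eb: "sin (z - x) *\<^sub>R e y = sin (z - y) *\<^sub>R e x + sin (y - x) *\<^sub>R e z" for x y z
      using arg_cong[OF circ_between[of z x b c y], of "act (inv v)"] v(1) by (simp add: e_def)
    have re: "rt (e (real k * \<phi>))" for k
      using root_act[of "circ b c (real k * \<phi>)" "inv v"] v(1) rts[of "real k * \<phi>"]
      unfolding e_def \<phi>_def by (auto intro: exI[of _ "int k"])
    have sp: "0 < sin (real k * \<phi>)" if "0 < k" "k < n" for k
    proof (rule sin_gt_zero)
      have "real k * \<phi> < real n * \<phi>" using that phi(1) by simp
      then show "real k * \<phi> < pi" using phi(2) by simp
    qed (use that phi in simp)
    have no: False
      if r: "rt r" and eq: "a *\<^sub>R r + a' *\<^sub>R \<alpha> x = a'' *\<^sub>R \<alpha> y" and a: "0 < a" "0 < a'" "0 < a''"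
        and xy: "x \<in> S" "y \<in> S" "\<alpha> x \<noteq> \<alpha> y" for r a a' a'' x y
    proof (cases "pos r")
      case True
      from simple_root_extreme_roots(2)[OF True pos_simple[OF xy(1)] a(1,2) xy(2) eq] show False using xy(3) by blast
    next
      case False
      then have nr: "neg r" using r root_cases by blast
      have "a *\<^sub>R (- r) + a'' *\<^sub>R \<alpha> y = a' *\<^sub>R \<alpha> x" unfolding eq[symmetric] by simp
      from simple_root_extreme_roots(2)[OF nr pos_simple[OF xy(2)] a(1,3) xy(1) this] show False using xy(3) by simp
    qed
    have i0: "i = 0"
    proof (rule ccontr)
      assume i: "i \<noteq> 0"
      have "sin (real (j - i) * \<phi>) *\<^sub>R e 0 + sin (real i * \<phi>) *\<^sub>R \<alpha> t = sin (real j * \<phi>) *\<^sub>R \<alpha> s"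
        using eb[of "real j * \<phi>" "real i * \<phi>" 0] st(5)
        by (simp add: ei of_nat_diff left_diff_distrib)
      from no[OF _ this] show False using sp[of "j - i"] sp[of i] sp[of j] i st ne re[of 0] by simp
    qed
    have jn: "j = n - 1"
    proof (rule ccontr)
      assume j: "j \<noteq> n - 1"
      let ?n = "real (n - 1)"
      have "sin (real (n - 1 - j) * \<phi>) = - sin (real j * \<phi> - ?n * \<phi>)"
        unfolding sin_minus[symmetric] using st(6) by (intro arg_cong[of _ _ sin]) (simp add: of_nat_diff algebra_simps)
      then have "sin (real j * \<phi>) *\<^sub>R e (?n * \<phi>) + sin (real (n - 1 - j) * \<phi>) *\<^sub>R \<alpha> s = sin (?n * \<phi>) *\<^sub>R \<alpha> t"
        using eb[of "real j * \<phi>" 0 "?n * \<phi>"] ei i0 by simp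
      from no[OF re this] show False using sp[of j] sp[of "n - 1 - j"] sp[of "n - 1"] j st i0 ne by simp
    qed
    show ?thesis using st i0 jn by simp
  qed
  have fin: "dp b \<le> dp (circ b c \<phi>)"
    if st: "s \<in> S" "t \<in> S" "s \<noteq> t" "pos (act v (\<alpha> s))" "pos (act v (\<alpha> t))"
      and e: "act v (\<alpha> s) = circ b c 0 \<and> act v (\<alpha> t) = circ b c (real (n - 1) * \<phi>)" for s t
  proof -
    have r1: "real (n - 1) * \<phi> = pi - \<phi>" using n phi(2) by (simp add: of_nat_diff algebra_simps)
    have B: "B (\<alpha> s) (\<alpha> t) = - cos \<phi>"
      using form_circ[OF o, of 0 "pi - \<phi>"] e v(1) r1 form_act[of v "\<alpha> s" "\<alpha> t"] by simp
    have "- circ b c (2 * 0 - (pi - \<phi>)) = circ b c \<phi>"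
      using circ_minus_pi[of b c \<phi>] by simp
    then have "circ b c (pi - \<phi>) - (2 * cos (pi - \<phi>)) *\<^sub>R b = circ b c \<phi>"
      using circ_reflect[of b c "pi - \<phi>" 0] by (simp add: cos_diff)
    then have a: "act v (\<alpha> t + (2 * cos \<phi>) *\<^sub>R \<alpha> s) = circ b c \<phi>" using v(1) e r1 by (simp add: cos_diff)
    have ab: "act v (\<alpha> s) = b" using e by simp
    consider "n = 4" | "0 < cos \<phi>" "cos \<phi> < 1" "(cos \<phi>)\<^sup>2 = 3 / 4 \<or> 13 / 16 \<le> (cos \<phi>)\<^sup>2"
      using cos_pi_div_even[OF n] by (auto simp: \<phi>_def)
    then show ?thesis
    proof cases
      case 1
      then have c: "cos \<phi> = sqrt 2 / 2" using cos_45 by (simp add: \<phi>_def)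
      then have "2 * cos \<phi> = sqrt 2" by simp
      from a[unfolded this] show ?thesis
        using dp_first_step_B2[OF st(1-3) B[unfolded c] v(1) st(4,5)] ab by simp
    next
      case 2
      then show ?thesis using dp_first_step_large[OF st(1-3) B _ _ _ v(1) st(4,5)] a ab by simp
    qed
  qed
  obtain i j where ij: "i < n" "act v (\<alpha> s) = circ b c (real i * \<phi>)" "j < n" "act v (\<alpha> t) = circ b c (real j * \<phi>)"
    using angle v by blast
  have "i \<noteq> j"
  proof
    assume "i = j"
    then have "\<alpha> s = \<alpha> t" using ij v(1) by (metis act_inv_cancel(1))
    then show False using simple_root_inj v by blast
  qed
  then consider "i < j" | "j < i" by linarith
  then show ?thesis
  proof cases
    case 1
    then show ?thesis using fin[OF v(2,3,4,7,8)] main[OF v(2,3) ij(2,4) 1 ij(3)] by (simp add: \<phi>_def)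
  next
    case 2
    then show ?thesis using fin[OF v(3,2) v(4)[symmetric] v(8,7)] main[OF v(3,2) ij(4,2) 2 ij(1)] by (simp add: \<phi>_def)
  qed
qed

text \<open>With \<gamma> at index \<open>k\<close>, one reflection leads from 0 to \<open>k\<close>
  when \<open>k + n\<close> is even. Otherwise the path goes through index 1, and only its first
  step for even \<open>n\<close> is beyond \<open>dp_plane_step\<close>. The root \<eta> lies beyond
  \<gamma> and so guarantees \<open>k + 2 \<le> n\<close>, the room that the steps need.\<close>

lemma dp_extreme_le:
  assumes "pos \<beta>" "pos \<gamma>" "pos \<eta>" "\<bar>B \<beta> \<gamma>\<bar> < 1" "0 < a" "0 < b" "\<gamma> = a *\<^sub>R \<beta> + b *\<^sub>R \<eta>"
    and extreme: "\<And>r a b. pos r \<Longrightarrow> 0 < a \<Longrightarrow> 0 < b \<Longrightarrow> \<beta> \<noteq> a *\<^sub>R r + b *\<^sub>R \<gamma>"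
  shows "dp \<beta> \<le> dp \<gamma>"
proof -
  obtain c n k where o: "orthonormal \<beta> c" and n: "2 \<le> n" and k: "0 < k" "k < n"
    and g: "\<gamma> = circ \<beta> c (real k * (pi / real n))"
    and rts: "\<And>t. rt (circ \<beta> c t) \<longleftrightarrow> (\<exists>j::int. t = of_int j * (pi / real n))"
    and p: "\<And>j. j < n \<Longrightarrow> pos (circ \<beta> c (real j * (pi / real n)))"
    using extreme_plane[OF assms(1,2,4) extreme] by auto
  define \<phi> where "\<phi> = pi / real n"
  have phi: "0 < \<phi>" "real n * \<phi> = pi" using n by (auto simp: \<phi>_def)
  have bc: "B \<beta> \<beta> = 1" "B c c = 1" "B \<beta> c = 0" "B c \<beta> = 0"
    using o form_sym[of c \<beta>] by (auto simp: orthonormal_def)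
  define \<psi> where "\<psi> = real k * \<phi>"
  have g': "\<gamma> = circ \<beta> c \<psi>" using g by (simp add: \<psi>_def \<phi>_def)
  have psi: "0 < \<psi>" "\<psi> < pi" using k phi unfolding \<psi>_def phi(2)[symmetric] by auto
  have k2: "k + 2 \<le> n"
  proof -
    define x where "x = (cos \<psi> - a) / b"
    define y where "y = sin \<psi> / b"
    have "b *\<^sub>R \<eta> = circ \<beta> c \<psi> - a *\<^sub>R \<beta>" unfolding g'[symmetric] by (subst assms(7)) simp
    then have "(1 / b) *\<^sub>R (b *\<^sub>R \<eta>) = (1 / b) *\<^sub>R (circ \<beta> c \<psi> - a *\<^sub>R \<beta>)" by (rule arg_cong)
    also have "circ \<beta> c \<psi> - a *\<^sub>R \<beta> = (cos \<psi> - a) *\<^sub>R \<beta> + sin \<psi> *\<^sub>R c"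
      by (simp add: circ_def scaleR_diff_left)
    finally have e: "\<eta> = x *\<^sub>R \<beta> + y *\<^sub>R c" using assms(6) by (simp add: x_def y_def scaleR_add_right)
    have "B \<eta> \<eta> = 1" using assms(3) pos_root form_root by blast
    then have "x\<^sup>2 + y\<^sup>2 = 1" unfolding e using bc by (simp add: power2_eq_square)
    then obtain t where t: "0 \<le> t" "t < 2 * pi" "x = cos t" "y = sin t" by (rule sincos_total_2pi)
    have et: "\<eta> = circ \<beta> c t" unfolding e t(3,4) circ_def ..
    have sy: "0 < sin t" using sin_gt_zero[OF psi] assms(6) by (simp add: t(4)[symmetric] y_def)
    have tp: "t < pi"
    proof (rule ccontr)
      assume "\<not> t < pi"
      then have "0 \<le> sin (t - pi)" using t by (intro sin_ge_zero) auto
      then show False using sy by simp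
    qed
    have "cos \<psi> = a + b * cos t" "sin \<psi> = b * sin t"
      using assms(6) by (simp_all add: t(3,4)[symmetric] x_def y_def)
    then have "sin (t - \<psi>) = a * sin t" by (simp add: sin_diff algebra_simps)
    then have s: "0 < sin (t - \<psi>)" using sy assms(5) by simp
    have "\<psi> < t"
    proof (rule ccontr)
      assume "\<not> \<psi> < t"
      then have "0 \<le> sin (\<psi> - t)" using psi t by (intro sin_ge_zero) auto
      then show False using s sin_minus[of "t - \<psi>"] by simp
    qed
    moreover obtain i :: int where i: "t = of_int i * \<phi>"
      using rts[of t] et assms(3) pos_root unfolding \<phi>_def by auto
    ultimately have "real k * \<phi> < of_int i * \<phi>" "of_int i * \<phi> < real n * \<phi>"
      using tp phi(2) by (auto simp: \<psi>_def)
    then have "real k < of_int i" "of_int i < real n" using phi(1) by (auto simp: mult_less_cancel_right)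
    then have "int k < i" "i < int n" by linarith+
    then show ?thesis by linarith
  qed
  note step = dp_plane_step[OF o n p]
  show ?thesis
  proof (cases "even (k + n)")
    case True
    then show ?thesis using step[of 0 k] k2 g by simp
  next
    case kn: False
    have one: "dp \<beta> \<le> dp (circ \<beta> c (pi / real n))"
    proof (cases "even n")
      case True
      then have "odd k" using kn by simp
      then have "4 \<le> n" using k(1) k2 True by presburger
      then show ?thesis using dp_first_step[OF o True _ rts p] by blast
    next
      case False
      then show ?thesis using step[of 0 1] k k2 by simp
    qed
    have "k + 3 \<le> n"
    proof -
      have "n \<noteq> k + 2" using kn by auto
      then show ?thesis using k2 by simp
    qed
    then have "dp (circ \<beta> c (real 1 * (pi / real n))) \<le> dp \<gamma>"
      unfolding g using k kn by (intro step) auto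
    then show ?thesis using one by simp
  qed
qed

subsection \<open>Descending to right descents\<close>

text \<open>\<eta> is not inverted by \<open>y\<close>, as \<delta> would lie between two
  inversions; this puts the image of \<alpha> s between that of \<delta> and a positive root, as
  \<open>dp_extreme_le\<close> requires. A product of at most -1 is impossible, since \<alpha> s and
  \<delta> are both positive and both inverted.\<close>

lemma dp_descent_le:
  assumes y: "y \<in> carrier W" and s: "s \<in> S" "neg (act (inv y) (\<alpha> s))"
    and d: "\<delta> \<in> short_inversions W y" and eta: "pos \<eta>"
    and ab: "0 < a" "0 < b" and eq: "\<delta> = a *\<^sub>R \<alpha> s + b *\<^sub>R \<eta>"
  shows "dp (- act (inv y) \<delta>) \<le> dp (- act (inv y) (\<alpha> s))"
proof (cases "\<delta> = \<alpha> s")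
  case False
  have dp: "pos \<delta>" "neg (act (inv y) \<delta>)" using short_inversion_inverted y d by auto
  have ps: "pos (\<alpha> s)" using pos_simple s by blast
  have iy: "inv y \<in> carrier W" using y by simp
  have pe: "pos (act (inv y) \<eta>)"
  proof (rule ccontr)
    assume "\<not> ?thesis"
    then have "neg (act (inv y) \<eta>)" using root_cases root_act[OF pos_root[OF eta] iy] by blast
    then show False
      using short_inversion_not_between[OF y d ps s(2) eta _ ab eq] False by simp
  qed
  define q where "q = B (\<alpha> s) \<delta>"
  consider "1 \<le> q" | "q \<le> -1" | "\<bar>q\<bar> < 1" by linarith
  then show ?thesis
  proof cases
    case 1
    then have "dom (\<alpha> s) \<delta>" using dom_simpleI s dp q_def by blast
    then have "dom (- act (inv y) \<delta>) (- act (inv y) (\<alpha> s))" using dom_minus dom_act iy by blast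
    then show ?thesis using dp_mono dp by blast
  next
    case 2
    then have "B (\<alpha> s) \<delta> \<le> -1" by (simp add: q_def)
    from no_infinite_plane[OF pos_root[OF ps] pos_root[OF dp(1)] this one_closed iy] show ?thesis
      using ps dp s by simp
  next
    case 3
    show ?thesis
    proof (rule dp_extreme_le[OF dp(2) s(2) pe])
      show "\<bar>B (- act (inv y) \<delta>) (- act (inv y) (\<alpha> s))\<bar> < 1"
        using 3 iy form_sym[of \<delta> "\<alpha> s"] by (simp add: q_def)
      show "0 < 1 / a" "0 < b / a" using ab by auto
      have e: "act (inv y) \<delta> = a *\<^sub>R act (inv y) (\<alpha> s) + b *\<^sub>R act (inv y) \<eta>"
        by (subst eq) (use iy in simp)
      show "- act (inv y) (\<alpha> s) = (1 / a) *\<^sub>R - act (inv y) \<delta> + (b / a) *\<^sub>R act (inv y) \<eta>"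
        unfolding e using ab by (simp add: scaleR_add_right scaleR_diff_right)
    next
      fix r and a' b' :: real assume r: "pos r" "0 < a'" "0 < b'"
      \<comment> \<open>Moved back by \<open>y\<close>, the root \<open>r\<close> becomes
        \<open>- r'\<close>. If \<open>r'\<close> is positive, \<delta> lies between two inversions;
        if it is negative, \<alpha> s fails to be extreme.\<close>
      show "- act (inv y) \<delta> \<noteq> a' *\<^sub>R r + b' *\<^sub>R - act (inv y) (\<alpha> s)"
      proof
        assume e: "- act (inv y) \<delta> = a' *\<^sub>R r + b' *\<^sub>R - act (inv y) (\<alpha> s)"
        define r' where "r' = - act y r"
        have "\<delta> = - act y (- act (inv y) \<delta>)" using y by simp
        also have "\<dots> = b' *\<^sub>R \<alpha> s + a' *\<^sub>R r'" unfolding e using y by (simp add: r'_def)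
        finally have er: "\<delta> = b' *\<^sub>R \<alpha> s + a' *\<^sub>R r'" .
        have ir: "act (inv y) r' = - r" using y by (simp add: r'_def)
        have "rt r'" using root_act pos_root r y by (simp add: r'_def)
        then consider "pos r'" | "neg r'" using root_cases by blast
        then show False
        proof cases
          case 1
          then show False
            using short_inversion_not_between[OF y d ps s(2) 1 _ r(3,2) er] ir r(1) False by simp
        next
          case 2
          have "1 *\<^sub>R \<delta> + a' *\<^sub>R (- r') = b' *\<^sub>R \<alpha> s" by (subst er) simp
          from simple_root_extreme_roots(1)[OF dp(1) 2 zero_less_one r(2) s(1) this] show False
            using False by blast
        qed
      qed
    qed
  qed
qed simp

text \<open>\<open>\<delta>\<close> is moved by \<open>u\<^sup>-\<^sup>1\<close> into a standard parabolic plane, and every left descent met on the way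
  has positive product with it.\<close>

definition rank_two_position :: "'v \<Rightarrow> 'g \<Rightarrow> 'g \<Rightarrow> 'g \<Rightarrow> bool" where
  "rank_two_position \<delta> u p q \<longleftrightarrow> u \<in> carrier W \<and> p \<in> S \<and> q \<in> S \<and> p \<noteq> q \<and>
    pos (act u (\<alpha> p)) \<and> pos (act u (\<alpha> q)) \<and>
    (\<exists>a b. 0 < a \<and> 0 < b \<and> \<delta> = a *\<^sub>R act u (\<alpha> p) + b *\<^sub>R act u (\<alpha> q)) \<and>
    (\<forall>\<xi>. pos \<xi> \<longrightarrow> neg (act (inv u) \<xi>) \<longrightarrow> 0 < B \<xi> \<delta>)"

lemma rank_two_position_swap: "rank_two_position \<delta> u p q \<Longrightarrow> rank_two_position \<delta> u q p"
  unfolding rank_two_position_def by (metis add.commute)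

text \<open>Adding a multiple of \<alpha> s to \<open>act s \<delta>\<close> stays in the plane, so
  \<open>u\<close> can be kept. The sign condition survives because
  \<open>inv u \<otimes> s = p \<otimes> inv u\<close>, so \<open>s\<close> permutes the inversions
  of \<open>u\<close>.\<close>

lemma rank_two_position_merge:
  assumes r: "rank_two_position (act s \<delta>) u p q" and s: "s \<in> S" "0 < B (\<alpha> s) \<delta>" "act u (\<alpha> p) = \<alpha> s"
  shows "rank_two_position \<delta> u p q"
proof -
  have u: "u \<in> carrier W" "p \<in> S" "q \<in> S" "p \<noteq> q" "pos (act u (\<alpha> p))" "pos (act u (\<alpha> q))"
    and xi: "\<And>\<xi>. pos \<xi> \<Longrightarrow> neg (act (inv u) \<xi>) \<Longrightarrow> 0 < B \<xi> (act s \<delta>)"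
    using r unfolding rank_two_position_def by blast+
  obtain a b where ab: "0 < a" "0 < b" "act s \<delta> = a *\<^sub>R act u (\<alpha> p) + b *\<^sub>R act u (\<alpha> q)"
    using r unfolding rank_two_position_def by blast
  have sc: "s \<in> carrier W" using gens_closed s by blast
  define k where "k = 2 * B (\<alpha> s) \<delta>"
  have "\<delta> = act s \<delta> + k *\<^sub>R \<alpha> s" using s(1) by (simp add: act_gen k_def)
  then have "\<delta> = (a + k) *\<^sub>R act u (\<alpha> p) + b *\<^sub>R act u (\<alpha> q)"
    unfolding ab(3) s(3)[symmetric] by (simp add: scaleR_add_left add.commute add.left_commute)
  moreover have "0 < a + k" using ab(1) s(2) by (simp add: k_def)
  moreover have "0 < B \<xi> \<delta>" if x: "pos \<xi>" "neg (act (inv u) \<xi>)" for \<xi>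
  proof -
    have iu: "act (inv u) (\<alpha> s) = \<alpha> p" using u(1) by (simp flip: s(3))
    have "\<xi> \<noteq> \<alpha> s" using x(2) iu pos_simple[OF u(2)] pos_not_neg by metis
    then have "pos (act s \<xi>)" using gen_permutes_pos x(1) s(1) by blast
    moreover have "neg (act (inv u) (act s \<xi>))"
    proof -
      have "- act (inv u) \<xi> \<noteq> \<alpha> p"
      proof
        assume "- act (inv u) \<xi> = \<alpha> p"
        then have "act u (act (inv u) \<xi>) = - \<alpha> s" using u(1) s(3) by (metis act_simps(4) minus_minus)
        then have "\<xi> = - \<alpha> s" using u(1) by simp
        then show False using x(1) pos_simple[OF s(1)] pos_not_neg by blast
      qed
      then have "pos (act p (- act (inv u) \<xi>))" using gen_permutes_pos x(2) u(2) by blast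
      moreover have "act (inv u) (act s \<xi>) = act p (act (inv u) \<xi>)"
      proof -
        have "B (\<alpha> p) (act (inv u) \<xi>) = B (\<alpha> s) \<xi>"
          using form_act[of u "\<alpha> p" "act (inv u) \<xi>"] u(1) s(3) by simp
        then show ?thesis using s(1) u(1,2) by (simp add: act_gen iu)
      qed
      ultimately show ?thesis using u(2) gens_closed by simp
    qed
    ultimately have "0 < B (act s \<xi>) (act s \<delta>)" using xi by blast
    then show ?thesis using sc by simp
  qed
  ultimately show ?thesis unfolding rank_two_position_def using u ab(2) by blast
qed

text \<open>Reflect \<delta> in simple roots with positive product until it becomes simple; the last
  reflection gives a plane of two simple roots. On the way back \<open>u\<close> becomes
  \<open>s \<otimes> u\<close>, unless \<alpha> s is already one of the two spanning roots.\<close>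

lemma rank_two_position_exists:
  assumes "pos \<delta>" "\<delta> \<notin> \<alpha> ` S"
  shows "\<exists>u p q. rank_two_position \<delta> u p q"
  using assms
proof (induction "depth \<delta>" arbitrary: \<delta> rule: less_induct)
  case less
  obtain s where s: "s \<in> S" "0 < B (\<alpha> s) \<delta>" using exists_pos_form_simple less.prems by blast
  have sc: "s \<in> carrier W" using gens_closed s by blast
  have ne: "\<delta> \<noteq> \<alpha> s" using less.prems s by blast
  define k where "k = 2 * B (\<alpha> s) \<delta>"
  have k: "0 < k" using s by (simp add: k_def)
  have dk: "\<delta> = act s \<delta> + k *\<^sub>R \<alpha> s" using s(1) by (simp add: act_gen k_def)
  have p1: "pos (act s \<delta>)" "depth (act s \<delta>) < depth \<delta>"
    using gen_permutes_pos depth_gen_less less.prems s ne by blast+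
  show ?case
  proof (cases "act s \<delta> \<in> \<alpha> ` S")
    case True
    then obtain t where t: "t \<in> S" "act s \<delta> = \<alpha> t" by blast
    have "t \<noteq> s"
    proof
      assume "t = s"
      then have "\<delta> = - \<alpha> s" using t s(1) act_gen_gen[of s \<delta>] act_gen_simple by metis
      then show False using less.prems(1) pos_simple[OF s(1)] pos_not_neg by blast
    qed
    moreover have "\<delta> = 1 *\<^sub>R act \<one> (\<alpha> t) + k *\<^sub>R act \<one> (\<alpha> s)" using dk t(2) by simp
    moreover have "False" if "pos \<xi>" "neg (act (inv \<one>) \<xi>)" for \<xi>
      using that pos_not_neg by simp
    ultimately have "rank_two_position \<delta> \<one> t s"
      unfolding rank_two_position_def using t s k pos_simple
      by (metis act_one one_closed zero_less_one)
    then show ?thesis by blast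
  next
    case False
    then obtain u p q where r: "rank_two_position (act s \<delta>) u p q" using less.hyps p1 by blast
    have u: "u \<in> carrier W" "p \<in> S" "q \<in> S" "p \<noteq> q" "pos (act u (\<alpha> p))" "pos (act u (\<alpha> q))"
      and xi: "\<And>\<xi>. pos \<xi> \<Longrightarrow> neg (act (inv u) \<xi>) \<Longrightarrow> 0 < B \<xi> (act s \<delta>)"
      using r unfolding rank_two_position_def by blast+
    obtain a b where ab: "0 < a" "0 < b" "act s \<delta> = a *\<^sub>R act u (\<alpha> p) + b *\<^sub>R act u (\<alpha> q)"
      using r unfolding rank_two_position_def by blast
    consider "act u (\<alpha> p) = \<alpha> s" | "act u (\<alpha> q) = \<alpha> s" | "act u (\<alpha> p) \<noteq> \<alpha> s" "act u (\<alpha> q) \<noteq> \<alpha> s" by blast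
    then show ?thesis
    proof cases
      case 1 then show ?thesis using rank_two_position_merge[OF r s] by blast
    next
      case 2 then show ?thesis using rank_two_position_merge[OF rank_two_position_swap[OF r] s] by blast
    next
      case 3
      have "pos (act (s \<otimes> u) (\<alpha> p))" "pos (act (s \<otimes> u) (\<alpha> q))"
        using gen_permutes_pos[OF u(5) s(1) 3(1)] gen_permutes_pos[OF u(6) s(1) 3(2)] u(1) sc by simp_all
      moreover have "\<delta> = a *\<^sub>R act (s \<otimes> u) (\<alpha> p) + b *\<^sub>R act (s \<otimes> u) (\<alpha> q)"
        using arg_cong[OF ab(3), of "act s"] s(1) sc u(1) by simp
      moreover have "0 < B \<xi> \<delta>" if x: "pos \<xi>" "neg (act (inv (s \<otimes> u)) \<xi>)" for \<xi>
      proof (cases "\<xi> = \<alpha> s")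
        case True then show ?thesis using s by simp
      next
        case False
        then have "pos (act s \<xi>)" using gen_permutes_pos x(1) s(1) by blast
        moreover have "neg (act (inv u) (act s \<xi>))"
          using x(2) u(1) sc s(1) by (simp add: inv_mult_group gens_inv)
        ultimately have "0 < B (act s \<xi>) (act s \<delta>)" using xi by blast
        then show ?thesis using sc by simp
      qed
      ultimately have "rank_two_position \<delta> (s \<otimes> u) p q"
        unfolding rank_two_position_def using u(1-4) sc ab(1,2) by blast
      then show ?thesis by blast
    qed
  qed
qed

lemma rank_two_position_not_simple:
  assumes "rank_two_position \<delta> u p q" "s \<in> S"
  shows "\<delta> \<noteq> \<alpha> s"
proof
  assume e: "\<delta> = \<alpha> s"
  obtain a b where ab: "0 < a" "0 < b" "\<delta> = a *\<^sub>R act u (\<alpha> p) + b *\<^sub>R act u (\<alpha> q)"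
    using assms unfolding rank_two_position_def by blast
  have u: "u \<in> carrier W" "p \<in> S" "q \<in> S" "p \<noteq> q" "pos (act u (\<alpha> p))" "pos (act u (\<alpha> q))"
    using assms unfolding rank_two_position_def by blast+
  have "a *\<^sub>R act u (\<alpha> p) + b *\<^sub>R act u (\<alpha> q) = 1 *\<^sub>R \<alpha> s" using ab(3) e by simp
  from simple_root_extreme_roots[OF u(5,6) ab(1,2) assms(2) this]
  have "act u (\<alpha> p) = act u (\<alpha> q)" by simp
  then have "\<alpha> p = \<alpha> q" using u(1) by (metis act_inv_cancel(1))
  then show False using simple_root_inj u by blast
qed

lemma depth_pos: "pos \<beta> \<Longrightarrow> 0 < depth \<beta>"
  by (rule depth_step) auto

lemma depth_simple_less:
  assumes "pos \<delta>" "\<And>t. t \<in> S \<Longrightarrow> \<delta> \<noteq> \<alpha> t" "s \<in> S"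
  shows "depth (\<alpha> s) < depth \<delta>"
proof -
  have "depth (\<alpha> s) \<le> lg s"
    using assms(3) gens_closed by (intro depth_le) (simp_all add: gens_inv act_gen_simple pos_simple)
  then have "depth (\<alpha> s) \<le> 1" using assms(3) by simp
  moreover obtain t where t: "t \<in> S" "0 < B (\<alpha> t) \<delta>" using exists_pos_form_simple assms(1) by blast
  have "0 < depth (act t \<delta>)" "depth (act t \<delta>) < depth \<delta>"
    using depth_pos gen_permutes_pos depth_gen_less assms(1,2) t by blast+
  ultimately show ?thesis by linarith
qed

lemma simple_short_inversion_iff:
  assumes "y \<in> carrier W" "s \<in> S"
  shows "\<alpha> s \<in> short_inversions W y \<longleftrightarrow> neg (act (inv y) (\<alpha> s))"
  unfolding short_inversions_iff rf_simple[OF assms(2)] left_ascent_iff(2)[OF assms, symmetric]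
  using length_gen_mult_cases[OF assms(2,1)] pos_simple assms by auto

lemma rank_two_position_peel:
  assumes r: "rank_two_position \<delta> u p q" and s: "s \<in> S" "neg (act (inv u) (\<alpha> s))"
  shows "rank_two_position (act s \<delta>) (s \<otimes> u) p q"
proof -
  have u: "u \<in> carrier W" "p \<in> S" "q \<in> S" "p \<noteq> q" "pos (act u (\<alpha> p))" "pos (act u (\<alpha> q))"
    and xi: "\<And>\<xi>. pos \<xi> \<Longrightarrow> neg (act (inv u) \<xi>) \<Longrightarrow> 0 < B \<xi> \<delta>"
    using r unfolding rank_two_position_def by blast+
  obtain a b where ab: "0 < a" "0 < b" "\<delta> = a *\<^sub>R act u (\<alpha> p) + b *\<^sub>R act u (\<alpha> q)"
    using r unfolding rank_two_position_def by blast
  have sc: "s \<in> carrier W" using gens_closed s by blast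
  have ne: "act u (\<alpha> x) \<noteq> \<alpha> s" if "x \<in> S" for x
    using s(2) u(1) pos_simple[OF that] pos_not_neg by (metis act_inv_cancel(1))
  have "pos (act (s \<otimes> u) (\<alpha> p))" "pos (act (s \<otimes> u) (\<alpha> q))"
    using gen_permutes_pos[OF u(5) s(1) ne[OF u(2)]] gen_permutes_pos[OF u(6) s(1) ne[OF u(3)]] u(1) sc
    by simp_all
  moreover have "act s \<delta> = a *\<^sub>R act (s \<otimes> u) (\<alpha> p) + b *\<^sub>R act (s \<otimes> u) (\<alpha> q)"
    using arg_cong[OF ab(3), of "act s"] sc u(1) by simp
  moreover have "0 < B \<xi> (act s \<delta>)" if x: "pos \<xi>" "neg (act (inv (s \<otimes> u)) \<xi>)" for \<xi>
  proof -
    have xs: "neg (act (inv u) (act s \<xi>))"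
      using x(2) u(1) sc s(1) by (simp add: inv_mult_group gens_inv)
    have "\<xi> \<noteq> \<alpha> s"
    proof
      assume "\<xi> = \<alpha> s"
      then show False using xs s u(1) pos_not_neg by (simp add: act_gen_simple)
    qed
    then have "pos (act s \<xi>)" using gen_permutes_pos x(1) s(1) by blast
    then have "0 < B (act s \<xi>) \<delta>" using xi xs by blast
    then show ?thesis using form_act[OF sc, of "act s \<xi>" \<delta>] s(1) by simp
  qed
  ultimately show ?thesis unfolding rank_two_position_def using u(1-4) sc ab(1,2) by blast
qed

text \<open>Strip left descents \<open>s\<close> off \<open>u\<close>, passing from \<open>y\<close> and \<open>\<delta>\<close> to \<open>s y\<close> and \<open>s(\<delta>)\<close>, until \<open>s\<close> is a descent of \<open>y\<close>
  or \<open>u\<close> is used up.\<close>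

lemma short_inversion_step:
  assumes "y \<in> carrier W" "\<delta> \<in> short_inversions W y" "rank_two_position \<delta> u p q"
  shows "\<exists>\<gamma> \<in> short_inversions W y. depth \<gamma> < depth \<delta> \<and>
    dp (- act (inv y) \<delta>) \<le> dp (- act (inv y) \<gamma>) \<and>
    (neg (act (inv u) \<gamma>) \<or> \<gamma> = act u (\<alpha> p) \<or> \<gamma> = act u (\<alpha> q))"
  using assms
proof (induction "lg u" arbitrary: y \<delta> u rule: less_induct)
  case less
  note y = less.prems(1) and d = less.prems(2) and r = less.prems(3)
  have u: "u \<in> carrier W" "p \<in> S" "q \<in> S" "p \<noteq> q" "pos (act u (\<alpha> p))" "pos (act u (\<alpha> q))"
    and xi: "\<And>\<xi>. pos \<xi> \<Longrightarrow> neg (act (inv u) \<xi>) \<Longrightarrow> 0 < B \<xi> \<delta>"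
    using r unfolding rank_two_position_def by blast+
  obtain a b where ab: "0 < a" "0 < b" "\<delta> = a *\<^sub>R act u (\<alpha> p) + b *\<^sub>R act u (\<alpha> q)"
    using r unfolding rank_two_position_def by blast
  have pd: "pos \<delta>" "neg (act (inv y) \<delta>)" using short_inversion_inverted y d by auto
  have ns: "\<delta> \<noteq> \<alpha> t" if "t \<in> S" for t using rank_two_position_not_simple r that by blast
  have simple: "\<alpha> s \<in> short_inversions W y \<and> depth (\<alpha> s) < depth \<delta> \<and>
      dp (- act (inv y) \<delta>) \<le> dp (- act (inv y) (\<alpha> s))"
    if "s \<in> S" "neg (act (inv y) (\<alpha> s))" "pos \<eta>" "0 < a" "0 < b" "\<delta> = a *\<^sub>R \<alpha> s + b *\<^sub>R \<eta>" for s \<eta> a b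
    using dp_descent_le[OF y that(1,2) d that(3-6)] simple_short_inversion_iff[OF y that(1)]
      depth_simple_less[OF pd(1) ns that(1)] that(2) by blast
  show ?case
  proof (cases "u = \<one>")
    case True
    have e: "\<delta> = a *\<^sub>R \<alpha> p + b *\<^sub>R \<alpha> q" using ab(3) True by simp
    then have e': "\<delta> = b *\<^sub>R \<alpha> q + a *\<^sub>R \<alpha> p" by (simp add: add.commute)
    have iy: "inv y \<in> carrier W" using y by simp
    have "neg (act (inv y) (\<alpha> p)) \<or> neg (act (inv y) (\<alpha> q))"
    proof (rule ccontr)
      assume n: "\<not> ?thesis"
      then have n: "pos (act (inv y) (\<alpha> p))" "pos (act (inv y) (\<alpha> q))"
        using root_cases root_act[OF root_simple iy] u(2,3) by blast+
      have "act (inv y) \<delta> = a *\<^sub>R act (inv y) (\<alpha> p) + b *\<^sub>R act (inv y) (\<alpha> q)"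
        by (subst e) (use iy in simp)
      then have "pos (act (inv y) \<delta>)"
        by (rule pos_comb_eq) (use n ab root_act[OF pos_root[OF pd(1)] iy] in auto)
      then show False using pd(2) pos_not_neg by blast
    qed
    then show ?thesis
      using simple[OF u(2) _ pos_simple[OF u(3)] ab(1,2) e] simple[OF u(3) _ pos_simple[OF u(2)] ab(2,1) e'] True
      by auto
  next
    case False
    then obtain s where s: "s \<in> S" "lg (s \<otimes> u) < lg u" using exists_left_descent u(1) by blast
    have sc: "s \<in> carrier W" using gens_closed s by blast
    have su: "neg (act (inv u) (\<alpha> s))" using left_ascent_iff(2) u(1) s by blast
    have k: "0 < B (\<alpha> s) \<delta>" using xi pos_simple s su by blast
    have sd: "pos (act s \<delta>)" "depth (act s \<delta>) < depth \<delta>"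
      using gen_permutes_pos depth_gen_less pd ns s k by blast+
    show ?thesis
    proof (cases "neg (act (inv y) (\<alpha> s))")
      case True
      have "\<delta> = (2 * B (\<alpha> s) \<delta>) *\<^sub>R \<alpha> s + 1 *\<^sub>R act s \<delta>" using s(1) by (simp add: act_gen)
      from simple[OF s(1) True sd(1) _ _ this] show ?thesis using k su by auto
    next
      case False
      have iy: "inv y \<in> carrier W" using y by simp
      have py: "pos (act (inv y) (\<alpha> s))" using False root_cases root_act[OF root_simple iy] s(1) by blast
      have ly: "lg (s \<otimes> y) = lg y + 1"
        using left_ascent_iff(1)[OF y s(1)] py length_gen_mult_cases[OF s(1) y] by linarith
      have sy: "s \<otimes> y \<in> carrier W" using sc y by simp
      have isy: "act (inv (s \<otimes> y)) v = act (inv y) (act s v)" for v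
        using sc y s(1) by (simp add: inv_mult_group gens_inv)
      have isu: "act (inv (s \<otimes> u)) v = act (inv u) (act s v)" for v
        using sc u(1) s(1) by (simp add: inv_mult_group gens_inv)
      have conj: "rf (act s \<beta>) \<otimes> (s \<otimes> y) = s \<otimes> (rf \<beta> \<otimes> y)" if "rt \<beta>" for \<beta>
        using that sc s(1) y by (simp add: rf_conj m_assoc gens_inv)
      have rd: "rt \<delta>" using pd pos_root by blast
      \<comment> \<open>Positivity of \<open>B (\<alpha> s) \<delta>\<close> makes \<open>s\<close>
        an ascent of \<open>rf \<delta> \<otimes> y\<close> as it is of \<open>y\<close>. Both
        lengths grow by one, so the inversion remains short.\<close>
      have "act s \<delta> \<in> short_inversions W (s \<otimes> y)"
      proof -
        have "act (inv (rf \<delta> \<otimes> y)) (\<alpha> s) = 1 *\<^sub>R act (inv y) (\<alpha> s) + (2 * B \<delta> (\<alpha> s)) *\<^sub>R (- act (inv y) \<delta>)"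
          using rd y by (simp add: inv_mult_group act_rf)
        then have "pos (act (inv (rf \<delta> \<otimes> y)) (\<alpha> s))"
        proof (rule pos_comb_eq)
          show "rt (act (inv (rf \<delta> \<otimes> y)) (\<alpha> s))" using rd y s(1) by (intro root_act root_simple) auto
          show "0 \<le> 2 * B \<delta> (\<alpha> s)" using k form_sym[of \<delta>] by simp
        qed (use py pd in auto)
        then have "lg (rf \<delta> \<otimes> y) < lg (s \<otimes> (rf \<delta> \<otimes> y))"
          using left_ascent_iff(1)[of "rf \<delta> \<otimes> y" s] rd y s(1) by simp
        then have "lg (s \<otimes> (rf \<delta> \<otimes> y)) = lg (rf \<delta> \<otimes> y) + 1"
          using length_gen_mult_cases[OF s(1), of "rf \<delta> \<otimes> y"] rd y by auto
        then show ?thesis using d sd(1) ly unfolding short_inversions_iff conj[OF rd] by simp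
      qed
      from less.hyps[OF s(2) sy this rank_two_position_peel[OF r s(1) su]]
      obtain \<gamma>' where g: "\<gamma>' \<in> short_inversions W (s \<otimes> y)" "depth \<gamma>' < depth (act s \<delta>)"
        "dp (- act (inv y) \<delta>) \<le> dp (- act (inv y) (act s \<gamma>'))"
        "neg (act (inv u) (act s \<gamma>')) \<or> \<gamma>' = act s (act u (\<alpha> p)) \<or> \<gamma>' = act s (act u (\<alpha> q))"
        unfolding isy isu using s(1) sc u(1) by auto
      define \<gamma> where "\<gamma> = act s \<gamma>'"
      have gs: "\<gamma>' = act s \<gamma>" using s(1) by (simp add: \<gamma>_def)
      have pg: "pos \<gamma>'" "neg (act (inv (s \<otimes> y)) \<gamma>')" using short_inversion_inverted[OF sy g(1)] by auto
      have gu: "neg (act (inv u) \<gamma>) \<or> \<gamma> = act u (\<alpha> p) \<or> \<gamma> = act u (\<alpha> q)"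
        using g(4) s(1) by (auto simp: \<gamma>_def)
      \<comment> \<open>This is the purpose of the last clause of the claim: it excludes the one
        positive root that \<open>s\<close> would make negative, so \<gamma> is positive.\<close>
      have "\<gamma>' \<noteq> \<alpha> s"
      proof
        assume "\<gamma>' = \<alpha> s"
        then have ga: "\<gamma> = - \<alpha> s" using s(1) by (simp add: \<gamma>_def act_gen_simple)
        have "pos (- act (inv u) (\<alpha> s))" "pos (\<alpha> s)" using su pos_simple s(1) by auto
        then show False using gu u(1,5,6) pos_not_neg[of "\<alpha> s"] pos_not_neg[of "- act (inv u) (\<alpha> s)"]
          unfolding ga by auto
      qed
      then have pgg: "pos \<gamma>" using gen_permutes_pos pg(1) s(1) unfolding \<gamma>_def by blast
      have rg: "rt \<gamma>" using pgg pos_root by blast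
      have "neg (act (inv y) \<gamma>)" using pg(2) unfolding isy by (simp add: \<gamma>_def)
      then have "lg (rf \<gamma> \<otimes> y) < lg y" using reflection_shortens_iff[OF y pgg] by blast
      moreover have "lg (s \<otimes> (rf \<gamma> \<otimes> y)) + 1 = lg (s \<otimes> y)"
        using g(1) unfolding short_inversions_iff gs conj[OF rg] by blast
      ultimately have "lg (rf \<gamma> \<otimes> y) + 1 = lg y"
        using length_gen_mult_cases[OF s(1), of "rf \<gamma> \<otimes> y"] rg y ly by auto
      then have "\<gamma> \<in> short_inversions W y" using pgg by (simp add: short_inversions_iff)
      \<comment> \<open>Undoing \<open>s\<close> may raise the depth by one, which the drop from
        \<delta> to \<open>act s \<delta>\<close> compensates.\<close>
      moreover have "depth \<gamma> < depth \<delta>"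
        using depth_gen_le[OF pg(1) s(1)] g(2) sd(2) by (simp add: \<gamma>_def)
      ultimately show ?thesis using g(3) gu unfolding \<gamma>_def[symmetric] by blast
    qed
  qed
qed

lemma short_inversion_le_simple:
  assumes "y \<in> carrier W" "\<delta> \<in> short_inversions W y"
  shows "\<exists>s \<in> S. \<alpha> s \<in> short_inversions W y \<and> dp (- act (inv y) \<delta>) \<le> dp (- act (inv y) (\<alpha> s))"
  using assms(2)
proof (induction "depth \<delta>" arbitrary: \<delta> rule: less_induct)
  case less
  show ?case
  proof (cases "\<delta> \<in> \<alpha> ` S")
    case True then show ?thesis using less.prems by blast
  next
    case False
    then obtain u p q where "rank_two_position \<delta> u p q"
      using rank_two_position_exists less.prems short_inversions_iff by blast
    from short_inversion_step[OF assms(1) less.prems this]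
    obtain \<gamma> where "\<gamma> \<in> short_inversions W y" "depth \<gamma> < depth \<delta>"
      "dp (- act (inv y) \<delta>) \<le> dp (- act (inv y) \<gamma>)" by blast
    with less.hyps[of \<gamma>] show ?thesis using le_trans by blast
  qed
qed

section \<open>From simple short inversions to right-descent roots and low elements\<close>

lemma right_descent_root_short:
  assumes "w \<in> carrier W" "\<gamma> \<in> right_descent_roots W w"
  shows "\<gamma> \<in> short_inversions W w"
proof -
  obtain s where s: "s \<in> S" "lg (w \<otimes> s) < lg w" "\<gamma> = - act w (\<alpha> s)"
    using assms(2) unfolding right_descent_roots_def by blast
  have "pos \<gamma>" using ascent_iff(2) assms(1) s by simp
  moreover have "rf \<gamma> \<otimes> w = w \<otimes> s"
    using s(1,3) assms(1) gens_closed root_act[OF root_simple]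
    by (simp add: rf_neg root_reflection_act m_assoc)
  ultimately show ?thesis
    using length_mult_gen_cases[OF s(1) assms(1)] s(2) by (simp add: short_inversions_iff)
qed

lemma short_inversion_le_descent:
  assumes w: "w \<in> carrier W" and b: "\<beta> \<in> short_inversions W w"
  shows "\<exists>\<gamma> \<in> right_descent_roots W w. dp \<beta> \<le> dp \<gamma>"
proof -
  have pb: "pos \<beta>" "neg (act (inv w) \<beta>)" using short_inversion_inverted w b by auto
  have rb: "rt \<beta>" using pb pos_root by blast
  define \<delta> where "\<delta> = - act (inv w) \<beta>"
  have "rf \<delta> \<otimes> inv w = inv (rf \<beta> \<otimes> w)"
    using w rb root_act[OF rb, of "inv w"] by (simp add: \<delta>_def rf_neg rf_conj m_assoc inv_mult_group)
  then have "lg (rf \<delta> \<otimes> inv w) + 1 = lg (inv w)"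
    using b w rb by (simp add: length_inv short_inversions_iff)
  then have "\<delta> \<in> short_inversions W (inv w)" using pb(2) by (simp add: short_inversions_iff \<delta>_def)
  from short_inversion_le_simple[OF inv_closed[OF w] this]
  obtain s where s: "s \<in> S" "\<alpha> s \<in> short_inversions W (inv w)"
    and le: "dp (- act (inv (inv w)) \<delta>) \<le> dp (- act (inv (inv w)) (\<alpha> s))" by blast
  have "dp \<beta> \<le> dp (- act w (\<alpha> s))" using le w by (simp add: \<delta>_def)
  note s = s this
  have "neg (act w (\<alpha> s))" using short_inversion_inverted[OF _ s(2)] w by simp
  then have "lg (w \<otimes> s) < lg w" using ascent_iff(2) w s(1) by blast
  then have "- act w (\<alpha> s) \<in> right_descent_roots W w" using s(1) unfolding right_descent_roots_def by blast
  then show ?thesis using s(3) by blast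
qed

lemma finite_right_descent_roots:
  assumes "w \<in> carrier W"
  shows "finite (right_descent_roots W w)"
proof (rule finite_subset[OF _ finite_inverted])
  show "right_descent_roots W w \<subseteq> {r. pos r \<and> neg (act (inv w) r)}"
    using right_descent_root_short[OF assms] short_inversion_inverted[OF assms] by blast
qed (use assms in simp)

lemma dp_short_inversion_le_max:
  assumes "w \<in> carrier W" "\<beta> \<in> short_inversions W w"
  shows "dp \<beta> \<le> max_descent_depth W w"
proof -
  obtain \<gamma> where g: "\<gamma> \<in> right_descent_roots W w" "dp \<beta> \<le> dp \<gamma>"
    using short_inversion_le_descent[OF assms] by blast
  then have "dp \<gamma> \<le> max_descent_depth W w"
    using finite_right_descent_roots[OF assms(1)] by (auto simp: max_descent_depth_def)
  then show ?thesis using g by simp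
qed

lemma max_descent_depth_attained:
  assumes "w \<in> carrier W" "right_descent_roots W w \<noteq> {}"
  shows "\<exists>\<gamma> \<in> right_descent_roots W w. dp \<gamma> = max_descent_depth W w"
proof -
  have "Max (dp ` right_descent_roots W w) \<in> dp ` right_descent_roots W w"
    using finite_right_descent_roots[OF assms(1)] assms(2) by (intro Max_in) auto
  then show ?thesis using assms(2) by (auto simp: max_descent_depth_def)
qed

lemma low_elements_iff:
  assumes "w \<in> carrier W"
  shows "w \<in> low_elements W m \<longleftrightarrow> max_descent_depth W w \<le> m"
proof
  assume "w \<in> low_elements W m"
  then have le: "dp \<beta> \<le> m" if "\<beta> \<in> short_inversions W w" for \<beta>
    using that by (auto simp: low_elements_def small_roots_def)
  show "max_descent_depth W w \<le> m"
  proof (cases "right_descent_roots W w = {}")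
    case True then show ?thesis by (simp add: max_descent_depth_def)
  next
    case False
    then show ?thesis using max_descent_depth_attained[OF assms] right_descent_root_short[OF assms] le by metis
  qed
next
  assume "max_descent_depth W w \<le> m"
  then show "w \<in> low_elements W m"
    using dp_short_inversion_le_max[OF assms] assms
    by (fastforce simp: low_elements_def small_roots_def short_inversions_iff)
qed

end

theorem theorem4p8:
  fixes W :: "('g, 'v::real_vector) coxeter_rep" and w :: 'g
  assumes "geometric_representation W"
    and "w \<in> carrier W"
  shows "(\<forall>\<beta> \<in> short_inversions W w. dominance_depth W \<beta> \<le> max_descent_depth W w) \<and>
    (short_inversions W w \<noteq> {} \<longrightarrow>
      (\<exists>\<gamma> \<in> right_descent_roots W w. \<gamma> \<in> short_inversions W w \<and>
        (\<forall>\<beta> \<in> short_inversions W w. dominance_depth W \<beta> \<le> dominance_depth W \<gamma>))) \<and>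
    w \<in> low_elements W (max_descent_depth W w) \<and>
    (\<forall>m::nat. w \<in> low_elements W m \<longleftrightarrow> m \<ge> max_descent_depth W w)"
proof (intro conjI impI)
  interpret geometric_representation W by (rule assms(1))
  note w = assms(2)
  show "\<forall>\<beta> \<in> short_inversions W w. dominance_depth W \<beta> \<le> max_descent_depth W w"
    using dp_short_inversion_le_max[OF w] by blast
  show "w \<in> low_elements W (max_descent_depth W w)"
    and "\<forall>m::nat. w \<in> low_elements W m \<longleftrightarrow> m \<ge> max_descent_depth W w"
    using low_elements_iff[OF w] by auto
  assume "short_inversions W w \<noteq> {}"
  then have "right_descent_roots W w \<noteq> {}" using short_inversion_le_descent[OF w] by blast
  then obtain \<gamma> where "\<gamma> \<in> right_descent_roots W w" "dominance_depth W \<gamma> = max_descent_depth W w"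
    using max_descent_depth_attained[OF w] by blast
  then show "\<exists>\<gamma> \<in> right_descent_roots W w. \<gamma> \<in> short_inversions W w \<and>
      (\<forall>\<beta> \<in> short_inversions W w. dominance_depth W \<beta> \<le> dominance_depth W \<gamma>)"
    using right_descent_root_short[OF w] dp_short_inversion_le_max[OF w] by metis
qed

end
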